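(* Let $G$ be an $m$-uniform hypergraph whose connected components are properly connected. If $c$ is the number of connected components of $G$ and $j(I(G))\neq0$, then $$j(I(G))=m^c\, e(\Bbbk[G]).$$
   Context: A hypergraph $G$ has a finite non-empty node set $V(G)=\{x_1,\dots,x_n\}$ and an edge set $E(G)$ consisting of subsets of $V(G)$; it is $m$-uniform ($m\ge1$) if every edge has exactly $m$ elements. $G$ is connected if any two nodes can be joined by a sequence of edges, the first containing one node and the last the other, with consecutive edges sharing a node. An $m$-uniform hypergraph is properly connected if for any two edges $u,v$ there is a sequence of edges starting with $u$ and ending with $v$ such that consecutive edges intersect in exactly $m-1$ nodes. Hypergraphs are assumed to have no isolated nodes (nodes lying in no edge); this is automatic when $j(I(G))\ne0$. Fix a field $\Bbbk$ and view nodes as indeterminates. The edge ideal is $I(G)=(x_{i_1}\cdots x_{i_m}:\{x_{i_1},\dots,x_{i_m}\}\in E(G))\subset R=\Bbbk[x_1,\dots,x_n]_{(x_1,\dots,x_n)}$. The edge subring $\Bbbk[G]$ is the $\Bbbk$-subalgebra generated by the monomials $x_{i_1}\cdots x_{i_m}$ with $\{x_{i_1},\dots,x_{i_m}\}\in E(G)$, regarded as a standard graded algebra by giving these generators degree $1$; $e(\Bbbk[G])$ is its Hilbert–Samuel multiplicity with respect to this grading. For an ideal $I$ in a Noetherian local ring $(R,\mathfrak m)$ of dimension $n\ge1$, the $j$-multiplicity is $j(I)=(n-1)!\lim_{t\to\infty}\lambda_R(\Gamma_{\mathfrak m}(I^t/I^{t+1}))/t^{n-1}$, where $\lambda_R$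 is length and $\Gamma_{\mathfrak m}$ is the zeroth local cohomology. *)

theory Defs
  imports
    Complex_Main
    "HOL-Library.Poly_Mapping"
    "HOL-Library.Extended_Nat"
    "HOL-Library.Multiset"
    "HOL-Algebra.Ideal_Product"
    "HOL-Algebra.Generated_Rings"
    "HOL-Algebra.Module"
    "HOL-Algebra.QuotRing"
begin

section \<open>Hypergraphs\<close>

record 'v hypergraph =
  nodes :: "'v set"
  edges :: "'v set set"

definition hypergraph :: "'v hypergraph \<Rightarrow> bool"
  where "hypergraph G \<longleftrightarrow> finite (nodes G) \<and> nodes G \<noteq> {} \<and> (\<forall>e\<in>edges G. e \<subseteq> nodes G)"

definition no_isolated_nodes :: "'v hypergraph \<Rightarrow> bool"
  where "no_isolated_nodes G \<longleftrightarrow> (\<forall>x\<in>nodes G. \<exists>e\<in>edges G. x \<in> e)"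

definition uniform :: "nat \<Rightarrow> 'v hypergraph \<Rightarrow> bool"
  where "uniform m G \<longleftrightarrow> 1 \<le> m \<and> (\<forall>e\<in>edges G. card e = m)"

definition connected_hypergraph :: "'v hypergraph \<Rightarrow> bool"
  where "connected_hypergraph G \<longleftrightarrow>
    (\<forall>x\<in>nodes G. \<forall>y\<in>nodes G. x \<noteq> y \<longrightarrow>
      (\<exists>es. es \<noteq> [] \<and> set es \<subseteq> edges G \<and> x \<in> hd es \<and> y \<in> last es \<and>
            successively (\<lambda>e f. e \<inter> f \<noteq> {}) es))"

definition properly_connected :: "nat \<Rightarrow> 'v hypergraph \<Rightarrow> bool"
  where "properly_connected m G \<longleftrightarrow>
    (\<forall>u\<in>edges G. \<forall>v\<in>edges G.
      \<exists>es. es \<noteq> [] \<and> set es \<subseteq> edges G \<and> hd es = u \<and> last es = v \<and>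
           successively (\<lambda>e f. card (e \<inter> f) = m - 1) es)"

definition induced :: "'v hypergraph \<Rightarrow> 'v set \<Rightarrow> 'v hypergraph"
  where "induced G U = \<lparr>nodes = U, edges = {e \<in> edges G. e \<subseteq> U}\<rparr>"

definition connected_components :: "'v hypergraph \<Rightarrow> 'v hypergraph set"
  where "connected_components G =
    {induced G U | U. U \<subseteq> nodes G \<and> U \<noteq> {} \<and> connected_hypergraph (induced G U) \<and>
       (\<forall>W. U \<subset> W \<and> W \<subseteq> nodes G \<longrightarrow> \<not> connected_hypergraph (induced G W))}"


section \<open>Commutative algebra\<close>

subsection \<open>Krull dimension\<close>

text \<open>A chain is a strictly increasing list; a list with \<open>l + 1\<close> entries is a chain of length \<open>l\<close>.\<close>

definition krull_dim :: "('a, 'b) ring_scheme \<Rightarrow> enat"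
  where "krull_dim R =
    (SUP Ps \<in> {Ps. Ps \<noteq> [] \<and> (\<forall>P\<in>set Ps. primeideal P R) \<and> sorted_wrt (\<subset>) Ps}.
       enat (length Ps - 1))"


subsection \<open>Modules: length, quotients, zeroth local cohomology\<close>

definition module_length :: "('a, 'r) ring_scheme \<Rightarrow> ('a, 'b, 'm) module_scheme \<Rightarrow> enat"
  where "module_length R M =
    (SUP Ns \<in> {Ns. Ns \<noteq> [] \<and> (\<forall>N\<in>set Ns. submodule N R M) \<and> sorted_wrt (\<subset>) Ns}.
       enat (length Ns - 1))"

definition ideal_module :: "('a, 'b) ring_scheme \<Rightarrow> 'a set \<Rightarrow> ('a, 'a) module"
  where "ideal_module R J =
    \<lparr>carrier = J, monoid.mult = mult R, one = \<one>\<^bsub>R\<^esub>, zero = \<zero>\<^bsub>R\<^esub>, add = add R, smult = mult R\<rparr>"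

text \<open>The fields \<open>mult\<close> and \<open>one\<close> of a \<^typ>\<open>('a, 'b) module\<close> record play no role in the notion
  of a module; below they are given arbitrary values.\<close>

definition quotient_module ::
    "('a, 'b, 'm) module_scheme \<Rightarrow> 'b set \<Rightarrow> ('a, 'b set) module"
  where "quotient_module M N =
    \<lparr>carrier = a_rcosets\<^bsub>M\<^esub> N, monoid.mult = (\<lambda>X Y. N), one = N, zero = N, add = set_add M,
     smult = (\<lambda>a X. \<Union>x\<in>X. N +>\<^bsub>M\<^esub> (a \<odot>\<^bsub>M\<^esub> x))\<rparr>"

definition local_cohomology0 ::
    "('a, 'r) ring_scheme \<Rightarrow> 'a set \<Rightarrow> ('a, 'b, 'm) module_scheme \<Rightarrow> ('a, 'b, 'm) module_scheme"
  where "local_cohomology0 R J M =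
    M\<lparr>carrier := {x \<in> carrier M. \<exists>k::nat. \<forall>a \<in> J [^]\<^bsub>ideals_set R\<^esub> k. a \<odot>\<^bsub>M\<^esub> x = \<zero>\<^bsub>M\<^esub>}\<rparr>"


subsection \<open>The \<open>j\<close>-multiplicity of an ideal in a Noetherian local ring\<close>

definition the_maximal_ideal :: "('a, 'b) ring_scheme \<Rightarrow> 'a set"
  where "the_maximal_ideal R = (THE M. maximalideal M R)"

text \<open>For an ideal \<open>I\<close> of a Noetherian local ring of dimension \<open>n \<ge> 1\<close>.  All the lengths are then
  finite, since \<open>\<Gamma>\<^sub>\<mm>(M)\<close> is finitely generated and killed by a power of \<open>\<mm>\<close> when
  \<open>M\<close> is finitely generated.\<close>

definition j_multiplicity :: "('a, 'b) ring_scheme \<Rightarrow> 'a set \<Rightarrow> real"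
  where "j_multiplicity R I =
    (let n = the_enat (krull_dim R) in
      fact (n - 1) *
      lim (\<lambda>t. real (the_enat (module_length R
                (local_cohomology0 R (the_maximal_ideal R)
                  (quotient_module (ideal_module R (I [^]\<^bsub>ideals_set R\<^esub> t))
                                   (I [^]\<^bsub>ideals_set R\<^esub> Suc t)))))
             / real t ^ (n - 1)))"


subsection \<open>Localization\<close>

definition frac_rel :: "('a, 'b) ring_scheme \<Rightarrow> 'a set \<Rightarrow> (('a \<times> 'a) \<times> ('a \<times> 'a)) set"
  where "frac_rel R S =
    {((a, s), (b, t)). a \<in> carrier R \<and> s \<in> S \<and> b \<in> carrier R \<and> t \<in> S \<and>
       (\<exists>u\<in>S. u \<otimes>\<^bsub>R\<^esub> (t \<otimes>\<^bsub>R\<^esub> a) = u \<otimes>\<^bsub>R\<^esub> (s \<otimes>\<^bsub>R\<^esub> b))}"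

definition fraction :: "('a, 'b) ring_scheme \<Rightarrow> 'a set \<Rightarrow> 'a \<Rightarrow> 'a \<Rightarrow> ('a \<times> 'a) set"
  where "fraction R S a s = frac_rel R S `` {(a, s)}"

definition localization :: "('a, 'b) ring_scheme \<Rightarrow> 'a set \<Rightarrow> ('a \<times> 'a) set ring"
  where "localization R S =
    \<lparr>carrier = (carrier R \<times> S) // frac_rel R S,
     monoid.mult = (\<lambda>X Y. \<Union>(a, s)\<in>X. \<Union>(b, t)\<in>Y. fraction R S (a \<otimes>\<^bsub>R\<^esub> b) (s \<otimes>\<^bsub>R\<^esub> t)),
     one = fraction R S \<one>\<^bsub>R\<^esub> \<one>\<^bsub>R\<^esub>,
     zero = fraction R S \<zero>\<^bsub>R\<^esub> \<one>\<^bsub>R\<^esub>,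
     add = (\<lambda>X Y. \<Union>(a, s)\<in>X. \<Union>(b, t)\<in>Y.
              fraction R S ((t \<otimes>\<^bsub>R\<^esub> a) \<oplus>\<^bsub>R\<^esub> (s \<otimes>\<^bsub>R\<^esub> b)) (s \<otimes>\<^bsub>R\<^esub> t))\<rparr>"


section \<open>Polynomial rings\<close>

text \<open>Polynomials with indeterminates in \<^typ>\<open>'v\<close>: a monomial is its exponent function
  \<^typ>\<open>'v \<Rightarrow>\<^sub>0 nat\<close>.\<close>

type_synonym ('v, 'k) mpoly = "('v \<Rightarrow>\<^sub>0 nat) \<Rightarrow>\<^sub>0 'k"

definition var :: "'v \<Rightarrow> ('v, 'k::field) mpoly"
  where "var x = Poly_Mapping.single (Poly_Mapping.single x 1) 1"

definition const :: "'k::field \<Rightarrow> ('v, 'k) mpoly"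
  where "const c = Poly_Mapping.single 0 c"

interpretation mpoly: vector_space "\<lambda>(c::'k::field) (p::('v, 'k) mpoly). const c * p"
  by unfold_locales
     (simp_all add: const_def algebra_simps single_add mult_single flip: mult.assoc)

definition polynomial_ring :: "'k::field itself \<Rightarrow> 'v set \<Rightarrow> ('v, 'k) mpoly ring"
  where "polynomial_ring K V =
    \<lparr>carrier = {p. \<forall>a\<in>Poly_Mapping.keys p. Poly_Mapping.keys a \<subseteq> V},
     monoid.mult = (*), one = 1, zero = 0, add = (+)\<rparr>"

definition irrelevant_ideal :: "'k::field itself \<Rightarrow> 'v set \<Rightarrow> ('v, 'k) mpoly set"
  where "irrelevant_ideal K V = Idl\<^bsub>polynomial_ring K V\<^esub> (var ` V)"

definition units_at_origin :: "'k::field itself \<Rightarrow> 'v set \<Rightarrow> ('v, 'k) mpoly set"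
  where "units_at_origin K V = carrier (polynomial_ring K V) - irrelevant_ideal K V"

definition local_polynomial_ring ::
    "'k::field itself \<Rightarrow> 'v set \<Rightarrow> (('v, 'k) mpoly \<times> ('v, 'k) mpoly) set ring"
  where "local_polynomial_ring K V = localization (polynomial_ring K V) (units_at_origin K V)"


section \<open>Edge ideal and edge subring\<close>

definition edge_monomial :: "'v set \<Rightarrow> ('v, 'k::field) mpoly"
  where "edge_monomial e = (\<Prod>x\<in>e. var x)"

definition edge_ideal ::
    "'k::field itself \<Rightarrow> 'v hypergraph \<Rightarrow> (('v, 'k) mpoly \<times> ('v, 'k) mpoly) set set"
  where "edge_ideal K G =
    Idl\<^bsub>local_polynomial_ring K (nodes G)\<^esub>
      ((\<lambda>e. fraction (polynomial_ring K (nodes G)) (units_at_origin K (nodes G)) (edge_monomial e) 1)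
         ` edges G)"

definition edge_subring :: "'k::field itself \<Rightarrow> 'v hypergraph \<Rightarrow> ('v, 'k) mpoly ring"
  where "edge_subring K G =
    (polynomial_ring K (nodes G))
      \<lparr>carrier := generate_ring (polynomial_ring K (nodes G))
                   (range const \<union> edge_monomial ` edges G)\<rparr>"

definition edge_subring_component ::
    "'k::field itself \<Rightarrow> 'v hypergraph \<Rightarrow> nat \<Rightarrow> ('v, 'k) mpoly set"
  where "edge_subring_component K G t =
    mpoly.span {prod_mset M | M. set_mset M \<subseteq> edge_monomial ` edges G \<and> size M = t}"

text \<open>Multiplicity of a standard graded algebra \<open>A\<close> (a subalgebra of a polynomial ring)
  with graded components \<open>A\<^sub>t\<close>: for \<open>d = dim A \<ge> 1\<close> it is
  \<open>(d - 1)!\<close> times the coefficient of \<open>t\<^sup>d\<^sup>-\<^sup>1\<close> in the Hilbert polynomial of \<open>A\<close>, and for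
  \<open>d = 0\<close> it is the length of \<open>A\<close>.\<close>

definition graded_multiplicity ::
    "('v, 'k::field) mpoly ring \<Rightarrow> (nat \<Rightarrow> ('v, 'k) mpoly set) \<Rightarrow> real"
  where "graded_multiplicity A Gr =
    (let d = the_enat (krull_dim A) in
      if d = 0 then real (mpoly.dim (carrier A))
      else fact (d - 1) * lim (\<lambda>t. real (mpoly.dim (Gr t)) / real t ^ (d - 1)))"

definition edge_subring_multiplicity :: "'k::field itself \<Rightarrow> 'v hypergraph \<Rightarrow> real"
  where "edge_subring_multiplicity K G =
    graded_multiplicity (edge_subring K G) (edge_subring_component K G)"

end

theory Submission
  imports
    Defs
    "HOL-Library.Multiset_Order"
    "HOL-Library.Function_Algebras"
    "HOL-Computational_Algebra.Polynomial"
begin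

text \<open>
  Let \<open>S t\<close> be the set of exponent vectors of products of \<open>t\<close> edges.  The ideal \<open>I\<^sup>t\<close> is spanned by the
  monomials in \<open>N t = S t + \<nat>\<^sup>V\<close>, the component of degree \<open>t\<close> of the edge subring has dimension
  \<open>card (S t)\<close>, and the length of \<open>\<Gamma>\<^sub>\<mm>(I\<^sup>t/I\<^sup>t\<^sup>+\<^sup>1)\<close> is the number of elements of the set \<open>M t\<close> of
  those \<open>a \<in> N t - N (t + 1)\<close> that every sufficiently high power of every variable moves into
  \<open>N (t + 1)\<close>.

  The sequence \<open>card (S t)\<close> is eventually polynomial.  If the lattice spanned by the edges contains all differences
  of unit vectors of nodes of the same component, then it has index \<open>m\<^sup>c\<close> in \<open>\<int>\<^sup>V\<close>: its cosets are given by the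
  degrees modulo \<open>m\<close> on the components.  Up to bounded shifts \<open>M t\<close> consists of one
  translate of \<open>S t\<close> per coset, hence \<open>card (M t)\<close> grows like \<open>m\<^sup>c * card (S t)\<close>.  Otherwise some proper
  subset of a component meets all edges of that component in the same number of nodes, because
  consecutive edges of a proper path differ by an exchange of two linked nodes; then \<open>card (S t)\<close>
  and with it \<open>card (M t)\<close> grows too slowly and the \<open>j\<close>-multiplicity vanishes.
\<close>

section \<open>Dickson's lemma\<close>

text \<open>Both multiplicities are defined through \<open>lim\<close>, which carries information
  only for convergent sequences. Hence \<open>card (S t)\<close> is shown to be eventually
  polynomial, while \<open>card (M t)\<close> obtains its limit by a sandwich. The sandwich needs
  bounds uniform in \<open>t\<close>: by Dickson's lemma each element of \<open>M t\<close> is an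
  element of \<open>S t\<close> plus a vector from one finite set, so finitely many congruences
  modulo the lattice of edges serve all \<open>t\<close>. The lattice itself is never formed;
  negative parts are moved to the other side, so that every computation stays with exponent vectors
  over \<nat>. The two limits also have to be taken against the same power of \<open>t\<close>. The
  local ring has dimension \<open>card (nodes G)\<close>, and linking makes the edges span the full
  real space, so that the edge subring has this dimension too. Upper bounds for chains of primes
  come from algebraic dependence, lower bounds from coordinate ideals and from faces of the monoid
  of edges. Where linking fails, the count drops by a full power of \<open>t\<close>, which the
  hypothesis of a nonzero \<open>j\<close>-multiplicity excludes.\<close>

lemma nat_mono_subseq:
  fixes f :: "nat \<Rightarrow> nat"
  shows "\<exists>\<phi> :: nat \<Rightarrow> nat. strict_mono \<phi> \<and> mono (\<lambda>k. f (\<phi> k))"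
proof -
  obtain g :: "nat \<Rightarrow> nat" where g: "strict_mono g" "monoseq (\<lambda>n. f (g n))" using seq_monosub by blast
  show ?thesis
  proof (cases "incseq (\<lambda>n. f (g n))")
    case True
    then show ?thesis using g by auto
  next
    case False
    then have dec: "decseq (\<lambda>n. f (g n))" using g(2) monoseq_iff by blast
    \<comment> \<open>A decreasing sequence of naturals is constant from an index on at which its
      least value occurs.\<close>
    define v where "v = (LEAST y. \<exists>n. y = f (g n))"
    have "\<exists>n. v = f (g n)" unfolding v_def by (rule LeastI_ex) blast
    then obtain N where N: "v = f (g N)" by blast
    have "f (g (N + k)) = v" for k
    proof (rule antisym)
      show "f (g (N + k)) \<le> v" using dec N by (simp add: decseq_def)
      show "v \<le> f (g (N + k))" unfolding v_def by (rule Least_le) blast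
    qed
    then show ?thesis using g(1)
      by (intro exI[of _ "\<lambda>k. g (N + k)"]) (auto simp: strict_mono_def mono_def)
  qed
qed

text \<open>Coordinates are treated one after the other: thinning out a sequence once more keeps
  monotone the coordinates that already are.\<close>

lemma dickson:
  fixes f :: "nat \<Rightarrow> 'i \<Rightarrow> nat"
  assumes "finite I"
  shows "\<exists>\<phi> :: nat \<Rightarrow> nat. strict_mono \<phi> \<and> (\<forall>i\<in>I. mono (\<lambda>k. f (\<phi> k) i))"
  using assms
proof (induction I)
  case empty
  then show ?case by (intro exI[of _ id]) (auto simp: strict_mono_def)
next
  case (insert a I)
  then obtain \<phi> :: "nat \<Rightarrow> nat" where \<phi>: "strict_mono \<phi>" "\<forall>i\<in>I. mono (\<lambda>k. f (\<phi> k) i)" by blast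
  obtain \<psi> :: "nat \<Rightarrow> nat" where \<psi>: "strict_mono \<psi>" "mono (\<lambda>k. f (\<phi> (\<psi> k)) a)"
    using nat_mono_subseq[of "\<lambda>k. f (\<phi> k) a"] by blast
  have "mono (\<lambda>k. f (\<phi> (\<psi> k)) i)" if "i \<in> I" for i
    using \<phi>(2) \<psi>(1) that by (auto simp: mono_def dest: strict_mono_mono)
  with \<psi> \<phi>(1) show ?case
    by (intro exI[of _ "\<lambda>k. \<phi> (\<psi> k)"]) (auto simp: strict_mono_def)
qed

lemma multiset_dickson:
  assumes "finite A" "\<And>k::nat. set_mset (f k) \<subseteq> A"
  obtains i j where "i < j" "f i \<subseteq># f j"
proof -
  obtain \<phi> :: "nat \<Rightarrow> nat" where \<phi>: "strict_mono \<phi>" "\<forall>i\<in>A. mono (\<lambda>k. count (f (\<phi> k)) i)"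
    using dickson[OF assms(1), of "\<lambda>k. count (f k)"] by blast
  have "f (\<phi> 0) \<subseteq># f (\<phi> 1)"
  proof (rule mset_subset_eqI)
    fix a show "count (f (\<phi> 0)) a \<le> count (f (\<phi> 1)) a"
    proof (cases "a \<in> A")
      case True
      then show ?thesis using \<phi>(2) by (auto simp: mono_def)
    next
      case False
      then have "a \<notin># f (\<phi> 0)" using assms(2) by blast
      then show ?thesis by (simp add: not_in_iff)
    qed
  qed
  moreover have "\<phi> 0 < \<phi> 1" using \<phi>(1) by (simp add: strict_mono_def)
  ultimately show thesis using that by blast
qed

section \<open>Eventually polynomial sequences\<close>

definition ev_poly :: "(nat \<Rightarrow> real) \<Rightarrow> bool"
  where "ev_poly f \<longleftrightarrow> (\<exists>p. \<forall>\<^sub>F t in sequentially. f t = poly p (real t))"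

lemma ev_polyI: "(\<And>t. t \<ge> N \<Longrightarrow> f t = poly p (real t)) \<Longrightarrow> ev_poly f"
  unfolding ev_poly_def eventually_sequentially by blast

lemma ev_polyE:
  assumes "ev_poly f"
  obtains p N where "\<And>t. t \<ge> N \<Longrightarrow> f t = poly p (real t)"
  using assms unfolding ev_poly_def eventually_sequentially by blast

lemma ev_poly_cong:
  assumes "ev_poly g" "\<And>t. t \<ge> N \<Longrightarrow> f t = g t"
  shows "ev_poly f"
proof -
  obtain p M where "\<And>t. t \<ge> M \<Longrightarrow> g t = poly p (real t)" using ev_polyE[OF assms(1)] by metis
  then show ?thesis by (intro ev_polyI[of "max N M" _ p]) (use assms(2) in auto)
qed

lemma ev_poly_add:
  assumes "ev_poly f" "ev_poly g"
  shows "ev_poly (\<lambda>t. f t + g t)"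
proof -
  obtain p M where p: "\<And>t. t \<ge> M \<Longrightarrow> f t = poly p (real t)" using ev_polyE[OF assms(1)] by metis
  obtain q N where q: "\<And>t. t \<ge> N \<Longrightarrow> g t = poly q (real t)" using ev_polyE[OF assms(2)] by metis
  show ?thesis by (intro ev_polyI[of "max M N" _ "p + q"]) (use p q in auto)
qed

lemma ev_poly_sum:
  assumes "finite I" "\<And>i. i \<in> I \<Longrightarrow> ev_poly (f i)"
  shows "ev_poly (\<lambda>t. \<Sum>i\<in>I. f i t)"
  using assms by (induction I) (auto intro: ev_poly_add ev_polyI[where p = 0])

lemma ev_poly_shift_back:
  assumes "ev_poly f"
  shows "ev_poly (\<lambda>t. f (t - k))"
proof -
  obtain p M where p: "\<And>t. t \<ge> M \<Longrightarrow> f t = poly p (real t)" using ev_polyE[OF assms(1)] by metis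
  show ?thesis
    by (intro ev_polyI[of "M + k" _ "pcompose p [:- real k, 1:]"]) (simp add: p poly_pcompose of_nat_diff)
qed

text \<open>In the binomial expansion of (x + 1)^(d + 1) - x^(d + 1) the top term is (d + 1) x^d;
  all lower powers already have antidifferences by induction and can be subtracted.\<close>

lemma monomial_antidifference: "\<exists>q::real poly. \<forall>x. poly q (x + 1) - poly q x = x ^ d"
proof (induction d rule: less_induct)
  case (less d)
  then obtain Q where Q: "\<And>k x. k < d \<Longrightarrow> poly (Q k) (x + 1) - poly (Q k) x = (x::real) ^ k" by metis
  define q where "q = smult (1 / real (Suc d)) (monom 1 (Suc d) - (\<Sum>k<d. smult (real (Suc d choose k)) (Q k)))"
  have "poly q (x + 1) - poly q x = x ^ d" for x
  proof -
    have "(x + 1) ^ Suc d = (\<Sum>k\<le>Suc d. real (Suc d choose k) * x ^ k)"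
      by (subst binomial_ring) simp
    also have "\<dots> = (\<Sum>k<d. real (Suc d choose k) * x ^ k) + real (Suc d) * x ^ d + x ^ Suc d"
      by (simp add: lessThan_Suc_atMost[symmetric])
    finally have e: "(x + 1) ^ Suc d - x ^ Suc d - (\<Sum>k<d. real (Suc d choose k) * x ^ k) = real (Suc d) * x ^ d"
      by simp
    have "(\<Sum>k<d. real (Suc d choose k) * poly (Q k) (x + 1)) - (\<Sum>k<d. real (Suc d choose k) * poly (Q k) x)
       = (\<Sum>k<d. real (Suc d choose k) * x ^ k)"
      by (simp add: sum_subtractf[symmetric] right_diff_distrib[symmetric] Q)
    then have "poly q (x + 1) - poly q x
       = 1 / real (Suc d) * ((x + 1) ^ Suc d - x ^ Suc d - (\<Sum>k<d. real (Suc d choose k) * x ^ k))"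
      unfolding q_def by (simp add: poly_monom poly_sum algebra_simps del: of_nat_Suc power_Suc)
    then show ?thesis unfolding e by (simp del: of_nat_Suc)
  qed
  then show ?case by blast
qed

lemma poly_antidifference: "\<exists>q::real poly. \<forall>x. poly q (x + 1) - poly q x = poly p x"
proof -
  obtain Q where Q: "\<And>d x. poly (Q d) (x + 1) - poly (Q d) x = (x::real) ^ d"
    using monomial_antidifference by metis
  have "\<forall>x. poly (\<Sum>i\<le>degree p. smult (coeff p i) (Q i)) (x + 1)
     - poly (\<Sum>i\<le>degree p. smult (coeff p i) (Q i)) x = poly p x"
    by (simp add: poly_sum sum_subtractf[symmetric] right_diff_distrib[symmetric] Q poly_altdef[of p])
  then show ?thesis by blast
qed

lemma ev_poly_difference:
  assumes "ev_poly g" "\<And>t. t \<ge> K \<Longrightarrow> f (Suc t) - f t = g (Suc t)"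
  shows "ev_poly f"
proof -
  obtain p M where p: "\<And>t. t \<ge> M \<Longrightarrow> g t = poly p (real t)" using ev_polyE[OF assms(1)] by metis
  \<comment> \<open>The hypothesis describes the difference from \<open>t\<close> to
    \<open>Suc t\<close> by the value at \<open>Suc t\<close>, so the antidifference is taken of p(x
    + 1).\<close>
  obtain q where q: "\<And>x. poly q (x + 1) - poly q x = poly (pcompose p [:1, 1:]) x"
    using poly_antidifference by metis
  define N where "N = max K M"
  have "f t = poly (q + [:f N - poly q (real N):]) (real t)" if "t \<ge> N" for t
    using that
  proof (induction t rule: dec_induct)
    case base
    then show ?case by simp
  next
    case (step t)
    have "f (Suc t) = f t + poly p (real (Suc t))"
      using assms(2)[of t] p[of "Suc t"] step(1) unfolding N_def by simp
    also have "\<dots> = f t + (poly q (real t + 1) - poly q (real t))"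
      unfolding q by (simp add: poly_pcompose add.commute)
    finally show ?case using step by (simp add: add.commute)
  qed
  then show ?thesis by (rule ev_polyI)
qed

lemma poly_over_power_tendsto:
  assumes "degree p \<le> k"
  shows "(\<lambda>t. poly p (real t) / real t ^ k) \<longlonglongrightarrow> coeff p k"
proof -
  have "(\<lambda>t. \<Sum>i\<le>k. coeff p i * (1 / real t ^ (k - i))) \<longlonglongrightarrow> (\<Sum>i\<le>k. coeff p i * (if i = k then 1 else 0))"
  proof (intro tendsto_sum tendsto_mult tendsto_const)
    fix i assume "i \<in> {..k}"
    show "(\<lambda>t. 1 / real t ^ (k - i)) \<longlonglongrightarrow> (if i = k then 1 else 0)"
    proof (cases "i = k")
      case False
      then have "0 < k - i" using \<open>i \<in> {..k}\<close> by simp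
      then have "(\<lambda>t. inverse (real t) ^ (k - i)) \<longlonglongrightarrow> 0"
        using tendsto_power[OF lim_inverse_n, of "k - i"] by (simp only: zero_power)
      moreover have "inverse (real t) ^ (k - i) = 1 / real t ^ (k - i)" for t
        by (simp add: power_inverse inverse_eq_divide[symmetric])
      ultimately show ?thesis using False by (simp only: if_False)
    qed simp
  qed
  moreover have "(\<Sum>i\<le>k. coeff p i * (if i = k then 1 else 0)) = coeff p k"
    by (simp add: if_distrib[of "\<lambda>x. _ * x"] cong: if_cong)
  moreover have "\<forall>\<^sub>F t in sequentially. (\<Sum>i\<le>k. coeff p i * (1 / real t ^ (k - i))) = poly p (real t) / real t ^ k"
    unfolding eventually_sequentially
  proof (intro exI[of _ 1] allI impI)
    fix t :: nat assume "1 \<le> t"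
    have "poly p (real t) = (\<Sum>i\<le>k. coeff p i * real t ^ i)"
      unfolding poly_altdef using assms
      by (intro sum.mono_neutral_left) (auto simp: coeff_eq_0)
    then have "poly p (real t) / real t ^ k = (\<Sum>i\<le>k. coeff p i * real t ^ i / real t ^ k)"
      by (simp add: sum_divide_distrib)
    also have "\<dots> = (\<Sum>i\<le>k. coeff p i * (1 / real t ^ (k - i)))"
      using \<open>1 \<le> t\<close> by (intro sum.cong refl) (simp add: power_diff field_simps)
    finally show "(\<Sum>i\<le>k. coeff p i * (1 / real t ^ (k - i))) = poly p (real t) / real t ^ k" by simp
  qed
  ultimately show ?thesis by (simp add: tendsto_cong)
qed

text \<open>The bound forces the polynomial to have degree at most \<open>k\<close>: were its degree
  \<open>d\<close> larger, division by t^d would give both the leading coefficient and 0 as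
  limit.\<close>

lemma ev_poly_bounded_convergent:
  assumes "ev_poly f" "\<And>t. t \<ge> 1 \<Longrightarrow> \<bar>f t\<bar> \<le> C * real t ^ k"
  shows "convergent (\<lambda>t. f t / real t ^ k)"
proof -
  obtain p M where p: "\<And>t. t \<ge> M \<Longrightarrow> f t = poly p (real t)" using ev_polyE[OF assms(1)] by metis
  have "degree p \<le> k"
  proof (rule ccontr)
    assume "\<not> degree p \<le> k"
    define d where "d = degree p"
    have kd: "k < d" using \<open>\<not> degree p \<le> k\<close> unfolding d_def by simp
    have "(\<lambda>t. poly p (real t) / real t ^ d) \<longlonglongrightarrow> coeff p d"
      by (rule poly_over_power_tendsto) (simp add: d_def)
    moreover have "(\<lambda>t. poly p (real t) / real t ^ d) \<longlonglongrightarrow> 0"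
    proof (rule tendsto_0_le[where K = 1])
      have "(\<lambda>t. C * inverse (real t) ^ (d - k)) \<longlonglongrightarrow> C * 0 ^ (d - k)"
        by (intro tendsto_intros lim_inverse_n)
      moreover have "C * 0 ^ (d - k) = 0" using kd by simp
      ultimately show "(\<lambda>t. C * inverse (real t) ^ (d - k)) \<longlonglongrightarrow> 0" by (simp only:)
      show "\<forall>\<^sub>F t in sequentially. norm (poly p (real t) / real t ^ d) \<le> norm (C * inverse (real t) ^ (d - k)) * 1"
        unfolding eventually_sequentially
      proof (intro exI[of _ "max 1 M"] allI impI)
        fix t assume t: "max 1 M \<le> t"
        then have t0: "real t > 0" and "f t = poly p (real t)" by (auto intro: p)
        then have "\<bar>poly p (real t)\<bar> \<le> C * real t ^ k" using assms(2)[of t] by simp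
        then have "\<bar>poly p (real t)\<bar> / real t ^ d \<le> C * real t ^ k / real t ^ d"
          using t0 by (intro divide_right_mono) auto
        also have "C * real t ^ k / real t ^ d = C * inverse (real t) ^ (d - k)"
        proof -
          have "real t ^ d = real t ^ k * real t ^ (d - k)"
            using kd by (simp only: power_add[symmetric]) simp
          moreover have "C * a / (a * b) = C * inverse b" if "a > 0" for a b :: real
            using that by (simp add: divide_inverse)
          ultimately show ?thesis using t0 by (simp only: power_inverse zero_less_power)
        qed
        finally have "norm (poly p (real t) / real t ^ d) \<le> C * inverse (real t) ^ (d - k)"
          by (simp only: real_norm_def abs_divide abs_of_nonneg zero_le_power of_nat_0_le_iff)
        also have "\<dots> \<le> norm (C * inverse (real t) ^ (d - k)) * 1"
          unfolding mult_1_right real_norm_def by (rule abs_ge_self)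
        finally show "norm (poly p (real t) / real t ^ d) \<le> norm (C * inverse (real t) ^ (d - k)) * 1" .
      qed
    qed
    ultimately have "coeff p d = 0" by (rule LIMSEQ_unique)
    then have "p = 0" unfolding d_def by simp
    then show False using kd unfolding d_def by simp
  qed
  then have "(\<lambda>t. poly p (real t) / real t ^ k) \<longlonglongrightarrow> coeff p k" by (rule poly_over_power_tendsto)
  moreover have "\<forall>\<^sub>F t in sequentially. poly p (real t) / real t ^ k = f t / real t ^ k"
    unfolding eventually_sequentially using p by (intro exI[of _ M]) simp
  ultimately have "(\<lambda>t. f t / real t ^ k) \<longlonglongrightarrow> coeff p k" by (rule Lim_transform_eventually)
  then show ?thesis by (rule convergentI)
qed

section \<open>Growth of iterated sumsets\<close>

lemma finite_multisets_of_size: "finite A \<Longrightarrow> finite {M. set_mset M \<subseteq> A \<and> size M = t}"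
proof -
  assume "finite A"
  have "{M. set_mset M \<subseteq> A \<and> size M = t} \<subseteq> mset ` {xs. set xs \<subseteq> A \<and> length xs = t}"
  proof
    fix M assume M: "M \<in> {M. set_mset M \<subseteq> A \<and> size M = t}"
    obtain xs where "M = mset xs" using ex_mset[of M] by auto
    then show "M \<in> mset ` {xs. set xs \<subseteq> A \<and> length xs = t}" using M by (intro image_eqI[of _ _ xs]) auto
  qed
  moreover have "finite (mset ` {xs. set xs \<subseteq> A \<and> length xs = t})"
    by (intro finite_imageI finite_lists_length_eq \<open>finite A\<close>)
  ultimately show ?thesis by (rule finite_subset)
qed

text \<open>If the sets changed infinitely often, pick an element lost at each change. By Dickson an
  earlier lost element lies below a later one; the later one still belongs to the set after the
  earlier loss, and downward closure brings the lost element back.\<close>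

lemma downset_slices_stabilize:
  assumes "finite A" "\<And>k::nat. D k \<subseteq> {M. set_mset M \<subseteq> A}"
    and down: "\<And>k M N. M \<in> D k \<Longrightarrow> N \<subseteq># M \<Longrightarrow> N \<in> D k"
    and "\<And>k. D (Suc k) \<subseteq> D k"
  shows "\<exists>K. \<forall>k\<ge>K. D k = D K"
proof (rule ccontr)
  assume neg: "\<not> ?thesis"
  have anti: "D l \<subseteq> D k" if "k \<le> l" for k l
    using assms(4) that by (rule lift_Suc_antimono_le)
  have "\<forall>K. \<exists>k. K < k \<and> D k \<noteq> D K"
  proof
    fix K
    obtain k where "k \<ge> K" "D k \<noteq> D K" using neg by blast
    then have "K < k" by (cases "k = K") auto
    then show "\<exists>k. K < k \<and> D k \<noteq> D K" using \<open>D k \<noteq> D K\<close> by blast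
  qed
  then obtain g where g: "\<And>K. K < g K \<and> D (g K) \<noteq> D K" by metis
  define s where "s j = (g ^^ j) 0" for j
  have s: "s j < s (Suc j)" "D (s (Suc j)) \<subset> D (s j)" for j
    using g[of "s j"] anti[of "s j" "g (s j)"] by (simp_all add: s_def psubset_eq)
  then have "\<exists>M. M \<in> D (s j) \<and> M \<notin> D (s (Suc j))" for j by (meson psubsetE subsetI)
  then obtain z where z: "\<And>j. z j \<in> D (s j)" "\<And>j. z j \<notin> D (s (Suc j))" by metis
  have zA: "set_mset (z k) \<subseteq> A" for k using z(1) assms(2) by blast
  obtain i j where ij: "i < j" "z i \<subseteq># z j"
    using multiset_dickson[of A z] assms(1) zA by blast
  have "strict_mono s" using s(1) by (simp add: strict_mono_Suc_iff)
  then have "s (Suc i) \<le> s j" using ij(1) by (simp add: strict_mono_less_eq)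
  then have "D (s j) \<subseteq> D (s (Suc i))" by (rule anti)
  then show False using z(1)[of j] z(2)[of i] down[OF _ ij(2)] by blast
qed

text \<open>Induction on the number of generators. Slicing by the multiplicity of the new generator
  gives a decreasing sequence of down-sets over fewer generators, which stabilizes. Finitely many
  slices contribute shifted eventually polynomial terms, and the stable rest contributes a discrete
  antiderivative of one such term.\<close>

lemma downset_ev_poly:
  assumes "finite A" "D \<subseteq> {M. set_mset M \<subseteq> A}" "\<And>M N. M \<in> D \<Longrightarrow> N \<subseteq># M \<Longrightarrow> N \<in> D"
  shows "ev_poly (\<lambda>t. real (card {M \<in> D. size M = t}))"
  using assms
proof (induction A arbitrary: D)
  case empty
  have "real (card {M \<in> D. size M = t}) = poly 0 (real t)" if "t \<ge> 1" for t
  proof -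
    have "{M \<in> D. size M = t} = {}" using empty that by auto
    then have "card {M \<in> D. size M = t} = card ({} :: 'a multiset set)" by (rule arg_cong)
    then show ?thesis by (simp only: card.empty of_nat_0 poly_0)
  qed
  then show ?case by (rule ev_polyI)
next
  case (insert a A)
  \<comment> \<open>\<open>D' k\<close> is the slice with exactly \<open>k\<close> copies of
    \<open>a\<close>, with those copies removed.\<close>
  define D' where "D' k = {M. set_mset M \<subseteq> A \<and> M + replicate_mset k a \<in> D}" for k
  have down: "N \<in> D' k" if "M \<in> D' k" "N \<subseteq># M" for M N k
    using that insert.prems(2)[of "M + replicate_mset k a" "N + replicate_mset k a"] set_mset_mono
    unfolding D'_def by fastforce
  have dec: "D' (Suc k) \<subseteq> D' k" for k
    using insert.prems(2) unfolding D'_def by fastforce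
  have "\<exists>K. \<forall>k\<ge>K. D' k = D' K"
  proof (rule downset_slices_stabilize[OF insert.hyps(1)])
    show "D' k \<subseteq> {M. set_mset M \<subseteq> A}" for k unfolding D'_def by blast
  qed (fact down dec)+
  then obtain K where K: "\<And>k. k \<ge> K \<Longrightarrow> D' k = D' K" by metis
  define H where "H k t = card {M \<in> D' k. size M = t}" for k t
  have H_poly: "ev_poly (\<lambda>t. real (H k t))" for k
    unfolding H_def
  proof (rule insert.IH)
    show "D' k \<subseteq> {M. set_mset M \<subseteq> A}" unfolding D'_def by blast
  qed (fact down)
  have finD': "finite {M \<in> D' k. size M = t}" for k t
    by (rule finite_subset[OF _ finite_multisets_of_size[OF insert.hyps(1), of t]]) (auto simp: D'_def)
  have count: "card {M \<in> D. size M = t} = (\<Sum>k\<le>t. H k (t - k))" for t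
  proof -
    have "{M \<in> D. size M = t} = (\<Union>k\<le>t. (\<lambda>M. M + replicate_mset k a) ` {M \<in> D' k. size M = t - k})"
    proof (intro equalityI subsetI)
      fix M assume M: "M \<in> {M \<in> D. size M = t}"
      define k where "k = count M a"
      define N where "N = filter_mset (\<lambda>x. x \<noteq> a) M"
      have MN: "M = N + replicate_mset k a"
        unfolding N_def k_def by (rule multiset_eqI) auto
      have "k \<le> t" "size N = t - k" using M MN by auto
      moreover have "set_mset N \<subseteq> A" using M insert.prems(1) unfolding N_def by auto
      then have "N \<in> D' k" using M MN unfolding D'_def by simp
      ultimately show "M \<in> (\<Union>k\<le>t. (\<lambda>M. M + replicate_mset k a) ` {M \<in> D' k. size M = t - k})"
        using MN by blast
    qed (auto simp: D'_def)
    moreover have "card \<dots> = (\<Sum>k\<le>t. card ((\<lambda>M. M + replicate_mset k a) ` {M \<in> D' k. size M = t - k}))"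
    proof (rule card_UN_disjoint)
      have "k = l" if "M + replicate_mset k a = N + replicate_mset l a" "M \<in> D' k" "N \<in> D' l" for M N k l
      proof -
        have "count M a = 0" "count N a = 0"
          using that insert.hyps(2) unfolding D'_def by (auto simp: count_eq_zero_iff)
        then show ?thesis using arg_cong[OF that(1), of "\<lambda>M. count M a"] by simp
      qed
      then show "\<forall>i\<in>{..t}. \<forall>j\<in>{..t}. i \<noteq> j \<longrightarrow>
         (\<lambda>M. M + replicate_mset i a) ` {M \<in> D' i. size M = t - i} \<inter>
         (\<lambda>M. M + replicate_mset j a) ` {M \<in> D' j. size M = t - j} = {}" by blast
    qed (use finD' in auto)
    moreover have "card ((\<lambda>M. M + replicate_mset k a) ` {M \<in> D' k. size M = t - k}) = H k (t - k)" for k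
      unfolding H_def by (rule card_image) (simp add: inj_on_def)
    ultimately show ?thesis by simp
  qed
  \<comment> \<open>From \<open>K\<close> on all slices coincide, so the increment of this tail from
    \<open>t\<close> to \<open>Suc t\<close> is the single value
    \<open>H K (Suc t - K)\<close>.\<close>
  define F where "F t = (\<Sum>k=K..t. real (H K (t - k)))" for t
  have "ev_poly F"
  proof (rule ev_poly_difference[of "\<lambda>t. real (H K (t - K))" K])
    show "ev_poly (\<lambda>t. real (H K (t - K)))" by (rule ev_poly_shift_back[OF H_poly])
    fix t assume "t \<ge> K"
    have "F (Suc t) = real (H K (Suc t - K)) + (\<Sum>k=Suc K..Suc t. real (H K (Suc t - k)))"
      unfolding F_def using \<open>t \<ge> K\<close> by (subst sum.atLeast_Suc_atMost) auto
    also have "(\<Sum>k=Suc K..Suc t. real (H K (Suc t - k))) = F t"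
      unfolding F_def by (subst sum.shift_bounds_cl_Suc_ivl) simp
    finally show "F (Suc t) - F t = real (H K (Suc t - K))" by simp
  qed
  moreover have "ev_poly (\<lambda>t. \<Sum>k<K. real (H k (t - k)))"
    by (intro ev_poly_sum ev_poly_shift_back H_poly) auto
  ultimately have "ev_poly (\<lambda>t. (\<Sum>k<K. real (H k (t - k))) + F t)" by (rule ev_poly_add[rotated])
  moreover have "real (card {M \<in> D. size M = t}) = (\<Sum>k<K. real (H k (t - k))) + F t" if "t \<ge> K" for t
  proof -
    have "{..t} = {..<K} \<union> {K..t}" using that by auto
    then have "(\<Sum>k\<le>t. real (H k (t - k))) = (\<Sum>k\<in>{..<K} \<union> {K..t}. real (H k (t - k)))"
      by (rule arg_cong)
    also have "\<dots> = (\<Sum>k<K. real (H k (t - k))) + (\<Sum>k=K..t. real (H k (t - k)))"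
      by (rule sum.union_disjoint) auto
    also have "(\<Sum>k=K..t. real (H k (t - k))) = F t"
    proof -
      have "H k (t - k) = H K (t - k)" if "k \<in> {K..t}" for k
        using K[of k] that unfolding H_def by (simp only: atLeastAtMost_iff)
      then show ?thesis unfolding F_def by simp
    qed
    finally show ?thesis unfolding count by simp
  qed
  ultimately show ?case by (rule ev_poly_cong)
qed

section \<open>Sums of t generators and the count of their values\<close>

definition sumset :: "'a::comm_monoid_add set \<Rightarrow> nat \<Rightarrow> 'a set"
  where "sumset A t = {sum_mset M | M. set_mset M \<subseteq> A \<and> size M = t}"

lemma finite_sumset: "finite A \<Longrightarrow> finite (sumset A t)"
  unfolding sumset_def using finite_multisets_of_size[of A t]
  by (simp add: setcompr_eq_image)

lemma sumset_0 [simp]: "sumset A 0 = {0}"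
  unfolding sumset_def by auto

lemma sumsetI: "set_mset M \<subseteq> A \<Longrightarrow> sum_mset M \<in> sumset A (size M)"
  unfolding sumset_def by blast

lemma sumset_1: "a \<in> A \<Longrightarrow> a \<in> sumset A 1"
  using sumsetI[of "{#a#}" A] by simp

lemma sumset_add:
  assumes "a \<in> sumset A s" "b \<in> sumset A t"
  shows "a + b \<in> sumset A (s + t)"
proof -
  obtain M N where "a = sum_mset M" "set_mset M \<subseteq> A" "size M = s"
    "b = sum_mset N" "set_mset N \<subseteq> A" "size N = t"
    using assms unfolding sumset_def by blast
  then show ?thesis using sumsetI[of "M + N" A] by simp
qed

lemma sumset_Suc: "sumset A (Suc t) = {a + s | a s. a \<in> A \<and> s \<in> sumset A t}"
proof (intro equalityI subsetI)
  fix x assume "x \<in> sumset A (Suc t)"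
  then obtain M where M: "x = sum_mset M" "set_mset M \<subseteq> A" "size M = Suc t" unfolding sumset_def by blast
  then obtain a N where "M = add_mset a N" by (metis size_eq_Suc_imp_eq_union)
  then show "x \<in> {a + s | a s. a \<in> A \<and> s \<in> sumset A t}"
    using M sumsetI[of N A] by auto
next
  fix x assume "x \<in> {a + s | a s. a \<in> A \<and> s \<in> sumset A t}"
  then show "x \<in> sumset A (Suc t)"
    using sumset_add[OF sumset_1, of _ A _ t] by auto
qed

text \<open>Among all multisets of generators with a given size and sum, the least one for a translation
  invariant order is a canonical representative; the canonical representatives form a down-set.\<close>

lemma sumset_ev_poly:
  fixes A :: "'a::comm_monoid_add set"
  assumes "finite A"
  shows "ev_poly (\<lambda>t. real (card (sumset A t)))"
proof -
  \<comment> \<open>Coding the generators by naturals makes the multiset order on the images a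
    linear order that respects adding and cancelling a common part.\<close>
  obtain f :: "'a \<Rightarrow> nat" where f: "inj_on f A" using finite_imp_inj_to_nat_seg[OF assms] by blast
  define R where "R M = {N. set_mset N \<subseteq> A \<and> size N = size M \<and> sum_mset N = sum_mset M}" for M :: "'a multiset"
  define D where "D = {M. set_mset M \<subseteq> A \<and> (\<forall>N\<in>R M. image_mset f M \<le> image_mset f N)}"
  have inj: "M = N" if "image_mset f M = image_mset f N" "set_mset M \<subseteq> A" "set_mset N \<subseteq> A" for M N
  proof -
    have inv: "image_mset (the_inv_into A f) (image_mset f L) = L" if "set_mset L \<subseteq> A" for L
    proof -
      have "image_mset (\<lambda>x. the_inv_into A f (f x)) L = image_mset (\<lambda>x. x) L"
        using that f by (intro image_mset_cong) (auto simp: the_inv_into_f_f)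
      then show ?thesis by (simp add: image_mset.compositionality comp_def)
    qed
    show ?thesis using inv[OF that(2)] inv[OF that(3)] unfolding that(1) by (rule trans[OF sym])
  qed
  have "ev_poly (\<lambda>t. real (card {M \<in> D. size M = t}))"
  proof (rule downset_ev_poly[OF assms])
    show "D \<subseteq> {M. set_mset M \<subseteq> A}" unfolding D_def by blast
    fix M N assume M: "M \<in> D" and NM: "N \<subseteq># M"
    then obtain L where L: "M = N + L" by (metis subset_mset.le_iff_add)
    have "image_mset f N \<le> image_mset f N'" if "N' \<in> R N" for N'
    proof -
      \<comment> \<open>Exchanging the part \<open>N\<close> of \<open>M\<close> for
        \<open>N'\<close> preserves size and sum, so minimality of \<open>M\<close> applies;
        cancelling \<open>L\<close> gives minimality of \<open>N\<close>.\<close>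
      have "N' + L \<in> R M" using that M unfolding R_def D_def L by auto
      then have "image_mset f M \<le> image_mset f (N' + L)" using M unfolding D_def by blast
      then show ?thesis unfolding L by simp
    qed
    then show "N \<in> D" using M unfolding D_def L by auto
  qed
  moreover have "card {M \<in> D. size M = t} = card (sumset A t)" for t
  proof (rule bij_betw_same_card)
    show "bij_betw sum_mset {M \<in> D. size M = t} (sumset A t)"
      unfolding bij_betw_def
    proof
      show "inj_on sum_mset {M \<in> D. size M = t}"
      proof (rule inj_onI)
        fix M N assume MN: "M \<in> {M \<in> D. size M = t}" "N \<in> {M \<in> D. size M = t}" "sum_mset M = sum_mset N"
        then have "N \<in> R M" "M \<in> R N" unfolding R_def D_def by auto
        then have "image_mset f M = image_mset f N" using MN unfolding D_def by (intro order_antisym) auto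
        then show "M = N" using inj MN unfolding D_def by blast
      qed
      show "sum_mset ` {M \<in> D. size M = t} = sumset A t"
      proof (intro equalityI subsetI)
        fix x assume "x \<in> sumset A t"
        then obtain M where M: "x = sum_mset M" "set_mset M \<subseteq> A" "size M = t" unfolding sumset_def by blast
        have fin: "finite (R M)"
          by (rule finite_subset[OF _ finite_multisets_of_size[OF assms, of "size M"]]) (auto simp: R_def)
        have "M \<in> R M" using M unfolding R_def by blast
        then have ne: "image_mset f ` R M \<noteq> {}" by blast
        have "Min (image_mset f ` R M) \<in> image_mset f ` R M" using fin ne by (intro Min_in) auto
        then obtain N where N: "N \<in> R M" "Min (image_mset f ` R M) = image_mset f N" by blast
        then have min: "image_mset f N \<le> image_mset f L" if "L \<in> R M" for L
          using fin that Min_le[of "image_mset f ` R M" "image_mset f L"] by simp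
        have "R N = R M" using N(1) unfolding R_def by auto
        then have "N \<in> D" using N(1) min unfolding D_def R_def by auto
        then show "x \<in> sum_mset ` {M \<in> D. size M = t}" using N(1) M unfolding R_def by (intro image_eqI[of _ _ N]) auto
      qed (auto simp: D_def sumset_def)
    qed
  qed
  ultimately show ?thesis by simp
qed

section \<open>Monomials\<close>

abbreviation lookup :: "('a \<Rightarrow>\<^sub>0 'b::zero) \<Rightarrow> 'a \<Rightarrow> 'b" where "lookup \<equiv> Poly_Mapping.lookup"
abbreviation keys :: "('a \<Rightarrow>\<^sub>0 'b::zero) \<Rightarrow> 'a set" where "keys \<equiv> Poly_Mapping.keys"
abbreviation single :: "'a \<Rightarrow> 'b \<Rightarrow> 'a \<Rightarrow>\<^sub>0 'b::zero" where "single \<equiv> Poly_Mapping.single"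

definition mon :: "'v set \<Rightarrow> ('v \<Rightarrow>\<^sub>0 nat) set"
  where "mon V = {b. keys b \<subseteq> V}"

definition deg_on :: "'v set \<Rightarrow> ('v \<Rightarrow>\<^sub>0 nat) \<Rightarrow> nat"
  where "deg_on U b = (\<Sum>x\<in>U. lookup b x)"

definition ind :: "'v set \<Rightarrow> 'v \<Rightarrow>\<^sub>0 nat"
  where "ind e = (\<Sum>x\<in>e. single x 1)"

lemma keys_add_nat: "keys (a + b) = keys a \<union> keys (b :: 'v \<Rightarrow>\<^sub>0 nat)"
  by (auto simp: in_keys_iff lookup_add)

lemma mon_add_iff: "a + b \<in> mon V \<longleftrightarrow> a \<in> mon V \<and> b \<in> mon V"
  unfolding mon_def by (auto simp: keys_add_nat)

lemma mon_0 [simp]: "0 \<in> mon V"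
  unfolding mon_def by simp

lemma mon_single: "x \<in> V \<Longrightarrow> single x k \<in> mon V"
  unfolding mon_def by (cases "k = 0") auto

lemma mon_sum: "(\<And>i. i \<in> I \<Longrightarrow> f i \<in> mon V) \<Longrightarrow> sum f I \<in> mon V"
  by (induction I rule: infinite_finite_induct) (auto simp: mon_add_iff)

lemma deg_on_add: "deg_on U (a + b) = deg_on U a + deg_on U b"
  unfolding deg_on_def by (simp add: lookup_add sum.distrib)

lemma deg_on_0 [simp]: "deg_on U 0 = 0"
  unfolding deg_on_def by simp

lemma lookup_ind: "finite e \<Longrightarrow> lookup (ind e) x = (if x \<in> e then 1 else 0)"
  unfolding ind_def by (simp add: lookup_sum lookup_single when_def)

lemma ind_in_mon: "e \<subseteq> V \<Longrightarrow> ind e \<in> mon V"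
  unfolding ind_def by (intro mon_sum mon_single) auto

lemma deg_on_ind: "finite e \<Longrightarrow> finite U \<Longrightarrow> deg_on U (ind e) = card (U \<inter> e)"
  unfolding deg_on_def by (simp add: lookup_ind sum.If_cases)

lemma monomial_expansion: "finite V \<Longrightarrow> b \<in> mon V \<Longrightarrow> b = (\<Sum>x\<in>V. single x (lookup b x))"
  by (rule poly_mapping_eqI)
     (auto simp: mon_def lookup_sum lookup_single when_def in_keys_iff subset_iff)

lemma mon_eqI: "a \<in> mon V \<Longrightarrow> b \<in> mon V \<Longrightarrow> (\<And>x. x \<in> V \<Longrightarrow> lookup a x = lookup b x) \<Longrightarrow> a = b"
proof (rule poly_mapping_eqI)
  fix x assume *: "a \<in> mon V" "b \<in> mon V" "\<And>x. x \<in> V \<Longrightarrow> lookup a x = lookup b x"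
  show "lookup a x = lookup b x"
  proof (cases "x \<in> V")
    case False
    then have "x \<notin> keys a" "x \<notin> keys b" using *(1,2) unfolding mon_def by blast+
    then show ?thesis by (simp add: in_keys_iff)
  qed (rule *)
qed

lemma monomial_le_imp_add:
  assumes "\<And>x. lookup a x \<le> lookup b x"
  obtains c where "b = a + (c :: 'v \<Rightarrow>\<^sub>0 nat)"
proof
  show "b = a + (b - a)" using assms by (intro poly_mapping_eqI) (simp add: lookup_add lookup_minus)
qed

lemma card_bounded_monomials:
  assumes "finite U"
  shows "card {b \<in> mon U. \<forall>x\<in>U. lookup b x < k} = k ^ card U"
    and "finite {b \<in> mon U. \<forall>x\<in>U. lookup b x < k}"
proof -
  let ?B = "{b \<in> mon U. \<forall>x\<in>U. lookup b x < k}"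
  have "bij_betw (\<lambda>b. restrict (lookup b) U) ?B (U \<rightarrow>\<^sub>E {..<k})"
    unfolding bij_betw_def
  proof
    show "inj_on (\<lambda>b. restrict (lookup b) U) ?B"
    proof (rule inj_onI)
      fix a b assume ab: "a \<in> ?B" "b \<in> ?B" "restrict (lookup a) U = restrict (lookup b) U"
      then have "lookup a x = lookup b x" if "x \<in> U" for x
        using that by (metis restrict_apply')
      then show "a = b" using ab mon_eqI[of a U b] by blast
    qed
    show "(\<lambda>b. restrict (lookup b) U) ` ?B = U \<rightarrow>\<^sub>E {..<k}"
    proof (intro equalityI subsetI)
      fix f assume f: "f \<in> U \<rightarrow>\<^sub>E {..<k}"
      define b where "b = (\<Sum>x\<in>U. single x (f x))"
      have b: "lookup b x = (if x \<in> U then f x else 0)" for x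
        unfolding b_def using assms by (simp add: lookup_sum lookup_single when_def)
      have "b \<in> mon U" unfolding b_def by (intro mon_sum mon_single)
      then have "b \<in> ?B" using f b by auto
      moreover have "restrict (lookup b) U = f"
        using f by (auto simp: b PiE_def extensional_def restrict_def)
      ultimately show "f \<in> (\<lambda>b. restrict (lookup b) U) ` ?B" by blast
    qed auto
  qed
  then show "card ?B = k ^ card U" "finite ?B"
    using assms by (auto simp: bij_betw_same_card card_PiE bij_betw_finite finite_PiE)
qed

section \<open>Powers of the edge ideal on the level of monomials\<close>

locale uniform_edges =
  fixes V :: "'v set" and E :: "'v set set" and m :: nat
  assumes finite_V: "finite V" and V_nonempty: "V \<noteq> {}"
    and edge_subset: "e \<in> E \<Longrightarrow> e \<subseteq> V" and card_edge: "e \<in> E \<Longrightarrow> card e = m"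
    and m_pos: "1 \<le> m"
begin

definition S :: "nat \<Rightarrow> ('v \<Rightarrow>\<^sub>0 nat) set"
  where "S t = sumset (ind ` E) t"

definition N :: "nat \<Rightarrow> ('v \<Rightarrow>\<^sub>0 nat) set"
  where "N t = {s + b | s b. s \<in> S t \<and> b \<in> mon V}"

definition M :: "nat \<Rightarrow> ('v \<Rightarrow>\<^sub>0 nat) set"
  where "M t = {a \<in> N t. a \<notin> N (Suc t) \<and> (\<forall>x\<in>V. \<exists>k. a + single x k \<in> N (Suc t))}"

lemma finite_E: "finite E"
  using finite_V edge_subset by (meson finite_Pow_iff finite_subset Pow_iff subsetI)

lemma finite_edge: "e \<in> E \<Longrightarrow> finite e"
  using finite_V edge_subset finite_subset by blast

lemma finite_S: "finite (S t)"
  unfolding S_def by (intro finite_sumset finite_imageI finite_E)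

lemma S_0 [simp]: "S 0 = {0}"
  unfolding S_def by simp

lemma S_Suc: "S (Suc t) = {ind e + s | e s. e \<in> E \<and> s \<in> S t}"
  unfolding S_def sumset_Suc by blast

lemma S_add: "a \<in> S s \<Longrightarrow> b \<in> S t \<Longrightarrow> a + b \<in> S (s + t)"
  unfolding S_def by (rule sumset_add)

lemma S_ind: "e \<in> E \<Longrightarrow> ind e \<in> S 1"
  unfolding S_def by (intro sumset_1) blast

lemma S_sum: "finite I \<Longrightarrow> (\<And>i. i \<in> I \<Longrightarrow> f i \<in> S (p i)) \<Longrightarrow> sum f I \<in> S (sum p I)"
  by (induction I rule: finite_induct) (auto intro: S_add)

lemma S_induct [consumes 1, case_names zero edge]:
  assumes "s \<in> S t" "P 0 0" "\<And>t e s. e \<in> E \<Longrightarrow> s \<in> S t \<Longrightarrow> P t s \<Longrightarrow> P (Suc t) (ind e + s)"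
  shows "P t s"
  using assms(1) by (induction t arbitrary: s) (auto simp: S_Suc intro: assms)

lemma S_subset_mon: "s \<in> S t \<Longrightarrow> s \<in> mon V"
  by (induction rule: S_induct) (auto simp: mon_add_iff intro: ind_in_mon[OF edge_subset])

lemma deg_S: "s \<in> S t \<Longrightarrow> deg_on V s = m * t"
proof (induction rule: S_induct)
  case (edge t e s)
  then have "V \<inter> e = e" using edge_subset by blast
  then show ?case
    using edge by (simp add: deg_on_add deg_on_ind finite_V finite_edge card_edge)
qed simp

lemma lookup_S: "s \<in> S t \<Longrightarrow> lookup s x \<le> t"
proof (induction rule: S_induct)
  case (edge t e s)
  then show ?case by (simp add: lookup_add lookup_ind finite_edge)
qed simp

lemma N_0: "N 0 = mon V"
  unfolding N_def by simp

lemma S_subset_N: "s \<in> S t \<Longrightarrow> s \<in> N t"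
  unfolding N_def using mon_0[of V] by force

lemma N_subset_mon: "a \<in> N t \<Longrightarrow> a \<in> mon V"
  unfolding N_def using S_subset_mon by (auto simp: mon_add_iff)

lemma N_add_mon:
  assumes "a \<in> N t" "b \<in> mon V" shows "a + b \<in> N t"
proof -
  obtain s c where "a = s + c" "s \<in> S t" "c \<in> mon V" using assms unfolding N_def by blast
  then have "a + b = s + (c + b)" "c + b \<in> mon V" using assms by (auto simp: add.assoc mon_add_iff)
  then show ?thesis using \<open>s \<in> S t\<close> unfolding N_def by blast
qed

lemma N_add_S:
  assumes "a \<in> N t" "s \<in> S p" shows "a + s \<in> N (t + p)"
proof -
  obtain s' c where "a = s' + c" "s' \<in> S t" "c \<in> mon V" using assms unfolding N_def by blast
  then have "a + s = (s' + s) + c" by (simp add: add_ac)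
  then show ?thesis using S_add[OF \<open>s' \<in> S t\<close> assms(2)] \<open>c \<in> mon V\<close> unfolding N_def by blast
qed

lemma N_Suc_subset: "N (Suc t) \<subseteq> N t"
proof
  fix a assume "a \<in> N (Suc t)"
  then obtain e s b where a: "a = ind e + s + b" "e \<in> E" "s \<in> S t" "b \<in> mon V"
    unfolding N_def S_Suc by blast
  then have "s + (ind e + b) \<in> N t"
    by (intro N_add_mon S_subset_N) (auto simp: mon_add_iff intro: ind_in_mon[OF edge_subset])
  then show "a \<in> N t" using a(1) by (simp add: add_ac)
qed

lemma N_antimono: "s \<le> t \<Longrightarrow> N t \<subseteq> N s"
  by (rule lift_Suc_antimono_le[of N, OF N_Suc_subset])

text \<open>By Dickson's lemma a single power of the maximal ideal kills the zeroth local cohomology in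
  all degrees at once.\<close>

lemma M_cofactor_bounded:
  "\<exists>K. \<forall>t s b. s \<in> S t \<longrightarrow> b \<in> mon V \<longrightarrow> s + b \<in> M t \<longrightarrow> deg_on V b \<le> K"
proof (rule ccontr)
  assume "\<not> ?thesis"
  then have "\<exists>t s b. s \<in> S t \<and> b \<in> mon V \<and> s + b \<in> M t \<and> K < deg_on V b" for K
    by (meson not_le)
  then obtain T s b where sb: "\<And>K. s K \<in> S (T K)" "\<And>K. b K \<in> mon V" "\<And>K. s K + b K \<in> M (T K)"
    "\<And>K. K < deg_on V (b K)" by metis
  have "\<exists>c. s K = sum_mset c \<and> set_mset c \<subseteq> ind ` E \<and> size c = T K" for K
    using sb(1)[of K] unfolding S_def sumset_def by blast
  then obtain c where c: "\<And>K. s K = sum_mset (c K)" "\<And>K. set_mset (c K) \<subseteq> ind ` E" "\<And>K. size (c K) = T K"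
    by metis
  \<comment> \<open>Edge multiplicities and cofactor exponents are put side by side, so that one
    application of Dickson's lemma makes both grow along the subsequence.\<close>
  define f where "f K i = (case i of Inl a \<Rightarrow> count (c K) a | Inr x \<Rightarrow> lookup (b K) x)" for K i
  obtain \<phi> :: "nat \<Rightarrow> nat" where \<phi>: "strict_mono \<phi>" "\<forall>i\<in>(ind ` E) <+> V. mono (\<lambda>k. f (\<phi> k) i)"
    using dickson[of "(ind ` E) <+> V" f] finite_V finite_E by auto
  define i where "i = \<phi> 0"
  have "\<forall>x\<in>V. \<exists>k. s i + b i + single x k \<in> N (Suc (T i))" using sb(3)[of i] unfolding M_def by blast
  then obtain k where k: "\<And>x. x \<in> V \<Longrightarrow> s i + b i + single x (k x) \<in> N (Suc (T i))" by metis
  \<comment> \<open>The index is so large that the degree of \<open>b j\<close> exceeds that of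
    \<open>b i\<close> by more than the sum of all exponents \<open>k x\<close>.\<close>
  define j where "j = \<phi> (deg_on V (b i) + sum k V)"
  have "deg_on V (b i) + sum k V \<le> j" unfolding j_def using \<phi>(1) by (rule strict_mono_imp_increasing)
  then have deg_j: "deg_on V (b i) + sum k V < deg_on V (b j)" using sb(4)[of j] by linarith
  have le: "f i z \<le> f j z" if "z \<in> (ind ` E) <+> V" for z
    using \<phi>(2) that unfolding i_def j_def mono_def by blast
  have "count (c i) a \<le> count (c j) a" for a
  proof (cases "a \<in> ind ` E")
    case True
    then show ?thesis using le[of "Inl a"] unfolding f_def by auto
  next
    case False
    then have "a \<notin># c i" using c(2) by blast
    then show ?thesis by (simp add: not_in_iff)
  qed
  then obtain c' where c': "c j = c i + c'" by (metis mset_subset_eqI subset_mset.le_iff_add)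
  have "lookup (b i) x \<le> lookup (b j) x" for x
  proof (cases "x \<in> V")
    case True
    then show ?thesis using le[of "Inr x"] unfolding f_def by auto
  next
    case False
    then have "x \<notin> keys (b i)" using sb(2) unfolding mon_def by blast
    then show ?thesis by (simp add: in_keys_iff)
  qed
  then obtain b' where b': "b j = b i + b'" by (rule monomial_le_imp_add)
  have "sum k V < deg_on V b'" using deg_j unfolding b' deg_on_add by linarith
  \<comment> \<open>Pigeonhole: the surplus \<open>b'\<close> has degree above the sum of the
    \<open>k x\<close>, hence contains x^(k x) for some \<open>x\<close>. This power pushes
    \<open>s i + b i\<close> into the next power of the ideal, and \<open>s j + b j\<close> along
    with it.\<close>
  then obtain x where x: "x \<in> V" "k x \<le> lookup b' x"
    unfolding deg_on_def using sum_mono[of V "lookup b'" k] by (meson leD linear)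
  have "lookup (single x (k x)) y \<le> lookup b' y" for y
    using x by (cases "y = x") (simp_all add: lookup_single)
  then obtain b'' where b'': "b' = single x (k x) + b''" by (rule monomial_le_imp_add)
  have "b'' \<in> mon V" using sb(2)[of j] unfolding b' b'' by (auto simp: mon_add_iff)
  moreover have "sum_mset c' \<in> S (size c')"
    unfolding S_def using c(2)[of j] c' by (intro sumsetI) auto
  ultimately have "s i + b i + single x (k x) + sum_mset c' + b'' \<in> N (Suc (T i) + size c')"
    by (intro N_add_mon N_add_S k x)
  moreover have "Suc (T i) + size c' = Suc (T j)" using c(3)[of i] c(3)[of j] c' by simp
  moreover have "s i + b i + single x (k x) + sum_mset c' + b'' = s j + b j"
    unfolding b' b'' c(1) c' by (simp add: add_ac)
  ultimately show False using sb(3)[of j] unfolding M_def by simp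
qed

text \<open>Says that \<open>b - b'\<close> lies in the lattice spanned by the edges, as a
  combination whose coefficients sum to \<open>q\<close>. Both parts of the combination are kept as
  sums of edges, so no negative exponents occur.\<close>

definition rel :: "nat \<Rightarrow> ('v \<Rightarrow>\<^sub>0 nat) \<Rightarrow> ('v \<Rightarrow>\<^sub>0 nat) \<Rightarrow> bool"
  where "rel q b b' \<longleftrightarrow> (\<exists>p. \<exists>s1\<in>S (p + q). \<exists>s2\<in>S p. b + s2 = b' + s1)"

lemma relI: "s1 \<in> S (p + q) \<Longrightarrow> s2 \<in> S p \<Longrightarrow> b + s2 = b' + s1 \<Longrightarrow> rel q b b'"
  unfolding rel_def by blast

lemma rel_refl: "rel 0 b b"
  by (rule relI[of 0 0 0 0]) auto

lemma rel_sym: "rel 0 b b' \<Longrightarrow> rel 0 b' b"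
  unfolding rel_def by (metis add.right_neutral)

lemma rel_trans:
  assumes "rel q b b'" "rel q' b' b''" shows "rel (q + q') b b''"
proof -
  obtain p s1 s2 where s: "s1 \<in> S (p + q)" "s2 \<in> S p" "b + s2 = b' + s1"
    using assms(1) unfolding rel_def by blast
  obtain p' s1' s2' where s': "s1' \<in> S (p' + q')" "s2' \<in> S p'" "b' + s2' = b'' + s1'"
    using assms(2) unfolding rel_def by blast
  have "b + (s2 + s2') = (b + s2) + s2'" by (simp add: add_ac)
  also have "\<dots> = (b' + s2') + s1" unfolding s(3) by (simp add: add_ac)
  also have "\<dots> = b'' + (s1 + s1')" unfolding s'(3) by (simp add: add_ac)
  finally have "b + (s2 + s2') = b'' + (s1 + s1')" .
  moreover have "s1 + s1' \<in> S ((p + p') + (q + q'))" using S_add[OF s(1) s'(1)] by (simp add: add_ac)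
  ultimately show ?thesis using S_add[OF s(2) s'(2)] by (blast intro: relI)
qed

lemma rel_add:
  assumes "rel q b b'" "rel q' d d'" shows "rel (q + q') (b + d) (b' + d')"
proof -
  obtain p s1 s2 where s: "s1 \<in> S (p + q)" "s2 \<in> S p" "b + s2 = b' + s1"
    using assms(1) unfolding rel_def by blast
  obtain p' s1' s2' where s': "s1' \<in> S (p' + q')" "s2' \<in> S p'" "d + s2' = d' + s1'"
    using assms(2) unfolding rel_def by blast
  have "b + d + (s2 + s2') = (b + s2) + (d + s2')" by (simp add: add_ac)
  also have "\<dots> = b' + d' + (s1 + s1')" unfolding s(3) s'(3) by (simp add: add_ac)
  finally have "b + d + (s2 + s2') = b' + d' + (s1 + s1')" .
  moreover have "s1 + s1' \<in> S ((p + p') + (q + q'))" using S_add[OF s(1) s'(1)] by (simp add: add_ac)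
  ultimately show ?thesis using S_add[OF s(2) s'(2)] by (blast intro: relI)
qed

lemma rel_sum:
  "finite I \<Longrightarrow> (\<And>i. i \<in> I \<Longrightarrow> rel (q i) (f i) (f' i)) \<Longrightarrow> rel (sum q I) (sum f I) (sum f' I)"
  by (induction I rule: finite_induct) (auto intro: rel_add rel_refl)

lemma rel_edge: "e \<in> E \<Longrightarrow> rel 1 (ind e) 0"
  by (rule relI[of "ind e" 0 1 0]) (simp_all add: S_ind[unfolded One_nat_def])

lemma rel_single: "rel 0 (single x 1) (single y 1) \<Longrightarrow> rel 0 (single x k) (single y k)"
proof (induction k)
  case (Suc k)
  have "single z (Suc k) = single z 1 + single z k" for z :: 'v by (simp flip: single_add)
  then show ?case using rel_add[OF Suc(2) Suc(1)[OF Suc(2)]] by simp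
qed (simp add: rel_refl)

text \<open>Both \<open>x\<close> together with \<open>v\<close> and \<open>y\<close> together with
  \<open>u\<close> make up \<open>w\<close> with \<open>x\<close> and \<open>y\<close>, so the unit
  vectors differ by \<open>ind u - ind v\<close>. This is how a proper path yields links.\<close>

lemma rel_adjacent_edges:
  assumes "u \<in> E" "v \<in> E" "u = insert x w" "v = insert y w" "x \<notin> w" "y \<notin> w"
  shows "rel 0 (single x 1) (single y 1)"
proof (rule relI)
  have "finite w" using finite_edge[OF assms(1)] assms(3) by simp
  then show "single x 1 + ind v = single y 1 + ind u"
    using assms(3-) by (simp add: ind_def add_ac)
  show "ind u \<in> S (1 + 0)" "ind v \<in> S 1" using S_ind assms by auto
qed

text \<open>Every element of \<open>S t\<close> has total degree \<open>m * t\<close>, so one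
  coordinate is determined by the others, each of which is at most \<open>t\<close>.\<close>

lemma card_S_le: "card (S t) \<le> (t + 1) ^ (card V - 1)"
proof -
  obtain x where x: "x \<in> V" using V_nonempty by blast
  let ?r = "\<lambda>s. restrict (lookup s) (V - {x})"
  have "inj_on ?r (S t)"
  proof (rule inj_onI)
    fix s s' assume s: "s \<in> S t" "s' \<in> S t" "?r s = ?r s'"
    have eq: "lookup s y = lookup s' y" if "y \<in> V - {x}" for y
      using s(3) that by (metis restrict_apply')
    have "deg_on V s = deg_on V s'" using s deg_S by simp
    then have "lookup s x = lookup s' x"
      unfolding deg_on_def using x finite_V eq by (simp add: sum.remove[of V x])
    then show "s = s'" using s eq S_subset_mon by (intro mon_eqI[of s V s']) auto
  qed
  moreover have "?r ` S t \<subseteq> (V - {x}) \<rightarrow>\<^sub>E {..t}"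
    using lookup_S by (intro image_subsetI restrict_PiE_iff[THEN iffD2]) auto
  ultimately have "card (S t) \<le> card ((V - {x}) \<rightarrow>\<^sub>E {..t})"
    using finite_V by (intro card_inj_on_le) (auto intro: finite_PiE)
  then show ?thesis using x finite_V by (simp add: card_PiE)
qed

text \<open>If the edges satisfy a linear relation independent of uniformity, two coordinates of a
  sum of edges are determined by the others.\<close>

lemma card_S_le_degenerate:
  assumes "C \<subseteq> U" "U \<subseteq> V" "x \<in> C" "y \<in> U - C"
    and edges: "\<And>e. e \<in> E \<Longrightarrow> m * card (C \<inter> e) = k * card (U \<inter> e)"
  shows "card (S t) \<le> (t + 1) ^ (card V - 2)"
proof -
  let ?r = "\<lambda>s. restrict (lookup s) (V - {x, y})"
  have xy: "x \<in> V" "y \<in> V" "x \<noteq> y" "y \<notin> C" "x \<in> U" "y \<in> U" using assms by auto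
  have fin: "finite C" "finite U" using assms(1,2) finite_V by (auto intro: finite_subset)
  have weighted: "m * deg_on C s = k * deg_on U s" if "s \<in> S t" for s t
    using that
  proof (induction rule: S_induct)
    case (edge t e s)
    then show ?case using edges[of e] fin
      by (simp add: deg_on_add deg_on_ind finite_edge distrib_left)
  qed simp
  have "inj_on ?r (S t)"
  proof (rule inj_onI)
    fix s s' assume s: "s \<in> S t" "s' \<in> S t" "?r s = ?r s'"
    have eq: "lookup s z = lookup s' z" if "z \<in> V - {x, y}" for z
      using s(3) that by (metis restrict_apply')
    have split: "deg_on W s = lookup s x + lookup s y + sum (lookup s) (W - {x, y})"
      if "x \<in> W" "y \<in> W" "finite W" for W and s :: "'v \<Rightarrow>\<^sub>0 nat"
      unfolding deg_on_def using that xy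
      by (simp add: sum.remove[of W x] sum.remove[of "W - {x}" y] Diff_insert[symmetric] insert_commute)
    have eqs: "sum (lookup s) (W - {x, y}) = sum (lookup s') (W - {x, y})" if "W \<subseteq> V" for W
      using that eq by (intro sum.cong) auto
    \<comment> \<open>Only the coordinates at \<open>x\<close> and \<open>y\<close> are open. The
      degree on \<open>V\<close> fixes their sum, hence the degree on \<open>U\<close>; the relation
      then fixes the degree on \<open>C\<close>, which sees \<open>x\<close> but not
      \<open>y\<close>.\<close>
    have "deg_on V s = deg_on V s'" using s deg_S by simp
    then have xy_sum: "lookup s x + lookup s y = lookup s' x + lookup s' y"
      using xy finite_V eqs[of V] by (simp add: split)
    then have "deg_on U s = deg_on U s'" using xy fin eqs[of U] assms by (simp add: split)
    then have "m * deg_on C s = m * deg_on C s'" using weighted s by metis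
    then have "deg_on C s = deg_on C s'" using m_pos by simp
    moreover have "deg_on C r = lookup r x + sum (lookup r) (C - {x, y})" for r
    proof -
      have "C - {x} = C - {x, y}" using xy by blast
      then show ?thesis unfolding deg_on_def using assms(3) fin by (simp add: sum.remove[of C x])
    qed
    ultimately have "lookup s x = lookup s' x" using eqs[of C] assms by simp
    moreover then have "lookup s y = lookup s' y" using xy_sum by simp
    ultimately show "s = s'" using s eq S_subset_mon by (intro mon_eqI[of s V s']) auto
  qed
  moreover have "?r ` S t \<subseteq> (V - {x, y}) \<rightarrow>\<^sub>E {..t}"
    using lookup_S by (intro image_subsetI restrict_PiE_iff[THEN iffD2]) auto
  ultimately have "card (S t) \<le> card ((V - {x, y}) \<rightarrow>\<^sub>E {..t})"
    using finite_V by (intro card_inj_on_le) (auto intro: finite_PiE)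
  moreover have "card (V - {x, y}) = card V - 2"
    using xy finite_V by (simp add: card_Diff_subset)
  ultimately show ?thesis using finite_V by (simp add: card_PiE)
qed

lemma convergent_card_S: "convergent (\<lambda>t. real (card (S t)) / real t ^ (card V - 1))"
proof (rule ev_poly_bounded_convergent)
  show "ev_poly (\<lambda>t. real (card (S t)))"
    unfolding S_def by (intro sumset_ev_poly finite_imageI finite_E)
  fix t :: nat assume "t \<ge> 1"
  have "real (card (S t)) \<le> real ((t + 1) ^ (card V - 1))" using card_S_le by (simp only: of_nat_le_iff)
  also have "\<dots> \<le> (2 * real t) ^ (card V - 1)"
    unfolding of_nat_power using \<open>t \<ge> 1\<close> by (intro power_mono) auto
  finally show "\<bar>real (card (S t))\<bar> \<le> 2 ^ (card V - 1) * real t ^ (card V - 1)" by (simp add: power_mult_distrib)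
qed

section \<open>Bounding M t by a constant multiple of S t\<close>

definition B :: "nat \<Rightarrow> ('v \<Rightarrow>\<^sub>0 nat) set"
  where "B K = {b \<in> mon V. deg_on V b \<le> K}"

lemma finite_B: "finite (B K)"
proof (rule finite_subset[OF _ card_bounded_monomials(2)[OF finite_V, of "Suc K"]])
  show "B K \<subseteq> {b \<in> mon V. \<forall>x\<in>V. lookup b x < Suc K}"
    unfolding B_def deg_on_def
    by (auto simp: less_Suc_eq_le intro: order_trans[OF member_le_sum[OF _ _ finite_V]])
qed

lemma M_bound: "\<exists>K. \<forall>t. M t \<subseteq> (\<lambda>(s, b). s + b) ` (S t \<times> B K)"
proof -
  obtain K where K: "\<And>t s b. s \<in> S t \<Longrightarrow> b \<in> mon V \<Longrightarrow> s + b \<in> M t \<Longrightarrow> deg_on V b \<le> K"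
    using M_cofactor_bounded by blast
  have "M t \<subseteq> (\<lambda>(s, b). s + b) ` (S t \<times> B K)" for t
  proof
    fix a assume a: "a \<in> M t"
    then obtain s b where "a = s + b" "s \<in> S t" "b \<in> mon V" unfolding M_def N_def by blast
    then show "a \<in> (\<lambda>(s, b). s + b) ` (S t \<times> B K)" using K a unfolding B_def by auto
  qed
  then show ?thesis by blast
qed

lemma finite_M: "finite (M t)"
  using M_bound finite_S finite_B by (meson finite_SigmaI finite_imageI finite_subset)

text \<open>Only the bounded cofactors from \<open>B K\<close> occur beside an element of
  \<open>S t\<close>. This crude bound carries slow growth of \<open>S t\<close> over to
  \<open>M t\<close> in the degenerate case.\<close>

lemma card_M_le: "\<exists>C. \<forall>t. card (M t) \<le> C * card (S t)"
proof -
  obtain K where K: "\<And>t. M t \<subseteq> (\<lambda>(s, b). s + b) ` (S t \<times> B K)" using M_bound by blast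
  have "card (M t) \<le> card (B K) * card (S t)" for t
  proof -
    have fin: "finite (S t \<times> B K)" using finite_S finite_B by blast
    have "card (M t) \<le> card ((\<lambda>(s, b). s + b) ` (S t \<times> B K))"
      using K fin by (intro card_mono finite_imageI)
    also have "\<dots> \<le> card (S t \<times> B K)" using fin by (rule card_image_le)
    finally show ?thesis by (simp add: card_cartesian_product mult.commute)
  qed
  then show ?thesis by blast
qed

end

section \<open>Comparison of the two counting functions\<close>

text \<open>A bounded shift of the argument changes t^k by the factor (1 + p/t)^k, which tends to 1.
  It absorbs the shifts in the comparison of \<open>M t\<close> with \<open>S t\<close>.\<close>

lemma tendsto_shifted_ratio:
  fixes f :: "nat \<Rightarrow> real"
  assumes "(\<lambda>t. f t / real t ^ k) \<longlonglongrightarrow> l"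
  shows "(\<lambda>t. f (t + p) / real t ^ k) \<longlonglongrightarrow> l" "(\<lambda>t. f (t - p) / real t ^ k) \<longlonglongrightarrow> l"
proof -
  have lim: "(\<lambda>t. real p / real t) \<longlonglongrightarrow> 0" by (rule lim_const_over_n)
  have "(\<lambda>t. f (t + p) / real (t + p) ^ k * (1 + real p / real t) ^ k) \<longlonglongrightarrow> l * (1 + 0) ^ k"
    by (intro tendsto_intros lim LIMSEQ_ignore_initial_segment[OF assms])
  moreover have "\<forall>\<^sub>F t in sequentially. f (t + p) / real (t + p) ^ k * (1 + real p / real t) ^ k = f (t + p) / real t ^ k"
    unfolding eventually_sequentially
  proof (intro exI[of _ 1] allI impI)
    fix t :: nat assume t: "1 \<le> t"
    then have "1 + real p / real t = real (t + p) / real t" by (simp add: field_simps)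
    then show "f (t + p) / real (t + p) ^ k * (1 + real p / real t) ^ k = f (t + p) / real t ^ k"
      using t by (simp add: power_divide)
  qed
  ultimately show "(\<lambda>t. f (t + p) / real t ^ k) \<longlonglongrightarrow> l"
    using Lim_transform_eventually by force
  \<comment> \<open>The limit is taken along \<open>t + p\<close>, where the truncated difference is
    exact.\<close>
  have "(\<lambda>t. f (t + p - p) / real (t + p) ^ k) \<longlonglongrightarrow> l"
  proof -
    have "(\<lambda>t. f t / real t ^ k * (1 / (1 + real p / real t) ^ k)) \<longlonglongrightarrow> l * (1 / (1 + 0) ^ k)"
      by (intro tendsto_intros lim assms) simp
    moreover have "\<forall>\<^sub>F t in sequentially. f t / real t ^ k * (1 / (1 + real p / real t) ^ k) = f (t + p - p) / real (t + p) ^ k"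
      unfolding eventually_sequentially
    proof (intro exI[of _ 1] allI impI)
      fix t :: nat assume t: "1 \<le> t"
      then have "1 + real p / real t = real (t + p) / real t" by (simp add: field_simps)
      then show "f t / real t ^ k * (1 / (1 + real p / real t) ^ k) = f (t + p - p) / real (t + p) ^ k"
        using t by (simp add: power_divide)
    qed
    ultimately show ?thesis using Lim_transform_eventually by force
  qed
  then show "(\<lambda>t. f (t - p) / real t ^ k) \<longlonglongrightarrow> l" by (rule LIMSEQ_offset)
qed

lemma single_sum: "(\<Sum>x\<in>I. single i (f x)) = single i (sum f I)"
  by (induction I rule: infinite_finite_induct) (auto simp: single_add)

text \<open>The nodes of a component are linked when the lattice spanned by the edges contains all
  differences of their unit vectors; \<open>rep\<close> picks a representative of each component.\<close>

locale linked_edges = uniform_edges V E m for V :: "'v set" and E m +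
  fixes rep :: "'v \<Rightarrow> 'v"
  assumes rep_in: "x \<in> V \<Longrightarrow> rep x \<in> V"
    and rep_rep: "x \<in> V \<Longrightarrow> rep (rep x) = rep x"
    and rep_edge: "e \<in> E \<Longrightarrow> x \<in> e \<Longrightarrow> y \<in> e \<Longrightarrow> rep x = rep y"
    and covered: "x \<in> V \<Longrightarrow> \<exists>e\<in>E. x \<in> e"
    and linked: "x \<in> V \<Longrightarrow> rel 0 (single x 1) (single (rep x) 1)"
begin

section \<open>Normal forms modulo the lattice of edges\<close>

definition C :: "'v set"
  where "C = rep ` V"

definition comp :: "'v \<Rightarrow> 'v set"
  where "comp i = {x \<in> V. rep x = i}"

text \<open>An upper bound for the number of edges that can be split off from \<open>b\<close>: each
  edge uses up \<open>m\<close> units of the degree of a single component.\<close>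

definition fl :: "('v \<Rightarrow>\<^sub>0 nat) \<Rightarrow> nat"
  where "fl b = (\<Sum>i\<in>C. deg_on (comp i) b div m)"

text \<open>The normal form of the coset of \<open>b\<close>: each component keeps its degree modulo
  \<open>m\<close>, placed on the representative node.\<close>

definition nf :: "('v \<Rightarrow>\<^sub>0 nat) \<Rightarrow> 'v \<Rightarrow>\<^sub>0 nat"
  where "nf b = (\<Sum>i\<in>C. single i (deg_on (comp i) b mod m))"

text \<open>A transversal of the cosets, with one vector for each choice of component degrees modulo
  \<open>m\<close>.\<close>

definition R :: "('v \<Rightarrow>\<^sub>0 nat) set"
  where "R = {b \<in> mon C. \<forall>i\<in>C. lookup b i < m}"

lemma finite_C: "finite C"
  unfolding C_def using finite_V by simp

lemma C_subset: "C \<subseteq> V"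
  unfolding C_def using rep_in by blast

lemma rep_C: "i \<in> C \<Longrightarrow> rep i = i"
  unfolding C_def using rep_rep by auto

lemma finite_comp: "finite (comp i)"
  unfolding comp_def using finite_V by simp

lemma card_R: "card R = m ^ card C" and finite_R: "finite R"
  unfolding R_def using card_bounded_monomials[OF finite_C] by auto

lemma nf_in_R: "nf b \<in> R"
proof -
  have "lookup (nf b) i < m" if "i \<in> C" for i
    unfolding nf_def using that finite_C m_pos by (simp add: lookup_sum lookup_single when_def)
  then show ?thesis unfolding R_def nf_def by (auto intro!: mon_sum mon_single)
qed

lemma nf_R: "b \<in> R \<Longrightarrow> nf b = b" and fl_R: "b \<in> R \<Longrightarrow> fl b = 0"
proof -
  assume b: "b \<in> R"
  have deg: "deg_on (comp i) b = lookup b i" if "i \<in> C" for i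
  proof -
    have "deg_on (comp i) b = (\<Sum>x\<in>{i}. lookup b x)"
      unfolding deg_on_def
    proof (rule sum.mono_neutral_right)
      show "{i} \<subseteq> comp i" using that rep_C C_subset unfolding comp_def by auto
      show "\<forall>x\<in>comp i - {i}. lookup b x = 0"
      proof
        fix x assume x: "x \<in> comp i - {i}"
        then have "x \<notin> C" using rep_C unfolding comp_def by auto
        then show "lookup b x = 0" using b unfolding R_def mon_def by (auto simp: in_keys_iff)
      qed
    qed (rule finite_comp)
    then show ?thesis by simp
  qed
  have lt: "lookup b i < m" if "i \<in> C" for i using b that unfolding R_def by blast
  have "nf b = (\<Sum>i\<in>C. single i (lookup b i))"
    unfolding nf_def using deg lt by (intro sum.cong) auto
  also have "\<dots> = b" using monomial_expansion[OF finite_C, of b] b unfolding R_def by auto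
  finally show "nf b = b" .
  show "fl b = 0" unfolding fl_def using deg lt finite_C by simp
qed

lemma deg_comp_edge:
  assumes "e \<in> E" "x \<in> e"
  shows "deg_on (comp i) (ind e) = (if i = rep x then m else 0)"
proof -
  have "comp i \<inter> e = (if i = rep x then e else {})"
  proof -
    have "rep y = rep x" if "y \<in> e" for y using rep_edge[OF assms(1) that assms(2)] .
    moreover have "e \<subseteq> V" using assms(1) by (rule edge_subset)
    ultimately show ?thesis unfolding comp_def by (auto simp: subset_iff)
  qed
  then show ?thesis using assms by (simp add: deg_on_ind finite_comp finite_edge card_edge)
qed

lemma edge_nonempty: "e \<in> E \<Longrightarrow> \<exists>x. x \<in> e"
  using card_edge[of e] m_pos by (cases "e = {}") auto

lemma fl_add_edge: "e \<in> E \<Longrightarrow> fl (ind e + b) = Suc (fl b)"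
  and nf_add_edge: "e \<in> E \<Longrightarrow> nf (ind e + b) = nf b"
proof -
  assume e: "e \<in> E"
  then obtain x where x: "x \<in> e" using edge_nonempty by blast
  have "rep x \<in> C" using x edge_subset[OF e] unfolding C_def by blast
  have "deg_on (comp i) (ind e + b) div m = (if i = rep x then 1 else 0) + deg_on (comp i) b div m" for i
    using deg_comp_edge[OF e x, of i] m_pos by (simp add: deg_on_add)
  then show "fl (ind e + b) = Suc (fl b)"
    unfolding fl_def using finite_C \<open>rep x \<in> C\<close> by (simp add: sum.distrib)
  have "deg_on (comp i) (ind e + b) mod m = deg_on (comp i) b mod m" for i
    using deg_comp_edge[OF e x, of i] by (simp add: deg_on_add)
  then show "nf (ind e + b) = nf b" unfolding nf_def by simp
qed

lemma fl_add_S: "s \<in> S t \<Longrightarrow> fl (s + b) = t + fl b"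
proof (induction rule: S_induct)
  case (edge t e s)
  then show ?case using fl_add_edge[of e "s + b"] by (simp add: add.assoc)
qed simp

lemma nf_add_S: "s \<in> S t \<Longrightarrow> nf (s + b) = nf b"
proof (induction rule: S_induct)
  case (edge t e s)
  then show ?case using nf_add_edge[of e "s + b"] by (simp add: add.assoc)
qed simp

lemma N_fl: "a \<in> N t \<Longrightarrow> t \<le> fl a"
  unfolding N_def using fl_add_S by auto

text \<open>An edge through \<open>i\<close> has \<open>m\<close> nodes, all linked to
  \<open>i\<close>; moving each of them to \<open>i\<close> turns the edge into \<open>m\<close>
  copies of \<open>i\<close>.\<close>

lemma rel_single_m: "i \<in> C \<Longrightarrow> rel 1 (single i m) 0"
proof -
  assume i: "i \<in> C"
  then obtain e where e: "e \<in> E" "i \<in> e" using covered C_subset by blast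
  have "rel (\<Sum>x\<in>e. 0) (\<Sum>x\<in>e. single x 1) (\<Sum>x\<in>e. single i 1)"
  proof (rule rel_sum[OF finite_edge[OF e(1)]])
    fix x assume x: "x \<in> e"
    have "rep x = i" using rep_edge[OF e(1) x e(2)] rep_C[OF i] by simp
    then show "rel 0 (single x 1) (single i 1)" using linked x edge_subset[OF e(1)] by blast
  qed
  moreover have "(\<Sum>x\<in>e. single i 1) = single i m"
    using card_edge[OF e(1)] by (simp add: single_sum)
  ultimately have "rel 0 (ind e) (single i m)" unfolding ind_def by simp
  from rel_trans[OF rel_sym[OF this] rel_edge[OF e(1)]] show ?thesis by simp
qed

lemma rel_single_multiple: "i \<in> C \<Longrightarrow> rel q (single i (m * q + r)) (single i r)"
proof (induction q)
  case (Suc q)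
  have "single i (m * Suc q + r) = single i m + single i (m * q + r)"
    by (simp add: add.assoc flip: single_add)
  then show ?case using rel_add[OF rel_single_m[OF Suc(2)] Suc(1)[OF Suc(2)]] by simp
qed (simp add: rel_refl)

text \<open>Links move every exponent to the representative of its component, where whole blocks of
  \<open>m\<close> are traded for edges. The number of blocks is exactly
  \<open>fl b\<close>.\<close>

lemma rel_nf: "b \<in> mon V \<Longrightarrow> rel (fl b) b (nf b)"
proof -
  assume b: "b \<in> mon V"
  have "rel (\<Sum>x\<in>V. 0) (\<Sum>x\<in>V. single x (lookup b x)) (\<Sum>x\<in>V. single (rep x) (lookup b x))"
    by (rule rel_sum[OF finite_V rel_single[OF linked]])
  then have "rel 0 b (\<Sum>x\<in>V. single (rep x) (lookup b x))"
    using monomial_expansion[OF finite_V b] by simp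
  moreover have "(\<Sum>x\<in>V. single (rep x) (lookup b x)) = (\<Sum>i\<in>C. single i (deg_on (comp i) b))"
  proof -
    have "(\<Sum>x\<in>V. single (rep x) (lookup b x)) = (\<Sum>i\<in>C. \<Sum>x\<in>comp i. single (rep x) (lookup b x))"
      unfolding C_def comp_def by (rule sum.image_gen[OF finite_V])
    also have "\<dots> = (\<Sum>i\<in>C. single i (deg_on (comp i) b))"
    proof (intro sum.cong refl)
      fix i assume "i \<in> C"
      have "(\<Sum>x\<in>comp i. single (rep x) (lookup b x)) = (\<Sum>x\<in>comp i. single i (lookup b x))"
        by (intro sum.cong) (auto simp: comp_def)
      also have "\<dots> = single i (deg_on (comp i) b)"
        unfolding deg_on_def by (rule single_sum)
      finally show "(\<Sum>x\<in>comp i. single (rep x) (lookup b x)) = single i (deg_on (comp i) b)" .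
    qed
    finally show ?thesis .
  qed
  moreover have "rel (fl b) (\<Sum>i\<in>C. single i (deg_on (comp i) b)) (nf b)"
    unfolding fl_def nf_def
  proof (rule rel_sum[OF finite_C])
    fix i assume "i \<in> C"
    from rel_single_multiple[OF this, of "deg_on (comp i) b div m" "deg_on (comp i) b mod m"]
    show "rel (deg_on (comp i) b div m) (single i (deg_on (comp i) b)) (single i (deg_on (comp i) b mod m))"
      by simp
  qed
  ultimately show ?thesis using rel_trans[of 0] by force
qed

text \<open>For each node the congruence of x^m with one edge becomes an equation after adding some
  \<open>s2 x\<close>. Adding all the \<open>s2 x\<close> at once gives a vector that serves every
  node.\<close>

lemma deep_element:
  shows "\<exists>q u. u \<in> S q \<and> (\<forall>x\<in>V. u + single x m \<in> N (Suc q))"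
proof -
  have "rel 1 (single x m) 0" if "x \<in> V" for x
    using rel_trans[OF rel_single[OF linked[OF that]] rel_single_m] that unfolding C_def by auto
  then have "\<exists>p s1 s2. s1 \<in> S (p + 1) \<and> s2 \<in> S p \<and> single x m + s2 = 0 + s1" if "x \<in> V" for x
    using that unfolding rel_def by blast
  then obtain p s1 s2 where s: "\<And>x. x \<in> V \<Longrightarrow> s1 x \<in> S (p x + 1)" "\<And>x. x \<in> V \<Longrightarrow> s2 x \<in> S (p x)"
    "\<And>x. x \<in> V \<Longrightarrow> single x m + s2 x = 0 + s1 x" by metis
  show ?thesis
  proof (intro exI conjI ballI)
    show "sum s2 V \<in> S (sum p V)" using s(2) finite_V by (rule S_sum[rotated])
    fix x assume x: "x \<in> V"
    have "sum s2 V + single x m = (single x m + s2 x) + sum s2 (V - {x})"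
      using x finite_V by (simp add: sum.remove add_ac)
    also have "\<dots> = s1 x + sum s2 (V - {x})" using s(3)[OF x] by simp
    also have "\<dots> \<in> S ((p x + 1) + sum p (V - {x}))"
      using finite_V x s by (intro S_add S_sum) auto
    also have "(p x + 1) + sum p (V - {x}) = Suc (sum p V)"
      using x finite_V by (simp add: sum.remove)
    finally show "sum s2 V + single x m \<in> N (Suc (sum p V))" by (rule S_subset_N)
  qed
qed

text \<open>The sums \<open>u + s + b\<close> with a deep element \<open>u\<close>, \<open>s\<close>
  in \<open>S (t - q)\<close> and \<open>b\<close> in \<open>R\<close> lie in \<open>M t\<close>.
  They are distinct, since \<open>nf\<close> recovers \<open>b\<close>.\<close>

lemma card_M_ge: "\<exists>q. \<forall>t\<ge>q. m ^ card C * card (S (t - q)) \<le> card (M t)"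
proof -
  obtain q u where u: "u \<in> S q" "\<And>x. x \<in> V \<Longrightarrow> u + single x m \<in> N (Suc q)"
    using deep_element by blast
  have "m ^ card C * card (S (t - q)) \<le> card (M t)" if "t \<ge> q" for t
  proof -
    let ?f = "\<lambda>(s, b). u + s + b"
    have "inj_on ?f (S (t - q) \<times> R)"
    proof (rule inj_onI, clarify)
      fix s b s' b' assume *: "s \<in> S (t - q)" "b \<in> R" "s' \<in> S (t - q)" "b' \<in> R" "u + s + b = u + s' + b'"
      have "nf (u + s + b) = b" if "s \<in> S (t - q)" "b \<in> R" for s b
        using nf_add_S[OF S_add[OF u(1) that(1)]] nf_R[OF that(2)] by simp
      then have "b = b'" using * by metis
      then show "s = s' \<and> b = b'" using *(5) by simp
    qed
    moreover have "?f ` (S (t - q) \<times> R) \<subseteq> M t"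
    proof (rule image_subsetI, clarify)
      fix s b assume sb: "s \<in> S (t - q)" "b \<in> R"
      have us: "u + s \<in> S t" using S_add[OF u(1) sb(1)] that by simp
      have b: "b \<in> mon V" using sb(2) C_subset unfolding R_def mon_def by blast
      have "u + s + b \<in> N t" using us b by (intro N_add_mon S_subset_N)
      \<comment> \<open>Since \<open>fl b = 0\<close>, the value of \<open>fl\<close> is exactly
        \<open>t\<close>, which leaves no room for one more edge.\<close>
      moreover have "u + s + b \<notin> N (Suc t)"
        using N_fl[of "u + s + b" "Suc t"] fl_add_S[OF us, of b] fl_R[OF sb(2)] by auto
      moreover have "u + s + b + single x m \<in> N (Suc t)" if "x \<in> V" for x
      proof -
        have "u + single x m + s + b \<in> N (Suc q + (t - q))"
          by (intro N_add_mon N_add_S u(2) sb b that)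
        then show ?thesis using \<open>t \<ge> q\<close> by (simp add: add_ac)
      qed
      ultimately show "u + s + b \<in> M t" unfolding M_def by blast
    qed
    ultimately have "card (S (t - q) \<times> R) \<le> card (M t)" using finite_M by (rule card_inj_on_le)
    then show ?thesis by (simp add: card_cartesian_product card_R mult.commute)
  qed
  then show ?thesis by blast
qed

text \<open>Elements with \<open>fl a = t\<close> are translated into \<open>S (t + P)\<close> plus
  \<open>R\<close>, which gives the main term. If the cofactor \<open>b\<close> has positive
  \<open>fl b\<close>, the part \<open>s\<close> must avoid a translate of
  \<open>S (t - p b)\<close>, for otherwise an extra edge could be split off; the remaining count is
  a difference of nearby values, of lower order in the limit.\<close>

lemma card_M_upper:
  "\<exists>P (K :: ('v \<Rightarrow>\<^sub>0 nat) set) p. finite K \<and> (\<forall>t\<ge>P. card (M t) \<le> m ^ card C * card (S (t + P)) +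
     (\<Sum>b\<in>K. card (S t) - card (S (t - p b))))"
proof -
  obtain K where K: "\<And>t. M t \<subseteq> (\<lambda>(s, b). s + b) ` (S t \<times> B K)" using M_bound by blast
  have "\<exists>p s1 s2. s1 \<in> S (p + fl b) \<and> s2 \<in> S p \<and> b + s2 = nf b + s1" if "b \<in> B K" for b
    using rel_nf[of b] that unfolding rel_def B_def by blast
  then obtain p s1 s2 where s: "\<And>b. b \<in> B K \<Longrightarrow> s1 b \<in> S (p b + fl b)"
    "\<And>b. b \<in> B K \<Longrightarrow> s2 b \<in> S (p b)" "\<And>b. b \<in> B K \<Longrightarrow> b + s2 b = nf b + s1 b" by metis
  define P where "P = sum p (B K)"
  define U where "U = sum s2 (B K)"
  have pP: "p b \<le> P" if "b \<in> B K" for b unfolding P_def using that finite_B by (intro member_le_sum) auto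
  have "card (M t) \<le> m ^ card C * card (S (t + P)) + (\<Sum>b\<in>B K. card (S t) - card (S (t - p b)))"
    if "t \<ge> P" for t
  proof -
    \<comment> \<open>On \<open>M t\<close> the value of \<open>fl\<close> is at least
      \<open>t\<close>; \<open>M0\<close> is the part where it is attained.\<close>
    define M0 where "M0 = {a \<in> M t. fl a = t}"
    define M1 where "M1 b = (\<lambda>s. s + b) ` (S t - (\<lambda>s. s2 b + s) ` S (t - p b))" for b
    have "M t \<subseteq> M0 \<union> (\<Union>b\<in>B K. M1 b)"
    proof
      fix a assume a: "a \<in> M t"
      then obtain s b where ab: "a = s + b" "s \<in> S t" "b \<in> B K" using K[of t] by auto
      show "a \<in> M0 \<union> (\<Union>b\<in>B K. M1 b)"
      proof (cases "fl b = 0")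
        case True
        then have "a \<in> M0" using a fl_add_S[OF ab(2), of b] unfolding M0_def ab(1) by simp
        then show ?thesis by blast
      next
        case False
        \<comment> \<open>If \<open>s\<close> contained \<open>s2 b\<close>, then
          \<open>b + s2 b\<close> could be rewritten as \<open>nf b + s1 b\<close>, a gain of
          \<open>fl b\<close> edges, and \<open>a\<close> would lie in
          \<open>N (Suc t)\<close>.\<close>
        have "s \<notin> (\<lambda>s. s2 b + s) ` S (t - p b)"
        proof
          assume "s \<in> (\<lambda>s. s2 b + s) ` S (t - p b)"
          then obtain s' where s': "s = s2 b + s'" "s' \<in> S (t - p b)" by blast
          have "a = s' + (b + s2 b)" unfolding ab(1) s'(1) by (simp add: add_ac)
          also have "\<dots> = (s' + s1 b) + nf b" unfolding s(3)[OF ab(3)] by (simp add: add_ac)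
          finally have "a = (s' + s1 b) + nf b" .
          moreover have "nf b \<in> mon V" using nf_in_R[of b] C_subset unfolding R_def mon_def by blast
          ultimately have "a \<in> N ((t - p b) + (p b + fl b))"
            using s'(2) s(1)[OF ab(3)] by (simp only: N_add_mon S_subset_N S_add)
          moreover have "Suc t \<le> (t - p b) + (p b + fl b)" using pP[OF ab(3)] that False by simp
          ultimately have "a \<in> N (Suc t)" using N_antimono by blast
          then show False using a unfolding M_def by blast
        qed
        then have "a \<in> M1 b" using ab unfolding M1_def by blast
        then show ?thesis using ab(3) by blast
      qed
    qed
    moreover have fin: "finite M0" "finite (M1 b)" for b
      unfolding M0_def M1_def using finite_M finite_S by auto
    ultimately have "card (M t) \<le> card (M0 \<union> (\<Union>b\<in>B K. M1 b))"
      using finite_B by (intro card_mono) auto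
    also have "\<dots> \<le> card M0 + (\<Sum>b\<in>B K. card (M1 b))"
      using card_UN_le[OF finite_B, of M1 K] card_Un_le[of M0 "\<Union>b\<in>B K. M1 b"] by linarith
    also have "\<dots> \<le> m ^ card C * card (S (t + P)) + (\<Sum>b\<in>B K. card (S t) - card (S (t - p b)))"
    proof (intro add_mono sum_mono)
      \<comment> \<open>Translation by the single vector \<open>U\<close> clears the denominators
        for every cofactor at once: the summand \<open>s2 b\<close> is used for the rewriting, the
        others merely add edges.\<close>
      have "(\<lambda>a. a + U) ` M0 \<subseteq> (\<lambda>(s, b). s + b) ` (S (t + P) \<times> R)"
      proof (rule image_subsetI)
        fix a assume a: "a \<in> M0"
        then obtain s b where ab: "a = s + b" "s \<in> S t" "b \<in> B K" using K[of t] unfolding M0_def by auto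
        have fl: "fl b = 0" using a fl_add_S[OF ab(2), of b] unfolding M0_def ab(1) by simp
        have "a + U = s + (b + s2 b) + sum s2 (B K - {b})"
          unfolding ab(1) U_def using ab(3) finite_B by (simp add: sum.remove add_ac)
        also have "\<dots> = (s + s1 b + sum s2 (B K - {b})) + nf b"
          unfolding s(3)[OF ab(3)] by (simp add: add_ac)
        finally have eq: "a + U = (s + s1 b + sum s2 (B K - {b})) + nf b" .
        have "s + s1 b + sum s2 (B K - {b}) \<in> S (t + (p b + fl b) + sum p (B K - {b}))"
          using s ab finite_B by (intro S_add S_sum) auto
        also have "t + (p b + fl b) + sum p (B K - {b}) = t + P"
          unfolding P_def fl using ab(3) finite_B by (simp add: sum.remove)
        finally show "a + U \<in> (\<lambda>(s, b). s + b) ` (S (t + P) \<times> R)"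
          using eq nf_in_R[of b] by (intro image_eqI[where x = "(_, nf b)"]) auto
      qed
      moreover have "inj_on (\<lambda>a. a + U) M0" by (simp add: inj_on_def)
      moreover have finSR: "finite (S (t + P) \<times> R)" using finite_S finite_R by blast
      ultimately have "card M0 \<le> card ((\<lambda>(s, b). s + b) ` (S (t + P) \<times> R))"
        by (intro card_inj_on_le) auto
      also have "\<dots> \<le> card (S (t + P) \<times> R)" using finSR by (rule card_image_le)
      finally show "card M0 \<le> m ^ card C * card (S (t + P))"
        by (simp add: card_cartesian_product card_R mult.commute)
      fix b assume b: "b \<in> B K"
      have "card (M1 b) \<le> card (S t - (\<lambda>s. s2 b + s) ` S (t - p b))"
        unfolding M1_def using finite_S by (intro card_image_le) auto
      also have "\<dots> = card (S t) - card ((\<lambda>s. s2 b + s) ` S (t - p b))"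
      proof (rule card_Diff_subset)
        show "(\<lambda>s. s2 b + s) ` S (t - p b) \<subseteq> S t"
        proof (rule image_subsetI)
          fix s' assume "s' \<in> S (t - p b)"
          from S_add[OF s(2)[OF b] this] show "s2 b + s' \<in> S t" using pP[OF b] that by simp
        qed
      qed (use finite_S in blast)
      also have "card ((\<lambda>s. s2 b + s) ` S (t - p b)) = card (S (t - p b))"
        by (rule card_image) (simp add: inj_on_def)
      finally show "card (M1 b) \<le> card (S t) - card (S (t - p b))" .
    qed
    finally show ?thesis .
  qed
  then show ?thesis using finite_B by blast
qed

text \<open>Both bounds have the same limit: shifts of the argument do not matter, and each
  correction term is a difference of two sequences tending to \<open>l\<close>.\<close>

lemma card_M_tendsto:
  assumes "(\<lambda>t. real (card (S t)) / real t ^ k) \<longlonglongrightarrow> l"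
  shows "(\<lambda>t. real (card (M t)) / real t ^ k) \<longlonglongrightarrow> real m ^ card C * l"
proof -
  note shift = tendsto_shifted_ratio[OF assms]
  obtain q where q: "\<And>t. t \<ge> q \<Longrightarrow> m ^ card C * card (S (t - q)) \<le> card (M t)" using card_M_ge by blast
  obtain P and K :: "('v \<Rightarrow>\<^sub>0 nat) set" and p where P': "finite K \<and> (\<forall>t\<ge>P. card (M t) \<le> m ^ card C * card (S (t + P)) +
     (\<Sum>b\<in>K. card (S t) - card (S (t - p b))))" using card_M_upper by (elim exE)
  then have P: "finite K" "\<And>t. t \<ge> P \<Longrightarrow> card (M t) \<le> m ^ card C * card (S (t + P)) +
     (\<Sum>b\<in>K. card (S t) - card (S (t - p b)))" by auto
  obtain e where "e \<in> E" using V_nonempty covered by blast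
  \<comment> \<open>Adding a fixed sum of \<open>i\<close> edges embeds one set into the other;
    hence the truncated subtractions in the upper bound are genuine differences.\<close>
  have mono: "card (S (t - i)) \<le> card (S t)" if "t \<ge> i" for t i
  proof -
    have "e \<in> E" by fact
    then have "ind e \<in> S 1" by (rule S_ind)
    from S_sum[of "{..<i}" "\<lambda>_. ind e" "\<lambda>_. 1"] this
    have u: "(\<Sum>j<i. ind e) \<in> S i" by simp
    have "(\<lambda>s. (\<Sum>j<i. ind e) + s) ` S (t - i) \<subseteq> S t"
      using S_add[OF u, of _ "t - i"] that by auto
    moreover have "inj_on (\<lambda>s. (\<Sum>j<i. ind e) + s) (S (t - i))" by (simp add: inj_on_def)
    ultimately show ?thesis using finite_S by (intro card_inj_on_le)
  qed
  define lo where "lo t = real m ^ card C * (real (card (S (t - q))) / real t ^ k)" for t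
  define up where "up t = real m ^ card C * (real (card (S (t + P))) / real t ^ k)
     + (\<Sum>b\<in>K. real (card (S t)) / real t ^ k - real (card (S (t - p b))) / real t ^ k)" for t
  show ?thesis
  proof (rule tendsto_sandwich)
    show "lo \<longlonglongrightarrow> real m ^ card C * l" unfolding lo_def by (intro tendsto_intros shift(2))
    have "up \<longlonglongrightarrow> real m ^ card C * l + (\<Sum>b\<in>K. l - l)"
      unfolding up_def by (intro tendsto_intros shift assms)
    then show "up \<longlonglongrightarrow> real m ^ card C * l" by simp
    show "\<forall>\<^sub>F t in sequentially. lo t \<le> real (card (M t)) / real t ^ k"
      unfolding eventually_sequentially
    proof (intro exI[of _ q] allI impI)
      fix t assume "q \<le> t"
      then have "real (m ^ card C * card (S (t - q))) \<le> real (card (M t))" using q by (simp only: of_nat_le_iff)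
      then show "lo t \<le> real (card (M t)) / real t ^ k"
        unfolding lo_def by (simp add: divide_right_mono)
    qed
    show "\<forall>\<^sub>F t in sequentially. real (card (M t)) / real t ^ k \<le> up t"
      unfolding eventually_sequentially
    proof (intro exI[of _ "P + sum p K"] allI impI)
      fix t assume t: "P + sum p K \<le> t"
      have pt: "p b \<le> t" if "b \<in> K" for b using member_le_sum[OF that _ P(1), of p] t by simp
      have "real (card (M t)) \<le> real (m ^ card C * card (S (t + P)) + (\<Sum>b\<in>K. card (S t) - card (S (t - p b))))"
        using P(2)[of t] t by (simp only: of_nat_le_iff)
      also have "\<dots> = real m ^ card C * real (card (S (t + P))) + (\<Sum>b\<in>K. real (card (S t)) - real (card (S (t - p b))))"
        using mono[OF pt] by (simp add: of_nat_diff)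
      finally have "real (card (M t)) / real t ^ k \<le> (real m ^ card C * real (card (S (t + P)))
         + (\<Sum>b\<in>K. real (card (S t)) - real (card (S (t - p b))))) / real t ^ k"
        by (rule divide_right_mono) simp
      then show "real (card (M t)) / real t ^ k \<le> up t"
        unfolding up_def by (simp add: add_divide_distrib sum_divide_distrib diff_divide_distrib)
    qed
  qed
qed

end

section \<open>Connected components\<close>

locale proper_hypergraph =
  fixes G :: "'v hypergraph" and m :: nat
  assumes hypergraph: "hypergraph G" and no_isolated: "no_isolated_nodes G"
    and uniform: "uniform m G"
    and proper: "\<And>H. H \<in> connected_components G \<Longrightarrow> properly_connected m H"
begin

sublocale uniform_edges "nodes G" "edges G" m
  by unfold_locales (use hypergraph uniform in \<open>auto simp: hypergraph_def uniform_def\<close>)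

section \<open>Components as classes of nodes joined through shared edges\<close>

definition adj :: "('v \<times> 'v) set"
  where "adj = {(x, y). \<exists>e\<in>edges G. x \<in> e \<and> y \<in> e}"

definition cls :: "'v \<Rightarrow> 'v set"
  where "cls x = {y. (x, y) \<in> adj\<^sup>*}"

text \<open>The choice is made from the class, not from \<open>x\<close>, so that all nodes of a
  class receive the same representative.\<close>

definition rep :: "'v \<Rightarrow> 'v"
  where "rep x = (SOME y. y \<in> cls x)"

lemma sym_adj: "sym (adj\<^sup>*)"
  by (intro sym_rtrancl) (auto simp: adj_def sym_def)

lemma cls_refl: "x \<in> cls x"
  unfolding cls_def by simp

lemma cls_eq: "y \<in> cls x \<Longrightarrow> cls y = cls x"
  unfolding cls_def using sym_adj by (auto dest: symD intro: rtrancl_trans)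

lemma edge_cls: "e \<in> edges G \<Longrightarrow> y \<in> e \<Longrightarrow> y \<in> cls x \<Longrightarrow> e \<subseteq> cls x"
  unfolding cls_def adj_def by (auto intro: rtrancl_into_rtrancl)

lemma cls_subset: "x \<in> nodes G \<Longrightarrow> cls x \<subseteq> nodes G"
proof
  fix y assume x: "x \<in> nodes G" and "y \<in> cls x"
  then have "(x, y) \<in> adj\<^sup>*" unfolding cls_def by simp
  then show "y \<in> nodes G" using x
    by (induction rule: rtrancl_induct) (auto simp: adj_def dest: edge_subset)
qed

lemma rep_in_cls: "rep x \<in> cls x"
  unfolding rep_def using cls_refl by (metis someI_ex)

lemma node_edge: "x \<in> nodes G \<Longrightarrow> \<exists>e\<in>edges G. x \<in> e"
  using no_isolated unfolding no_isolated_nodes_def by blast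

lemma path_imp_cls:
  assumes "es \<noteq> []" "set es \<subseteq> edges G" "successively (\<lambda>e f. e \<inter> f \<noteq> {}) es" "x \<in> hd es" "y \<in> last es"
  shows "y \<in> cls x"
  using assms
proof (induction es arbitrary: x rule: induct_list012)
  case (2 e)
  then show ?case using edge_cls[OF _ _ cls_refl] by auto
next
  case (3 e f es)
  then obtain z where z: "z \<in> e" "z \<in> f" by auto
  have "y \<in> cls z" using 3 z by auto
  moreover have "z \<in> cls x" using edge_cls[of e x x] cls_refl 3 z by auto
  ultimately show ?case using cls_eq by blast
qed simp

lemma cls_imp_path:
  assumes "x \<in> nodes G" "y \<in> cls x"
  shows "\<exists>es. es \<noteq> [] \<and> set es \<subseteq> {e \<in> edges G. e \<subseteq> cls x} \<and> x \<in> hd es \<and> y \<in> last es \<and>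
    successively (\<lambda>e f. e \<inter> f \<noteq> {}) es"
proof -
  have "(x, y) \<in> adj\<^sup>*" using assms(2) unfolding cls_def by simp
  then show ?thesis
  proof (induction rule: rtrancl_induct)
    case base
    obtain e where e: "e \<in> edges G" "x \<in> e" using node_edge assms(1) by blast
    then show ?case using edge_cls[OF e cls_refl] by (intro exI[of _ "[e]"]) auto
  next
    case (step y z)
    then obtain es where es: "es \<noteq> []" "set es \<subseteq> {e \<in> edges G. e \<subseteq> cls x}" "x \<in> hd es" "y \<in> last es"
      "successively (\<lambda>e f. e \<inter> f \<noteq> {}) es" by blast
    obtain e where e: "e \<in> edges G" "y \<in> e" "z \<in> e" using step(2) unfolding adj_def by blast
    have "y \<in> cls x" using step(1) unfolding cls_def by simp
    then have "e \<subseteq> cls x" using edge_cls e by blast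
    then show ?case using es e by (intro exI[of _ "es @ [e]"]) (auto simp: successively_append_iff)
  qed
qed

lemma connected_subset_cls:
  assumes "connected_hypergraph (induced G U)" "x \<in> U"
  shows "U \<subseteq> cls x"
proof
  fix y assume y: "y \<in> U"
  show "y \<in> cls x"
  proof (cases "x = y")
    case False
    then obtain es where "es \<noteq> []" "set es \<subseteq> edges (induced G U)" "x \<in> hd es" "y \<in> last es"
      "successively (\<lambda>e f. e \<inter> f \<noteq> {}) es"
      using assms(1)[unfolded connected_hypergraph_def, rule_format, of x y] assms(2) y
      by (auto simp: induced_def)
    then show ?thesis by (intro path_imp_cls) (auto simp: induced_def)
  qed (simp add: cls_refl)
qed

lemma connected_cls:
  assumes "x \<in> nodes G"
  shows "connected_hypergraph (induced G (cls x))"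
  unfolding connected_hypergraph_def
proof (intro ballI impI)
  fix y z assume "y \<in> nodes (induced G (cls x))" "z \<in> nodes (induced G (cls x))"
  then have yz: "y \<in> cls x" "z \<in> cls x" by (auto simp: induced_def)
  then have "y \<in> nodes G" "z \<in> cls y" using cls_subset[OF assms] cls_eq[OF yz(1)] by auto
  from cls_imp_path[OF this]
  show "\<exists>es. es \<noteq> [] \<and> set es \<subseteq> edges (induced G (cls x)) \<and> y \<in> hd es \<and> z \<in> last es \<and>
     successively (\<lambda>e f. e \<inter> f \<noteq> {}) es"
    unfolding cls_eq[OF yz(1)] by (simp add: induced_def)
qed

text \<open>Classes induce connected hypergraphs, and a connected induced part lies in the class of
  each of its nodes; so the maximal ones are the classes themselves.\<close>

lemma components_eq: "connected_components G = induced G ` cls ` nodes G"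
proof (intro equalityI subsetI)
  fix H assume "H \<in> connected_components G"
  then obtain U where U: "H = induced G U" "U \<subseteq> nodes G" "U \<noteq> {}" "connected_hypergraph (induced G U)"
    and max: "\<forall>W. U \<subset> W \<and> W \<subseteq> nodes G \<longrightarrow> \<not> connected_hypergraph (induced G W)"
    unfolding connected_components_def mem_Collect_eq by (elim exE conjE)
  then obtain x where x: "x \<in> U" by blast
  then have xG: "x \<in> nodes G" using U by blast
  have "U \<subseteq> cls x" using connected_subset_cls U x by blast
  then have "U = cls x" using max connected_cls[OF xG] cls_subset[OF xG] by blast
  then show "H \<in> induced G ` cls ` nodes G" using U(1) xG by blast
next
  fix H assume "H \<in> induced G ` cls ` nodes G"
  then obtain x where x: "H = induced G (cls x)" "x \<in> nodes G" by blast
  have "\<not> connected_hypergraph (induced G W)" if "cls x \<subset> W" for W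
    using connected_subset_cls[of W x] that cls_refl by blast
  then show "H \<in> connected_components G"
    unfolding connected_components_def
    using x connected_cls[OF x(2)] cls_subset[OF x(2)] cls_refl[of x] by blast
qed

lemma card_components: "card (connected_components G) = card (rep ` nodes G)"
proof -
  have "inj_on (induced G) (cls ` nodes G)"
    by (rule inj_onI) (metis hypergraph.select_convs(1) induced_def)
  then have "card (connected_components G) = card (cls ` nodes G)"
    unfolding components_eq by (rule card_image)
  moreover have "inj_on (\<lambda>U. SOME y. y \<in> U) (cls ` nodes G)"
  proof (rule inj_onI)
    fix A B assume AB: "A \<in> cls ` nodes G" "B \<in> cls ` nodes G" "(SOME y. y \<in> A) = (SOME y. y \<in> B)"
    then obtain x y where "A = cls x" "B = cls y" by blast
    moreover then have "rep x = rep y" using AB(3) unfolding rep_def by simp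
    ultimately show "A = B" using rep_in_cls cls_eq by metis
  qed
  then have "card ((\<lambda>U. SOME y. y \<in> U) ` cls ` nodes G) = card (cls ` nodes G)" by (rule card_image)
  moreover have "(\<lambda>U. SOME y. y \<in> U) ` cls ` nodes G = rep ` nodes G"
    unfolding rep_def by (simp add: image_image)
  ultimately show ?thesis by simp
qed

text \<open>Consecutive edges of a proper path exchange one node \<open>a\<close> for one node
  \<open>b\<close>. The two are linked, and \<open>T\<close> contains either both or neither, so the
  count never changes along the path.\<close>

lemma card_class_const:
  assumes "x \<in> nodes G" "T \<subseteq> cls x"
    and closed: "\<And>a b. a \<in> cls x \<Longrightarrow> b \<in> cls x \<Longrightarrow> rel 0 (single a 1) (single b 1) \<Longrightarrow> a \<in> T \<longleftrightarrow> b \<in> T"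
    and uv: "u \<in> edges G" "u \<subseteq> cls x" "v \<in> edges G" "v \<subseteq> cls x"
  shows "card (T \<inter> u) = card (T \<inter> v)"
proof -
  have step: "card (T \<inter> e) = card (T \<inter> f)"
    if ef: "e \<in> edges G" "e \<subseteq> cls x" "f \<in> edges G" "f \<subseteq> cls x" "card (e \<inter> f) = m - 1" for e f
  proof -
    have fin: "finite e" "finite f" using finite_edge ef by auto
    have ab: "\<exists>a. e - f = {a} " if "e \<in> edges G" "f \<in> edges G" "card (e \<inter> f) = m - 1" for e f
    proof -
      have "card (e - f) = 1"
        using that m_pos finite_edge card_edge by (simp add: card_Diff_subset_Int)
      then show ?thesis by (simp add: card_1_singleton_iff)
    qed
    obtain a where a: "e - f = {a}" using ab[of e f] ef by blast
    obtain b where b: "f - e = {b}" using ab[of f e] ef by (auto simp: Int_commute)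
    have *: "e = insert a (e \<inter> f)" "f = insert b (e \<inter> f)" "a \<notin> e \<inter> f" "b \<notin> e \<inter> f" using a b by blast+
    have "a \<in> T \<longleftrightarrow> b \<in> T"
      using closed[of a b] rel_adjacent_edges[OF ef(1,3) *] a b ef by blast
    moreover have "T \<inter> e = (if a \<in> T then insert a (T \<inter> (e \<inter> f)) else T \<inter> (e \<inter> f))"
      "T \<inter> f = (if b \<in> T then insert b (T \<inter> (e \<inter> f)) else T \<inter> (e \<inter> f))" using * by auto
    ultimately show ?thesis using * fin by simp
  qed
  have "properly_connected m (induced G (cls x))" using proper components_eq assms(1) by blast
  then obtain es where es: "es \<noteq> []" "set es \<subseteq> {e \<in> edges G. e \<subseteq> cls x}" "hd es = u" "last es = v"
    "successively (\<lambda>e f. card (e \<inter> f) = m - 1) es"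
    using uv unfolding properly_connected_def by (auto simp: induced_def)
  have "card (T \<inter> hd es) = card (T \<inter> last es)" using es(1,2,5)
  proof (induction es rule: induct_list012)
    case (3 e f es)
    then show ?case using step[of e f] by auto
  qed auto
  then show ?thesis using es by simp
qed

theorem linked_or_degenerate:
  "linked_edges (nodes G) (edges G) m rep \<or>
    2 \<le> card (nodes G) \<and> (\<forall>t. card (S t) \<le> (t + 1) ^ (card (nodes G) - 2))"
proof (cases "\<forall>x\<in>nodes G. rel 0 (single x 1) (single (rep x) 1)")
  case True
  have "rep (rep x) = rep x" "rep x \<in> nodes G" if "x \<in> nodes G" for x
    using cls_eq[OF rep_in_cls, of x] rep_in_cls[of x] cls_subset[OF that] unfolding rep_def by auto
  moreover have "rep x = rep y" if "e \<in> edges G" "x \<in> e" "y \<in> e" for e x y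
    using cls_eq[of y x] edge_cls[OF that(1,2) cls_refl] that unfolding rep_def by auto
  ultimately have "linked_edges (nodes G) (edges G) m rep"
    using True node_edge by unfold_locales fast+
  then show ?thesis by blast
next
  case False
  then obtain z where z: "z \<in> nodes G" "\<not> rel 0 (single z 1) (single (rep z) 1)" by blast
  \<comment> \<open>The nodes linked to \<open>z\<close> form a proper part of its class, since
    \<open>rep z\<close> is missing.\<close>
  define T where "T = {y \<in> cls z. rel 0 (single z 1) (single y 1)}"
  obtain e0 where e0: "e0 \<in> edges G" "z \<in> e0" using node_edge z by blast
  have e0_sub: "e0 \<subseteq> cls z" using edge_cls[OF e0 cls_refl] .
  have closed: "a \<in> T \<longleftrightarrow> b \<in> T" if ab: "a \<in> cls z" "b \<in> cls z" "rel 0 (single a 1) (single b 1)" for a b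
    using ab rel_trans[of 0 "single z 1" "single a 1" 0 "single b 1"]
      rel_trans[of 0 "single z 1" "single b 1" 0 "single a 1"] rel_sym[OF ab(3)]
    unfolding T_def by auto
  have "card (S t) \<le> (t + 1) ^ (card (nodes G) - 2)" for t
  \<comment> \<open>The extra linear relation: edges inside the class of \<open>z\<close> meet it in
    \<open>m\<close> nodes and meet \<open>T\<close> in as many nodes as \<open>e0\<close> does; for
    all other edges both counts are 0.\<close>
  proof (rule card_S_le_degenerate[of T "cls z" z "rep z" "card (T \<inter> e0)"])
    show "T \<subseteq> cls z" unfolding T_def by blast
    show "cls z \<subseteq> nodes G" using cls_subset z by blast
    show "z \<in> T" unfolding T_def using cls_refl rel_refl by blast
    show "rep z \<in> cls z - T" unfolding T_def using z rep_in_cls by blast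
    fix e assume e: "e \<in> edges G"
    show "m * card (T \<inter> e) = card (T \<inter> e0) * card (cls z \<inter> e)"
    proof (cases "e \<inter> cls z = {}")
      case True
      then have "cls z \<inter> e = {}" "T \<inter> e = {}" unfolding T_def by auto
      then show ?thesis by simp
    next
      case False
      then have sub: "e \<subseteq> cls z" using edge_cls e by blast
      then have "card (T \<inter> e) = card (T \<inter> e0)"
        using card_class_const[of z T e e0] closed z(1) e e0(1) e0_sub unfolding T_def by blast
      moreover have "cls z \<inter> e = e" using sub by blast
      ultimately show ?thesis using card_edge[OF e] by simp
    qed
  qed
  moreover have "2 \<le> card (nodes G)"
  proof -
    have "z \<noteq> rep z" using z(2) rel_refl by metis
    then have "card {z, rep z} = 2" by simp
    moreover have "{z, rep z} \<subseteq> nodes G" using z(1) rep_in_cls[of z] cls_subset[of z] by blast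
    ultimately show ?thesis using card_mono[OF finite_V] by metis
  qed
  ultimately show ?thesis by blast
qed

end

section \<open>Products of polynomials and their supports\<close>

lemma mpoly_expansion: "p = (\<Sum>a\<in>keys p. single a (lookup p a))"
  by (rule poly_mapping_eqI) (auto simp: lookup_sum lookup_single when_def in_keys_iff)

definition restr :: "'a set \<Rightarrow> ('a \<Rightarrow>\<^sub>0 'b::comm_monoid_add) \<Rightarrow> 'a \<Rightarrow>\<^sub>0 'b"
  where "restr F p = (\<Sum>a\<in>keys p \<inter> F. single a (lookup p a))"

lemma lookup_restr: "lookup (restr F p) a = (if a \<in> F then lookup p a else 0)"
  unfolding restr_def by (auto simp: lookup_sum lookup_single when_def in_keys_iff)

lemma keys_restr: "keys (restr F p) = keys p \<inter> F"
  by (auto simp: in_keys_iff lookup_restr split: if_splits)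

lemma restr_split: "p = restr F p + restr (- F) p"
  by (rule poly_mapping_eqI) (simp add: lookup_add lookup_restr)

lemma keys_mult_subset:
  assumes "\<And>a b. a \<in> keys p \<Longrightarrow> b \<in> keys q \<Longrightarrow> a + b \<in> X"
  shows "keys (p * q) \<subseteq> X"
  using keys_mult[of p q] assms by blast

lemma keys_add_subset: "keys p \<subseteq> X \<Longrightarrow> keys q \<subseteq> X \<Longrightarrow> keys (p + q) \<subseteq> X"
  using keys_add[of p q] by blast

lemma lookup_const_mult: "lookup (single 0 c * p) a = c * lookup (p :: 'a::monoid_add \<Rightarrow>\<^sub>0 'b::semiring_0) a"
  by (simp add: mult_map_scale_conv_mult[symmetric] map.rep_eq when_def)

text \<open>A leading term argument. The finitely many variables that occur are coded by naturals,
  which yields a linear order on their exponent vectors compatible with addition; the product of the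
  two leading terms cannot cancel.\<close>

lemma mpoly_mult_nonzero:
  fixes p q :: "('v, 'k::field) mpoly"
  assumes "p \<noteq> 0" "q \<noteq> 0"
  shows "p * q \<noteq> 0"
proof -
  define X where "X = (\<Union>a\<in>keys p \<union> keys q. keys a)"
  have "finite X" unfolding X_def by simp
  then obtain f :: "'v \<Rightarrow> nat" where f: "inj_on f X" by (meson finite_imp_inj_to_nat_seg)
  define \<phi> where "\<phi> a = (\<Sum>x\<in>X. single (f x) (lookup a x))" for a :: "'v \<Rightarrow>\<^sub>0 nat"
  have \<phi>_add: "\<phi> (a + b) = \<phi> a + \<phi> b" for a b
    unfolding \<phi>_def by (simp add: lookup_add single_add sum.distrib)
  have lookup_\<phi>: "lookup (\<phi> a) (f x) = lookup a x" if "x \<in> X" for a x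
  proof -
    have "lookup (\<phi> a) (f x) = (\<Sum>y\<in>X. if y = x then lookup a y else 0)"
      unfolding \<phi>_def lookup_sum lookup_single when_def
      by (intro sum.cong refl) (simp add: inj_on_eq_iff[OF f _ that])
    then show ?thesis using that \<open>finite X\<close> by simp
  qed
  have \<phi>_inj: "a = b" if "\<phi> a = \<phi> b" "a \<in> keys p \<union> keys q" "b \<in> keys p \<union> keys q" for a b
  proof (rule mon_eqI[of a X])
    show "a \<in> mon X" "b \<in> mon X" using that unfolding X_def mon_def by auto
    show "lookup a x = lookup b x" if "x \<in> X" for x
      using lookup_\<phi>[OF that, of a] lookup_\<phi>[OF that, of b] \<open>\<phi> a = \<phi> b\<close> by simp
  qed
  have max: "\<exists>a\<in>keys r. \<forall>b\<in>keys r. b \<noteq> a \<longrightarrow> \<phi> b < \<phi> a" if "r \<noteq> 0" "keys r \<subseteq> keys p \<union> keys q" for r :: "('v, 'k) mpoly"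
  proof -
    have ne: "\<phi> ` keys r \<noteq> {}" using that(1) by (simp add: poly_mapping_eq_iff keys.rep_eq fun_eq_iff)
    then have "Max (\<phi> ` keys r) \<in> \<phi> ` keys r" by (intro Max_in) auto
    then obtain a where a: "a \<in> keys r" "Max (\<phi> ` keys r) = \<phi> a" by blast
    have "\<phi> b < \<phi> a" if b: "b \<in> keys r" "b \<noteq> a" for b
    proof -
      have "\<phi> b \<le> \<phi> a" using b a(2) Max_ge[of "\<phi> ` keys r" "\<phi> b"] by simp
      moreover have "\<phi> b \<noteq> \<phi> a" using \<phi>_inj[of b a] b a \<open>keys r \<subseteq> _\<close> by blast
      ultimately show ?thesis by simp
    qed
    then show ?thesis using a by blast
  qed
  obtain a where a: "a \<in> keys p" "\<And>b. b \<in> keys p \<Longrightarrow> b \<noteq> a \<Longrightarrow> \<phi> b < \<phi> a" using max[of p] assms by blast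
  obtain b where b: "b \<in> keys q" "\<And>c. c \<in> keys q \<Longrightarrow> c \<noteq> b \<Longrightarrow> \<phi> c < \<phi> b" using max[of q] assms by blast
  define p' where "p' = restr (- {a}) p"
  define q' where "q' = restr (- {b}) q"
  have p: "p = single a (lookup p a) + p'" and q: "q = single b (lookup q b) + q'"
    unfolding p'_def q'_def by (rule poly_mapping_eqI; simp add: lookup_add lookup_restr lookup_single when_def)+
  have split: "p * q = single (a + b) (lookup p a * lookup q b) + (single a (lookup p a) * q' + p' * q)"
  proof -
    define c where "c = lookup p a"
    define d where "d = lookup q b"
    have pc: "p = single a c + p'" and qd: "q = single b d + q'" using p q unfolding c_def d_def .
    have "p * q = single a c * q + p' * q" unfolding pc by (rule distrib_right)
    also have "single a c * q = single (a + b) (c * d) + single a c * q'"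
      unfolding qd by (simp add: distrib_left mult_single)
    finally show ?thesis unfolding c_def d_def by (simp add: add.assoc)
  qed
  have "a + b \<notin> keys (single a (lookup p a) * q')"
  proof
    assume "a + b \<in> keys (single a (lookup p a) * q')"
    then obtain c d where "c \<in> keys (single a (lookup p a))" "d \<in> keys q'" "a + b = c + d"
      using keys_mult by blast
    then have "b \<in> keys q'" by (auto split: if_splits)
    then show False unfolding q'_def keys_restr by simp
  qed
  moreover have "a + b \<notin> keys (p' * q)"
  proof
    assume "a + b \<in> keys (p' * q)"
    then obtain c d where cd: "c \<in> keys p'" "d \<in> keys q" "a + b = c + d" using keys_mult by blast
    then have "c \<in> keys p" "c \<noteq> a" unfolding p'_def keys_restr by auto
    then have "\<phi> c < \<phi> a" using a(2) by blast
    moreover have "\<phi> d \<le> \<phi> b" using b(2)[OF cd(2)] by (cases "d = b") auto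
    ultimately have "\<phi> c + \<phi> d < \<phi> a + \<phi> b" by (rule add_less_le_mono)
    then show False using cd(3) by (simp flip: \<phi>_add)
  qed
  ultimately have "lookup (p * q) (a + b) = lookup p a * lookup q b"
    by (subst split) (simp add: lookup_add in_keys_iff)
  also have "\<dots> \<noteq> 0" using a(1) b(1) by (simp add: in_keys_iff)
  finally show ?thesis by auto
qed

text \<open>Split both factors into their parts inside and outside \<open>I\<close>. The product of
  the outer parts is nonzero and supported outside \<open>I\<close>, where the remaining products,
  all supported in \<open>I\<close>, cannot cancel it.\<close>

lemma support_in_prime_complement:
  fixes p q :: "('v, 'k::field) mpoly"
  assumes keys: "keys p \<subseteq> T" "keys q \<subseteq> T" and pq: "keys (p * q) \<subseteq> I"
    and ideal: "\<And>a b. a \<in> I \<Longrightarrow> b \<in> T \<Longrightarrow> a + b \<in> I"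
    and prime: "\<And>a b. a \<in> T - I \<Longrightarrow> b \<in> T - I \<Longrightarrow> a + b \<notin> I"
  shows "keys p \<subseteq> I \<or> keys q \<subseteq> I"
proof (rule ccontr)
  assume neg: "\<not> ?thesis"
  define p1 where "p1 = restr (- I) p"
  define p2 where "p2 = restr I p"
  define q1 where "q1 = restr (- I) q"
  define q2 where "q2 = restr I q"
  have k: "keys p1 \<subseteq> T - I" "keys q1 \<subseteq> T - I" "keys p2 \<subseteq> I" "keys q2 \<subseteq> I"
    unfolding p1_def p2_def q1_def q2_def keys_restr using keys by auto
  have "keys p1 \<noteq> {}" "keys q1 \<noteq> {}" unfolding p1_def q1_def keys_restr using neg by auto
  then have "p1 * q1 \<noteq> 0" by (intro mpoly_mult_nonzero) auto
  then obtain a where a: "lookup (p1 * q1) a \<noteq> 0"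
    by (metis lookup_zero poly_mapping_eqI)
  have "keys (p1 * q1) \<subseteq> - I" using prime k by (intro keys_mult_subset) blast
  then have aI: "a \<notin> I" using a by (auto simp: in_keys_iff)
  have split: "p * q = p1 * q1 + (p1 * q2 + p2 * q)"
  proof -
    have "p = p1 + p2" "q = q1 + q2"
      unfolding p1_def p2_def q1_def q2_def
      by (rule restr_split[of _ "- I", unfolded double_compl])+
    then have "p * q = (p1 + p2) * q" "p1 * q = p1 * (q1 + q2)" by simp_all
    then show ?thesis by (simp only: distrib_left distrib_right add.assoc)
  qed
  have "keys (p1 * q2) \<subseteq> I"
  proof (rule keys_mult_subset)
    fix a b assume "a \<in> keys p1" "b \<in> keys q2"
    then have "b + a \<in> I" using ideal k by blast
    then show "a + b \<in> I" by (simp add: add.commute)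
  qed
  moreover have "keys (p2 * q) \<subseteq> I" using ideal k keys by (intro keys_mult_subset) blast
  ultimately have "lookup (p1 * q2 + p2 * q) a = 0"
    using aI keys_add_subset[of "p1 * q2" I "p2 * q"] by (auto simp: in_keys_iff)
  then have "lookup (p * q) a \<noteq> 0" using a unfolding split by (simp add: lookup_add)
  then show False using pq aI by (auto simp: in_keys_iff)
qed

text \<open>The exponent 0 arises only as 0 + 0, because exponents are natural numbers.\<close>

lemma lookup_mult_0: "lookup (p * q) 0 = lookup p 0 * lookup (q :: ('v, 'k::field) mpoly) 0"
proof -
  have split: "p * q = single 0 (lookup p 0) * q + restr (- {0}) p * q"
  proof -
    have "p = single 0 (lookup p 0) + restr (- {0}) p"
      by (rule poly_mapping_eqI) (simp add: lookup_add lookup_restr lookup_single when_def)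
    then show ?thesis by (metis distrib_right)
  qed
  have "0 \<notin> keys (restr (- {0}) p * q)"
  proof
    assume "0 \<in> keys (restr (- {0}) p * q)"
    then obtain a b where ab: "a \<in> keys (restr (- {0}) p)" "0 = a + b" using keys_mult by blast
    have "a = 0"
    proof (rule poly_mapping_eqI)
      fix x show "lookup a x = lookup 0 x"
        using arg_cong[OF ab(2), of "\<lambda>c. lookup c x"] by (simp add: lookup_add)
    qed
    then show False using ab(1) by (simp add: keys_restr)
  qed
  then show ?thesis by (subst split) (simp add: lookup_add lookup_const_mult in_keys_iff)
qed

lemma deg_on_pos: "finite V \<Longrightarrow> b \<in> mon V \<Longrightarrow> b \<noteq> 0 \<Longrightarrow> 0 < deg_on V b"
proof -
  assume V: "finite V" "b \<in> mon V" "b \<noteq> 0"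
  then obtain x where "lookup b x \<noteq> 0" by (metis lookup_zero poly_mapping_eqI)
  moreover then have "x \<in> V" using V unfolding mon_def by (auto simp: in_keys_iff)
  ultimately show ?thesis unfolding deg_on_def using V by (simp add: sum_pos2[of V x])
qed

text \<open>Monomial ideals are contracted from the localization at the origin.\<close>

lemma monomial_ideal_saturated:
  fixes f u :: "('v, 'k::field) mpoly"
  assumes V: "finite V" and keys: "keys f \<subseteq> mon V" "keys u \<subseteq> mon V" and u: "lookup u 0 \<noteq> 0"
    and uf: "keys (u * f) \<subseteq> I" and ideal: "\<And>a b. a \<in> I \<Longrightarrow> b \<in> mon V \<Longrightarrow> a + b \<in> I"
  shows "keys f \<subseteq> I"
proof (rule ccontr)
  assume "\<not> ?thesis"
  then have ex: "\<exists>a. a \<in> keys f - I" by blast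
  \<comment> \<open>A monomial of least degree outside \<open>I\<close>. Non-constant terms of
    \<open>u\<close> could reach it only from monomials of \<open>f\<close> that are smaller and
    also outside \<open>I\<close>, so its coefficient in \<open>u * f\<close> comes from the
    constant term of \<open>u\<close> alone.\<close>
  define a where "a = arg_min (deg_on V) (\<lambda>a. a \<in> keys f - I)"
  have a: "a \<in> keys f" "a \<notin> I" and min: "\<And>b. b \<in> keys f - I \<Longrightarrow> deg_on V a \<le> deg_on V b"
    using ex arg_min_natI[of "\<lambda>a. a \<in> keys f - I" _ "deg_on V"] arg_min_nat_le[of "\<lambda>a. a \<in> keys f - I" _ "deg_on V"]
    unfolding a_def by blast+
  have "a \<notin> keys (restr (- {0}) u * f)"
  proof
    assume "a \<in> keys (restr (- {0}) u * f)"
    then obtain b c where bc: "b \<in> keys (restr (- {0}) u)" "c \<in> keys f" "a = b + c" using keys_mult by blast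
    then have b: "b \<in> mon V" "b \<noteq> 0" using keys unfolding keys_restr by auto
    then have "c \<notin> I" using ideal[of c b] a(2) bc(3) by (auto simp: add.commute)
    then have "deg_on V a \<le> deg_on V c" using min bc(2) by blast
    then show False using deg_on_pos[OF V b] unfolding bc(3) deg_on_add by simp
  qed
  moreover have "u * f = single 0 (lookup u 0) * f + restr (- {0}) u * f"
  proof -
    have "u = single 0 (lookup u 0) + restr (- {0}) u"
      by (rule poly_mapping_eqI) (simp add: lookup_add lookup_restr lookup_single when_def)
    then show ?thesis by (metis distrib_right)
  qed
  ultimately have "lookup (u * f) a = lookup u 0 * lookup f a"
    by (simp add: lookup_add lookup_const_mult in_keys_iff)
  then have "a \<in> keys (u * f)" using u a(1) by (simp add: in_keys_iff)
  then show False using uf a(2) by blast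
qed

section \<open>Spans of monomials\<close>

lemma const_eq: "const c = single 0 c"
  unfolding const_def by simp

lemma span_monomials: "mpoly.span ((\<lambda>a. single a (1::'k::field)) ` X) = {p :: ('v, 'k) mpoly. keys p \<subseteq> X}"
proof (intro equalityI subsetI)
  fix p :: "('v, 'k) mpoly" assume "p \<in> mpoly.span ((\<lambda>a. single a 1) ` X)"
  then show "p \<in> {p. keys p \<subseteq> X}"
  proof (induction rule: mpoly.span_induct_alt)
    case (step c x y)
    then have "keys (const c * x) \<subseteq> X" unfolding const_eq by (auto simp: in_keys_iff lookup_const_mult lookup_single when_def split: if_splits)
    then show ?case using keys_add_subset[of "const c * x" X y] step by simp
  qed simp
next
  fix p :: "('v, 'k) mpoly" assume p: "p \<in> {p. keys p \<subseteq> X}"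
  have "p = (\<Sum>a\<in>keys p. const (lookup p a) * single a 1)"
    unfolding const_eq by (subst mpoly_expansion[of p]) (simp add: mult_single)
  also have "\<dots> \<in> mpoly.span ((\<lambda>a. single a 1) ` X)"
    using p by (intro mpoly.span_sum mpoly.span_scale mpoly.span_base) auto
  finally show "p \<in> mpoly.span ((\<lambda>a. single a 1) ` X)" .
qed

lemma independent_monomials: "mpoly.independent ((\<lambda>a. single a (1::'k::field)) ` X :: ('v, 'k) mpoly set)"
proof
  assume "mpoly.dependent ((\<lambda>a. single a (1::'k)) ` X :: ('v, 'k) mpoly set)"
  then obtain t u v where t: "finite t" "t \<subseteq> (\<lambda>a. single a (1::'k)) ` X"
    "(\<Sum>v\<in>t. const (u v) * v) = 0" "v \<in> t" "u v \<noteq> 0"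
    unfolding mpoly.dependent_explicit by blast
  obtain a where a: "v = single a 1" using t by blast
  have "lookup (\<Sum>v\<in>t. const (u v) * v) a = (\<Sum>w\<in>t. if w = v then u w else 0)"
    unfolding lookup_sum const_eq lookup_const_mult
  proof (rule sum.cong[OF refl])
    fix w assume "w \<in> t"
    then obtain b where b: "w = single b 1" using t(2) by blast
    have "w = v \<longleftrightarrow> a = b"
      unfolding a b by (metis lookup_single_eq lookup_single_not_eq zero_neq_one)
    then show "u w * lookup w a = (if w = v then u w else 0)"
      unfolding b by (auto simp: lookup_single when_def)
  qed
  then show False using t by simp
qed

lemma dim_monomials: "mpoly.dim {p :: ('v, 'k::field) mpoly. keys p \<subseteq> X} = card X"
proof -
  have "mpoly.dim (mpoly.span ((\<lambda>a. single a (1::'k)) ` X :: ('v, 'k) mpoly set)) = card ((\<lambda>a. single a (1::'k)) ` X)"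
    by (rule mpoly.dim_span_eq_card_independent[OF independent_monomials])
  moreover have "inj_on (\<lambda>a. single a (1::'k)) X"
    by (rule inj_onI) (metis lookup_single_eq lookup_single_not_eq zero_neq_one)
  ultimately show ?thesis unfolding span_monomials by (simp add: card_image)
qed

section \<open>Krull dimension of algebras of polynomials\<close>

text \<open>Presents a subset of a type class ring as a ring record, so that facts about ideals of
  records can be proved with ordinary polynomial arithmetic.\<close>

definition class_ring :: "'a::comm_ring_1 set \<Rightarrow> 'a ring"
  where "class_ring A = \<lparr>carrier = A, monoid.mult = (*), one = 1, zero = 0, add = (+)\<rparr>"

definition subalg :: "('v, 'k::field) mpoly set \<Rightarrow> bool"
  where "subalg A \<longleftrightarrow> range const \<subseteq> A \<and> (\<forall>a\<in>A. \<forall>b\<in>A. a + b \<in> A \<and> a * b \<in> A)"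

definition prime_in :: "'a::comm_ring_1 set \<Rightarrow> 'a set \<Rightarrow> bool"
  where "prime_in A P \<longleftrightarrow> P \<subseteq> A \<and> 0 \<in> P \<and> (\<forall>a\<in>P. \<forall>b\<in>P. a + b \<in> P) \<and> (\<forall>a\<in>A. \<forall>b\<in>P. a * b \<in> P) \<and>
     1 \<notin> P \<and> (\<forall>a\<in>A. \<forall>b\<in>A. a * b \<in> P \<longrightarrow> a \<in> P \<or> b \<in> P)"

lemma const_1 [simp]: "const 1 = 1"
  unfolding const_eq by simp

lemma const_0 [simp]: "const 0 = 0"
  unfolding const_eq by simp

lemma const_mult: "const c * const d = const (c * d)"
  unfolding const_eq by (simp add: mult_single)

lemma const_minus_1: "const (- 1) * p = - p"
proof -
  have "const (- 1) = - const 1" unfolding const_eq by (rule single_uminus)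
  then show ?thesis by simp
qed

lemma subalg_closed:
  assumes "subalg A"
  shows "const c \<in> A" "0 \<in> A" "1 \<in> A" "a \<in> A \<Longrightarrow> b \<in> A \<Longrightarrow> a + b \<in> A" "a \<in> A \<Longrightarrow> b \<in> A \<Longrightarrow> a * b \<in> A"
    "a \<in> A \<Longrightarrow> - a \<in> A"
proof -
  show c: "const c \<in> A" for c using assms unfolding subalg_def by blast
  show "0 \<in> A" "1 \<in> A" using c[of 0] c[of 1] by simp_all
  show "a \<in> A \<Longrightarrow> b \<in> A \<Longrightarrow> a + b \<in> A" "a \<in> A \<Longrightarrow> b \<in> A \<Longrightarrow> a * b \<in> A"
    using assms unfolding subalg_def by blast+
  show "a \<in> A \<Longrightarrow> - a \<in> A"
    using assms c[of "- 1"] const_minus_1[of a] unfolding subalg_def by metis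
qed

lemma subalg_sum: "subalg A \<Longrightarrow> (\<And>i. i \<in> I \<Longrightarrow> f i \<in> A) \<Longrightarrow> sum f I \<in> A"
  by (induction I rule: infinite_finite_induct) (auto intro: subalg_closed)

lemma subalg_power: "subalg A \<Longrightarrow> a \<in> A \<Longrightarrow> a ^ k \<in> A"
  by (induction k) (auto intro: subalg_closed)

lemma cring_class_ring:
  assumes "subalg A" shows "cring (class_ring A)"
proof (rule cringI)
  note cl = subalg_closed[OF assms]
  show "abelian_group (class_ring A)"
  proof (rule abelian_groupI)
    fix x assume "x \<in> carrier (class_ring A)"
    then show "\<exists>y\<in>carrier (class_ring A). y \<oplus>\<^bsub>class_ring A\<^esub> x = \<zero>\<^bsub>class_ring A\<^esub>"
      unfolding class_ring_def by (intro bexI[of _ "- x"]) (auto intro: cl)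
  qed (auto simp: class_ring_def add_ac intro: cl)
  show "comm_monoid (class_ring A)"
    by (rule comm_monoidI) (auto simp: class_ring_def mult_ac intro: cl)
qed (auto simp: class_ring_def distrib_right)

lemma a_inv_class_ring:
  assumes "subalg A" "a \<in> A" shows "\<ominus>\<^bsub>class_ring A\<^esub> a = - a"
proof -
  interpret cring "class_ring A" by (rule cring_class_ring[OF assms(1)])
  show ?thesis
    by (rule minus_equality) (use subalg_closed[OF assms(1)] assms(2) in \<open>auto simp: class_ring_def\<close>)
qed

lemma primeideal_class_ring_iff:
  assumes "subalg A"
  shows "primeideal P (class_ring A) \<longleftrightarrow> prime_in A P"
proof
  interpret R: cring "class_ring A" by (rule cring_class_ring[OF assms])
  {
    assume "primeideal P (class_ring A)"
    then interpret P: primeideal P "class_ring A" .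
    have "1 \<notin> P"
      using P.one_imp_carrier P.I_notcarr by (auto simp: class_ring_def)
    then show "prime_in A P"
      using P.Icarr P.a_closed P.zero_closed P.I_l_closed P.I_prime
      unfolding prime_in_def by (auto simp: class_ring_def)
  }
  assume P: "prime_in A P"
  have "ideal P (class_ring A)"
  proof (rule idealI)
    show "ring (class_ring A)" by (rule R.ring_axioms)
    show "subgroup P (add_monoid (class_ring A))"
    proof
      fix x assume "x \<in> P"
      then have "x \<in> A" "const (- 1) * x \<in> P" using P subalg_closed(1)[OF assms] unfolding prime_in_def by blast+
      then show "inv\<^bsub>add_monoid (class_ring A)\<^esub> x \<in> P"
        using a_inv_class_ring[OF assms, of x] unfolding a_inv_def const_minus_1 by simp
    qed (use P in \<open>auto simp: prime_in_def class_ring_def\<close>)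
  next
    fix a x assume "a \<in> P" "x \<in> carrier (class_ring A)"
    then have "x * a \<in> P" using P unfolding prime_in_def class_ring_def by auto
    then show "x \<otimes>\<^bsub>class_ring A\<^esub> a \<in> P" "a \<otimes>\<^bsub>class_ring A\<^esub> x \<in> P"
      unfolding class_ring_def by (simp_all add: mult.commute[of a x])
  qed
  then show "primeideal P (class_ring A)"
    by (rule primeidealI[OF _ cring_class_ring[OF assms]])
      (use P subalg_closed[OF assms] in \<open>auto simp: prime_in_def class_ring_def\<close>)
qed

section \<open>Chains of primes and polynomial relations\<close>

lemma krull_dim_leI:
  assumes "\<And>Ps. Ps \<noteq> [] \<Longrightarrow> \<forall>P\<in>set Ps. primeideal P R \<Longrightarrow> sorted_wrt (\<subset>) Ps \<Longrightarrow> length Ps \<le> Suc n"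
  shows "krull_dim R \<le> enat n"
  unfolding krull_dim_def
proof (rule SUP_least)
  fix Ps assume "Ps \<in> {Ps. Ps \<noteq> [] \<and> (\<forall>P\<in>set Ps. primeideal P R) \<and> sorted_wrt (\<subset>) Ps}"
  then have "length Ps \<le> Suc n" using assms by blast
  then show "enat (length Ps - 1) \<le> enat n" by simp
qed

lemma krull_dim_geI:
  assumes "\<forall>P\<in>set Ps. primeideal P R" "sorted_wrt (\<subset>) Ps" "Suc n \<le> length Ps"
  shows "enat n \<le> krull_dim R"
proof -
  have "enat n \<le> enat (length Ps - 1)" using assms by simp
  also have "\<dots> \<le> krull_dim R"
    unfolding krull_dim_def using assms by (intro SUP_upper) auto
  finally show ?thesis .
qed

definition monl :: "'a::comm_monoid_mult list \<Rightarrow> nat list \<Rightarrow> 'a"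
  where "monl xs \<alpha> = prod_list (map2 (\<lambda>x k. x ^ k) xs \<alpha>)"

lemma monl_Cons: "monl (x # xs) (k # \<alpha>) = x ^ k * monl xs \<alpha>"
  unfolding monl_def by simp

lemma monl_in_subalg: "subalg A \<Longrightarrow> set xs \<subseteq> A \<Longrightarrow> monl xs \<alpha> \<in> A"
proof (induction xs arbitrary: \<alpha>)
  case (Cons x xs)
  then show ?case
    by (cases \<alpha>) (auto simp: monl_Cons, auto simp: monl_def intro: subalg_closed subalg_power)
qed (auto simp: monl_def intro: subalg_closed)

lemma prime_in_power: "prime_in A P \<Longrightarrow> subalg A \<Longrightarrow> x \<in> A \<Longrightarrow> x ^ k \<in> P \<Longrightarrow> x \<in> P"
proof (induction k)
  case 0
  then show ?case by (simp add: prime_in_def)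
next
  case (Suc k)
  then have "x \<in> P \<or> x ^ k \<in> P"
    using subalg_power[of A x k] unfolding prime_in_def by (metis power_Suc)
  then show ?case using Suc by blast
qed

text \<open>Algebraic independence modulo \<open>P\<close>. A nonzero polynomial is given by its
  support \<open>F\<close>, a nonempty set of exponent lists, and coefficients that do not vanish
  there.\<close>

definition no_relation :: "('v, 'k::field) mpoly list \<Rightarrow> ('v, 'k) mpoly set \<Rightarrow> bool"
  where "no_relation xs P \<longleftrightarrow> (\<forall>F c. finite F \<and> F \<noteq> {} \<and> (\<forall>\<alpha>\<in>F. length \<alpha> = length xs \<and> c \<alpha> \<noteq> 0) \<longrightarrow>
       (\<Sum>\<alpha>\<in>F. const (c \<alpha>) * monl xs \<alpha>) \<notin> P)"

lemma no_relationI: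
  assumes "\<And>F c. finite F \<Longrightarrow> F \<noteq> {} \<Longrightarrow> \<forall>\<alpha>\<in>F. length \<alpha> = length xs \<and> c \<alpha> \<noteq> 0 \<Longrightarrow>
       (\<Sum>\<alpha>\<in>F. const (c \<alpha>) * monl xs \<alpha>) \<notin> P"
  shows "no_relation xs P"
  unfolding no_relation_def using assms by blast

lemma no_relationD:
  assumes "no_relation xs P" "finite F" "F \<noteq> {}" "\<forall>\<alpha>\<in>F. length \<alpha> = length xs \<and> c \<alpha> \<noteq> 0"
  shows "(\<Sum>\<alpha>\<in>F. const (c \<alpha>) * monl xs \<alpha>) \<notin> P"
  using assms unfolding no_relation_def by blast

text \<open>Elements picked from the steps of a chain of primes satisfy no polynomial relation, not even
  modulo the smallest prime: divide by the largest power of the first element and move on to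
  the next prime.  This is the argument of Coquand and Lombardi.\<close>

lemma chain_no_relation:
  fixes P :: "('v, 'k::field) mpoly set"
  assumes "subalg A" "sorted_wrt (\<subset>) (P # Ps)" "\<forall>Q\<in>set (P # Ps). prime_in A Q"
  shows "\<exists>xs. length xs = length Ps \<and> set xs \<subseteq> A \<and> no_relation xs P"
  using assms(2,3)
proof (induction Ps arbitrary: P)
  case Nil
  have P: "prime_in A P" using Nil by simp
  have "(\<Sum>\<alpha>\<in>F. const (c \<alpha>) * monl [] \<alpha>) \<notin> P"
    if "finite F" "F \<noteq> {}" "\<forall>\<alpha>\<in>F. length \<alpha> = 0 \<and> c \<alpha> \<noteq> 0" for F :: "nat list set" and c :: "nat list \<Rightarrow> 'k"
  proof
    assume *: "(\<Sum>\<alpha>\<in>F. const (c \<alpha>) * monl [] \<alpha>) \<in> P"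
    have "F = {[]}" using that by auto
    then have "const (c []) \<in> P" "c [] \<noteq> 0" using * that by (simp_all add: monl_def)
    then have "const (1 / c []) * const (c []) \<in> P"
      using P subalg_closed(1)[OF assms(1)] unfolding prime_in_def by blast
    then show False using P \<open>c [] \<noteq> 0\<close> by (simp add: const_mult prime_in_def)
  qed
  then have "no_relation [] P" by (intro no_relationI) auto
  then show ?case by (intro exI[of _ "[]"]) simp
next
  case (Cons Q Ps)
  have P: "prime_in A P" and Q: "prime_in A Q" and PQ: "P \<subset> Q" using Cons.prems by auto
  obtain xs where xs: "length xs = length Ps" "set xs \<subseteq> A"
    and IH: "no_relation xs Q"
    using Cons.IH[of Q] Cons.prems by auto
  obtain x where x: "x \<in> Q" "x \<notin> P" using PQ by blast
  have xA: "x \<in> A" using x Q unfolding prime_in_def by blast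
  note cl = subalg_closed[OF assms(1)]
  have "(\<Sum>\<alpha>\<in>F. const (c \<alpha>) * monl (x # xs) \<alpha>) \<notin> P"
    if F: "finite F" "F \<noteq> {}" "\<forall>\<alpha>\<in>F. length \<alpha> = length (x # xs) \<and> c \<alpha> \<noteq> 0"
    for F :: "nat list set" and c :: "nat list \<Rightarrow> 'k"
  proof
    assume *: "(\<Sum>\<alpha>\<in>F. const (c \<alpha>) * monl (x # xs) \<alpha>) \<in> P"
    \<comment> \<open>The largest power of \<open>x\<close> common to all terms. Dividing by it
      leaves \<open>s0 + x * s1\<close>, where \<open>s0\<close> collects the terms whose exponent
      of \<open>x\<close> is exactly \<open>k\<close>.\<close>
    define k where "k = Min (hd ` F)"
    have kF: "k \<in> hd ` F" unfolding k_def using F by (intro Min_in) auto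
    have k_le: "k \<le> hd \<alpha>" if "\<alpha> \<in> F" for \<alpha> unfolding k_def using F that by (intro Min_le) auto
    have split: "\<alpha> = hd \<alpha> # tl \<alpha>" "length (tl \<alpha>) = length xs" if "\<alpha> \<in> F" for \<alpha>
      using F(3) that by (cases \<alpha>; fastforce)+
    define F0 where "F0 = {\<alpha> \<in> F. hd \<alpha> = k}"
    define s0 where "s0 = (\<Sum>\<beta>\<in>tl ` F0. const (c (k # \<beta>)) * monl xs \<beta>)"
    define s1 where "s1 = (\<Sum>\<alpha>\<in>F - F0. const (c \<alpha>) * x ^ (hd \<alpha> - Suc k) * monl xs (tl \<alpha>))"
    have F0: "k # tl \<alpha> = \<alpha>" if "\<alpha> \<in> F0" for \<alpha> using split(1) that unfolding F0_def by force
    have inj: "inj_on tl F0" by (rule inj_onI) (metis F0)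
    have s1A: "s1 \<in> A"
      unfolding s1_def by (intro subalg_sum assms(1) cl subalg_power xA monl_in_subalg xs)
    have "(\<Sum>\<alpha>\<in>F. const (c \<alpha>) * monl (x # xs) \<alpha>)
      = (\<Sum>\<alpha>\<in>F0. const (c \<alpha>) * monl (x # xs) \<alpha>) + (\<Sum>\<alpha>\<in>F - F0. const (c \<alpha>) * monl (x # xs) \<alpha>)"
      using F(1) by (subst sum.subset_diff[of F0 F]) (auto simp: F0_def)
    also have "(\<Sum>\<alpha>\<in>F0. const (c \<alpha>) * monl (x # xs) \<alpha>) = x ^ k * s0"
    proof -
      have "const (c \<alpha>) * monl (x # xs) \<alpha> = x ^ k * (const (c (k # tl \<alpha>)) * monl xs (tl \<alpha>))" if "\<alpha> \<in> F0" for \<alpha>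
        using monl_Cons[of x xs k "tl \<alpha>"] F0[OF that] by (simp add: mult.left_commute)
      then show ?thesis
        unfolding s0_def sum_distrib_left by (simp add: sum.reindex[OF inj])
    qed
    also have "(\<Sum>\<alpha>\<in>F - F0. const (c \<alpha>) * monl (x # xs) \<alpha>) = x ^ k * (x * s1)"
      unfolding s1_def sum_distrib_left
    proof (rule sum.cong[OF refl])
      fix \<alpha> assume a: "\<alpha> \<in> F - F0"
      then have "k < hd \<alpha>" using k_le[of \<alpha>] unfolding F0_def by auto
      then have "x ^ hd \<alpha> = x ^ k * (x * x ^ (hd \<alpha> - Suc k))"
        by (simp only: power_Suc[symmetric] power_add[symmetric]) simp
      then have "monl (x # xs) \<alpha> = x ^ k * (x * x ^ (hd \<alpha> - Suc k)) * monl xs (tl \<alpha>)"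
        using split(1)[of \<alpha>] a monl_Cons[of x xs "hd \<alpha>" "tl \<alpha>"] by (metis DiffD1)
      then show "const (c \<alpha>) * monl (x # xs) \<alpha>
          = x ^ k * (x * (const (c \<alpha>) * x ^ (hd \<alpha> - Suc k) * monl xs (tl \<alpha>)))"
        by (simp only: mult_ac)
    qed
    finally have "x ^ k * (s0 + x * s1) \<in> P" using * by (simp add: distrib_left)
    moreover have s0A: "s0 \<in> A" unfolding s0_def by (intro subalg_sum assms(1) cl monl_in_subalg xs)
    moreover have "x ^ k \<notin> P" using prime_in_power[OF P assms(1) xA] x by blast
    ultimately have "s0 + x * s1 \<in> P"
      using P cl(4)[OF s0A cl(5)[OF xA s1A]] subalg_power[OF assms(1) xA] unfolding prime_in_def by blast
    then have 1: "s0 + x * s1 \<in> Q" using PQ by blast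
    have "- s1 * x \<in> Q" using Q x(1) cl(6)[OF s1A] unfolding prime_in_def by blast
    then have "(s0 + x * s1) + (- s1 * x) \<in> Q" using Q 1 unfolding prime_in_def by blast
    moreover have "(s0 + x * s1) + (- s1 * x) = s0" by (simp add: mult.commute)
    ultimately have "s0 \<in> Q" by simp
    moreover have "s0 \<notin> Q"
      unfolding s0_def
    proof (rule no_relationD[OF IH])
      show "finite (tl ` F0)" using F(1) unfolding F0_def by simp
      show "tl ` F0 \<noteq> {}" using kF unfolding F0_def by auto
      show "\<forall>\<beta>\<in>tl ` F0. length \<beta> = length xs \<and> c (k # \<beta>) \<noteq> 0"
      proof
        fix \<beta> assume "\<beta> \<in> tl ` F0"
        then obtain \<alpha> where a: "\<alpha> \<in> F0" "\<beta> = tl \<alpha>" by blast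
        then show "length \<beta> = length xs \<and> c (k # \<beta>) \<noteq> 0"
          using split(2)[of \<alpha>] F(3) F0[OF a(1)] unfolding F0_def by auto
      qed
    qed
    ultimately show False by blast
  qed
  then have "no_relation (x # xs) P" by (rule no_relationI)
  then show ?case using xs xA by (intro exI[of _ "x # xs"]) simp
qed

section \<open>Algebraic dependence by counting monomials\<close>

definition bdd :: "'v set \<Rightarrow> nat \<Rightarrow> ('v, 'k::field) mpoly \<Rightarrow> bool"
  where "bdd V d p \<longleftrightarrow> (\<forall>a\<in>keys p. a \<in> mon V \<and> (\<forall>v. lookup a v \<le> d))"

lemma bdd_mult:
  assumes "bdd V d p" "bdd V e q" shows "bdd V (d + e) (p * q)"
  unfolding bdd_def
proof
  fix a assume "a \<in> keys (p * q)"
  then obtain b c where "a = b + c" "b \<in> keys p" "c \<in> keys q" using keys_mult by blast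
  then show "a \<in> mon V \<and> (\<forall>v. lookup a v \<le> d + e)"
    using assms unfolding bdd_def by (auto simp: mon_add_iff lookup_add intro!: add_mono)
qed

lemma bdd_1: "bdd V 0 1"
  unfolding bdd_def by simp

lemma bdd_mono: "bdd V d p \<Longrightarrow> d \<le> e \<Longrightarrow> bdd V e p"
  unfolding bdd_def using order_trans by blast

lemma bdd_power: "bdd V d p \<Longrightarrow> bdd V (k * d) (p ^ k)"
  by (induction k) (auto simp: bdd_1 intro: bdd_mult)

lemma bdd_monl:
  assumes "\<forall>x\<in>set xs. bdd V d x" "set \<alpha> \<subseteq> {..N}"
  shows "bdd V (length xs * (N * d)) (monl xs \<alpha>)"
  using assms
proof (induction xs arbitrary: \<alpha>)
  case (Cons x xs)
  show ?case
  proof (cases \<alpha>)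
    case Nil
    then show ?thesis using bdd_mono[OF bdd_1] by (simp add: monl_def)
  next
    case (Cons k \<beta>)
    have "bdd V (k * d + length xs * (N * d)) (x ^ k * monl xs \<beta>)"
      using Cons.IH[of \<beta>] Cons.prems Cons by (intro bdd_mult bdd_power) auto
    moreover have "k * d + length xs * (N * d) \<le> length (x # xs) * (N * d)"
      using Cons.prems Cons by (simp add: mult_le_mono1)
    ultimately show ?thesis using bdd_mono unfolding Cons monl_Cons by blast
  qed
qed (simp add: monl_def bdd_1)

text \<open>Counting: there are more monomials in the \<open>card V + 1\<close> given polynomials than monomials in
  the variables they involve.\<close>

lemma algebraic_dependence:
  fixes xs :: "('v, 'k::field) mpoly list"
  assumes "finite V" "length xs = Suc (card V)" "\<forall>x\<in>set xs. keys x \<subseteq> mon V"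
  shows "\<exists>F c. finite F \<and> F \<noteq> {} \<and> (\<forall>\<alpha>\<in>F. length \<alpha> = length xs \<and> c \<alpha> \<noteq> (0::'k)) \<and>
    (\<Sum>\<alpha>\<in>F. const (c \<alpha>) * monl xs \<alpha>) = 0"
proof -
  define d where "d = (\<Sum>x\<in>set xs. \<Sum>a\<in>keys x. deg_on V a)"
  have bdd: "bdd V d x" if x: "x \<in> set xs" for x
    unfolding bdd_def
  proof (intro ballI conjI allI)
    fix a v assume a: "a \<in> keys x"
    show aV: "a \<in> mon V" using assms(3) x a by blast
    have "lookup a v \<le> deg_on V a"
    proof (cases "v \<in> V")
      case True
      then show ?thesis unfolding deg_on_def using assms(1) by (intro member_le_sum) auto
    next
      case False
      then have "v \<notin> keys a" using aV unfolding mon_def by blast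
      then show ?thesis by (simp add: in_keys_iff)
    qed
    also have "\<dots> \<le> (\<Sum>a\<in>keys x. deg_on V a)" using a by (intro member_le_sum) auto
    also have "\<dots> \<le> d" unfolding d_def using x by (intro member_le_sum[of x]) auto
    finally show "lookup a v \<le> d" .
  qed
  define n where "n = card V"
  define D where "D = length xs"
  \<comment> \<open>There are (N + 1)^(n + 1) exponent lists with entries up to \<open>N\<close>,
    while the products involve at most (D N d + 1)^n \<le> ((N + 1) (D d + 1))^n = (N + 1)^n N
    monomials. This choice of \<open>N\<close> makes the second number smaller.\<close>
  define N where "N = (D * d + 1) ^ n"
  define L where "L = {\<alpha>. set \<alpha> \<subseteq> {..N} \<and> length \<alpha> = D}"
  have finL: "finite L" and cardL: "card L = (N + 1) ^ Suc n"
    unfolding L_def using card_lists_length_eq[of "{..N}" D] finite_lists_length_eq[of "{..N}" D] assms(2)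
    by (auto simp: D_def n_def)
  \<comment> \<open>A coincidence between two products is already a relation; otherwise the products
    are distinct and too many to be linearly independent.\<close>
  have "\<exists>F c. finite F \<and> F \<noteq> {} \<and> F \<subseteq> L \<and> (\<forall>\<alpha>\<in>F. c \<alpha> \<noteq> (0::'k)) \<and> (\<Sum>\<alpha>\<in>F. const (c \<alpha>) * monl xs \<alpha>) = 0"
  proof (cases "inj_on (monl xs) L")
    case False
    then obtain \<alpha> \<beta> where ab: "\<alpha> \<in> L" "\<beta> \<in> L" "\<alpha> \<noteq> \<beta>" "monl xs \<alpha> = monl xs \<beta>" unfolding inj_on_def by blast
    define c where "c = (\<lambda>\<gamma>. if \<gamma> = \<alpha> then 1 else (-1 :: 'k))"
    have "(\<Sum>\<gamma>\<in>{\<alpha>, \<beta>}. const (c \<gamma>) * monl xs \<gamma>) = 0"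
      using ab(3,4) unfolding c_def by (simp add: const_minus_1)
    then show ?thesis using ab by (intro exI[of _ "{\<alpha>, \<beta>}"] exI[of _ c]) (auto simp: c_def)
  next
    case True
    define B where "B = {b \<in> mon V. \<forall>x\<in>V. lookup b x < Suc (D * (N * d))}"
    define U where "U = (\<lambda>a. single a (1::'k)) ` B"
    have finB: "finite B" and cardB: "card B = (Suc (D * (N * d))) ^ n"
      unfolding B_def n_def using card_bounded_monomials[OF assms(1)] by auto
    have sub: "monl xs ` L \<subseteq> mpoly.span U"
      unfolding U_def span_monomials
    proof (rule image_subsetI)
      fix \<alpha> assume "\<alpha> \<in> L"
      then have "bdd V (D * (N * d)) (monl xs \<alpha>)"
        unfolding L_def D_def using bdd by (intro bdd_monl) auto
      then show "monl xs \<alpha> \<in> {p. keys p \<subseteq> B}" unfolding bdd_def B_def by (auto simp: less_Suc_eq_le)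
    qed
    have "card U \<le> card B" unfolding U_def using finB by (rule card_image_le)
    also have "\<dots> < card L"
    proof -
      have "Suc (D * (N * d)) \<le> (N + 1) * (D * d + 1)" by (simp add: algebra_simps)
      then have "card B \<le> ((N + 1) * (D * d + 1)) ^ n" unfolding cardB by (rule power_mono) simp
      also have "\<dots> = (N + 1) ^ n * N" unfolding power_mult_distrib N_def ..
      also have "\<dots> < (N + 1) ^ Suc n" by simp
      finally show ?thesis unfolding cardL .
    qed
    also have "card L = card (monl xs ` L)" using True by (simp add: card_image)
    finally have "card U < card (monl xs ` L)" .
    moreover have "finite U" unfolding U_def using finB by simp
    ultimately have "mpoly.dependent (monl xs ` L)"
      using mpoly.independent_span_bound[of U "monl xs ` L"] sub by auto
    then obtain t u v where t: "finite t" "t \<subseteq> monl xs ` L" "(\<Sum>v\<in>t. const (u v) * v) = 0" "v \<in> t" "u v \<noteq> 0"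
      unfolding mpoly.dependent_explicit by blast
    define F where "F = {\<alpha> \<in> L. monl xs \<alpha> \<in> t \<and> u (monl xs \<alpha>) \<noteq> 0}"
    have "monl xs ` F = {v \<in> t. u v \<noteq> 0}" unfolding F_def using t(2) by auto
    then have "(\<Sum>\<alpha>\<in>F. const (u (monl xs \<alpha>)) * monl xs \<alpha>) = (\<Sum>v\<in>{v \<in> t. u v \<noteq> 0}. const (u v) * v)"
      using sum.reindex[OF inj_on_subset[OF True], of F "\<lambda>v. const (u v) * v"] unfolding F_def by simp
    also have "\<dots> = (\<Sum>v\<in>t. const (u v) * v)"
      using t(1) by (intro sum.mono_neutral_left) auto
    finally have "(\<Sum>\<alpha>\<in>F. const (u (monl xs \<alpha>)) * monl xs \<alpha>) = 0" using t(3) by simp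
    moreover have "F \<noteq> {}" unfolding F_def using t by auto
    moreover have "finite F" "F \<subseteq> L" "\<forall>\<alpha>\<in>F. u (monl xs \<alpha>) \<noteq> 0" unfolding F_def using finL by auto
    ultimately show ?thesis
      by (intro exI[of _ F] exI[of _ "\<lambda>\<alpha>. u (monl xs \<alpha>)"] conjI)
  qed
  then obtain F c where F: "finite F" "F \<noteq> {}" "F \<subseteq> L" "\<forall>\<alpha>\<in>F. c \<alpha> \<noteq> (0::'k)"
    "(\<Sum>\<alpha>\<in>F. const (c \<alpha>) * monl xs \<alpha>) = 0" by (elim exE conjE)
  moreover have "\<forall>\<alpha>\<in>F. length \<alpha> = length xs \<and> c \<alpha> \<noteq> 0" using F(3,4) unfolding L_def D_def by blast
  ultimately show ?thesis by (intro exI[of _ F] exI[of _ c] conjI)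
qed

text \<open>A chain of \<open>card V + 2\<close> primes would provide \<open>card V + 1\<close>
  elements without a relation modulo the smallest prime, against algebraic dependence. The chain is
  cut to exactly this length.\<close>

lemma prime_chain_length:
  fixes A :: "('v, 'k::field) mpoly set"
  assumes "finite V" "subalg A" "A \<subseteq> {p. keys p \<subseteq> mon V}"
    and chain: "\<forall>P\<in>set Ps. prime_in A P" "sorted_wrt (\<subset>) Ps"
  shows "length Ps \<le> Suc (card V)"
proof (rule ccontr)
  assume "\<not> ?thesis"
  then have len: "length (take (card V + 2) Ps) = card V + 2" by simp
  then obtain P Qs where PQ: "take (card V + 2) Ps = P # Qs" by (cases "take (card V + 2) Ps") auto
  have "sorted_wrt (\<subset>) (P # Qs)" "\<forall>Q\<in>set (P # Qs). prime_in A Q"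
    unfolding PQ[symmetric] using chain by (auto intro: sorted_wrt_take dest: in_set_takeD)
  from chain_no_relation[OF assms(2) this] obtain xs where xs: "length xs = length Qs" "set xs \<subseteq> A"
    and no: "no_relation xs P" by blast
  have "length xs = Suc (card V)" using xs(1) len unfolding PQ by simp
  then obtain F and c :: "nat list \<Rightarrow> 'k" where "finite F" "F \<noteq> {}" "\<forall>\<alpha>\<in>F. length \<alpha> = length xs \<and> c \<alpha> \<noteq> 0"
    "(\<Sum>\<alpha>\<in>F. const (c \<alpha>) * monl xs \<alpha>) = 0"
  proof -
    have "\<forall>x\<in>set xs. keys x \<subseteq> mon V" using xs(2) assms(3) by blast
    from algebraic_dependence[OF assms(1) \<open>length xs = Suc (card V)\<close> this]
    show thesis by (elim exE conjE) (rule that)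
  qed
  moreover have "0 \<in> P" using \<open>\<forall>Q\<in>set (P # Qs). prime_in A Q\<close> by (simp add: prime_in_def)
  ultimately show False using no_relationD[OF no, of F c] by simp
qed

section \<open>Faces of affine monoids\<close>

text \<open>Exponent vectors are viewed as real functions on the nodes, where spans, dimensions and
  linear functionals are at hand for an arbitrary node type.\<close>

interpretation real_fun: vector_space "\<lambda>(c::real) (f :: 'v \<Rightarrow> real) x. c * f x"
  by unfold_locales (auto simp: fun_eq_iff algebra_simps)

interpretation real_functional: vector_space_pair "\<lambda>(c::real) (f :: 'v \<Rightarrow> real) x. c * f x" "(*) :: real \<Rightarrow> real \<Rightarrow> real"
  by unfold_locales (auto simp: algebra_simps)

abbreviation functional :: "(('v \<Rightarrow> real) \<Rightarrow> real) \<Rightarrow> bool"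
  where "functional \<equiv> Vector_Spaces.linear (\<lambda>(c::real) f x. c * f x) (*)"

text \<open>A basis of the span of \<open>B\<close> stays independent when \<open>a\<close> is
  added, so values can be prescribed on it freely.\<close>

lemma separating_functional:
  fixes B :: "('v \<Rightarrow> real) set"
  assumes "a \<notin> real_fun.span B"
  obtains w where "functional w" "\<And>b. b \<in> B \<Longrightarrow> w b = 0" "w a = 1"
proof -
  obtain C where C: "C \<subseteq> B" "real_fun.independent C" "B \<subseteq> real_fun.span C"
    using real_fun.maximal_independent_subset by blast
  have "real_fun.span C = real_fun.span B"
    using C by (metis real_fun.span_mono real_fun.span_span subset_antisym)
  then have aC: "a \<notin> real_fun.span C" using assms by simp
  then have "real_fun.independent (insert a C)" using C(2) by (rule real_fun.independent_insertI)
  then obtain w where w: "functional w" "\<forall>x\<in>insert a C. w x = (if x = a then 1 else 0)"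
    using real_functional.linear_independent_extend[of "insert a C" "\<lambda>x. if x = a then 1 else 0"] by blast
  have "a \<notin> C" using aC real_fun.span_base by blast
  then have C0: "w x = 0" if "x \<in> C" for x using w(2) that by auto
  have "w b = 0" if "b \<in> B" for b
    using real_functional.linear_eq_0_on_span[OF w(1), of C b] C0 C(3) that by blast
  then show thesis using that w by simp
qed

text \<open>A supporting functional with as many zeros as possible cuts out a facet: otherwise it could be
  tilted until one more generator becomes a zero.\<close>

lemma exists_facet:
  fixes A :: "('v \<Rightarrow> real) set"
  assumes A: "finite A" "A \<noteq> {}" and w0: "functional w0" "\<And>a. a \<in> A \<Longrightarrow> w0 a > 0"
  obtains w where "functional w" "\<And>a. a \<in> A \<Longrightarrow> w a \<ge> 0" "\<exists>a\<in>A. w a > 0"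
    "real_fun.dim A \<le> Suc (real_fun.dim {a \<in> A. w a = 0})"
proof -
  define Q where "Q w \<longleftrightarrow> functional w \<and> (\<forall>a\<in>A. w a \<ge> 0) \<and> (\<exists>a\<in>A. w a > 0)" for w
  define z where "z w = card {a \<in> A. w a = 0}" for w :: "('v \<Rightarrow> real) \<Rightarrow> real"
  have "Q w0" unfolding Q_def using w0 A by (auto intro: less_imp_le)
  moreover have "z w \<le> card A" for w unfolding z_def using A by (intro card_mono) auto
  ultimately obtain w where w: "Q w" and max: "\<And>w'. Q w' \<Longrightarrow> z w' \<le> z w"
    using ex_has_greatest_nat[of Q w0 z "Suc (card A)"] by (auto simp: less_Suc_eq_le)
  define Z where "Z = {a \<in> A. w a = 0}"
  obtain a0 where a0: "a0 \<in> A" "w a0 > 0" using w unfolding Q_def by blast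
  have "real_fun.dim A \<le> Suc (real_fun.dim Z)"
  proof (rule ccontr)
    assume neg: "\<not> real_fun.dim A \<le> Suc (real_fun.dim Z)"
    obtain C where C: "C \<subseteq> Z" "Z \<subseteq> real_fun.span C" "card C = real_fun.dim Z"
      using real_fun.basis_exists by metis
    obtain C' where C': "C' \<subseteq> A" "real_fun.independent C'" "card C' = real_fun.dim A"
      using real_fun.basis_exists by metis
    have finC: "finite C" using C(1) A(1) unfolding Z_def by (auto intro: finite_subset)
    \<comment> \<open>A gap of at least two dimensions leaves a generator outside the span of the
      zeros and \<open>a0\<close>. A functional that vanishes on these and not on that generator
      gives the direction of tilting.\<close>
    have "\<not> A \<subseteq> real_fun.span (insert a0 C)"
    proof
      assume "A \<subseteq> real_fun.span (insert a0 C)"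
      then have "card C' \<le> card (insert a0 C)"
        using real_fun.independent_span_bound[of "insert a0 C" C'] C' finC by auto
      also have "\<dots> \<le> Suc (real_fun.dim Z)" using C(3) finC by (simp add: card_insert_if)
      finally show False using neg C'(3) by simp
    qed
    then obtain a1 where a1: "a1 \<in> A" "a1 \<notin> real_fun.span (insert a0 C)" by blast
    obtain w' where w': "functional w'" "\<And>b. b \<in> insert a0 C \<Longrightarrow> w' b = 0" "w' a1 = 1"
      using separating_functional[OF a1(2)] by metis
    have w'Z: "w' b = 0" if "b \<in> Z" for b
      using real_functional.linear_eq_0_on_span[OF w'(1), of C b] w'(2) C(2) that by blast
    define L where "L = {a \<in> A. w' a > 0}"
    \<comment> \<open>The largest amount of tilting by \<open>w'\<close> that keeps all values
      nonnegative. The minimum is attained at some generator with \<open>w'\<close> positive, which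
      becomes a new zero; \<open>a0\<close> keeps its positive value.\<close>
    define l where "l = Min ((\<lambda>a. w a / w' a) ` L)"
    have "a1 \<in> L" unfolding L_def using a1 w'(3) by simp
    then have "l \<in> (\<lambda>a. w a / w' a) ` L" unfolding l_def L_def using A by (intro Min_in) auto
    then obtain as where as: "as \<in> L" "l = w as / w' as" by blast
    have l_le: "l \<le> w a / w' a" if "a \<in> L" for a
      unfolding l_def using that A by (intro Min_le) (auto simp: L_def)
    have w_ge: "w a \<ge> 0" if "a \<in> A" for a using w that unfolding Q_def by blast
    have "l \<ge> 0" using as w_ge unfolding L_def by auto
    define w'' where "w'' a = w a - l * w' a" for a
    have "functional w''"
      unfolding w''_def using w w'(1) unfolding Q_def
      by (intro real_functional.linear_compose_sub real_functional.linear_compose_scale_right) auto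
    moreover have "w'' a \<ge> 0" if "a \<in> A" for a
    proof (cases "w' a > 0")
      case True
      then show ?thesis using l_le[of a] that unfolding L_def w''_def by (simp add: field_simps)
    next
      case False
      then have "l * w' a \<le> 0" using \<open>l \<ge> 0\<close> by (simp add: mult_nonneg_nonpos)
      then show ?thesis using w_ge[OF that] unfolding w''_def by simp
    qed
    moreover have "w'' a0 > 0" unfolding w''_def using a0(2) w'(2)[of a0] by simp
    ultimately have "Q w''" unfolding Q_def using a0(1) by blast
    moreover have "z w < z w''"
      unfolding z_def
    proof (rule psubset_card_mono)
      show "finite {a \<in> A. w'' a = 0}" using A by simp
      have "w' as > 0" "as \<in> A" using as unfolding L_def by auto
      then have "w'' as = 0" unfolding w''_def as(2) by simp
      moreover have "as \<notin> Z" using w'Z \<open>w' as > 0\<close> by force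
      moreover have "Z \<subseteq> {a \<in> A. w'' a = 0}" using w'Z unfolding w''_def Z_def by auto
      ultimately show "{a \<in> A. w a = 0} \<subset> {a \<in> A. w'' a = 0}" using \<open>as \<in> A\<close> unfolding Z_def by blast
    qed
    ultimately show False using max[of w''] by simp
  qed
  then show thesis using that[of w] w unfolding Q_def Z_def by blast
qed

section \<open>Faces described on generators and the primes belonging to them\<close>

definition gen :: "'a::comm_monoid_add set \<Rightarrow> 'a set"
  where "gen A = {sum_mset X | X. set_mset X \<subseteq> A}"

text \<open>The usual condition that both summands of an element of the face lie in the face, tested
  on generators: a sum of generators lands in \<open>gen F\<close> only if all of them are in
  \<open>F\<close>.\<close>

definition face :: "'a::comm_monoid_add set \<Rightarrow> 'a set \<Rightarrow> bool"
  where "face A F \<longleftrightarrow> F \<subseteq> A \<and> (\<forall>X. set_mset X \<subseteq> A \<longrightarrow> sum_mset X \<in> gen F \<longrightarrow> set_mset X \<subseteq> F)"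

lemma genI: "set_mset X \<subseteq> A \<Longrightarrow> sum_mset X \<in> gen A"
  unfolding gen_def by blast

lemma gen_0: "0 \<in> gen A"
  using genI[of "{#}"] by simp

lemma gen_base: "a \<in> A \<Longrightarrow> a \<in> gen A"
  using genI[of "{#a#}"] by simp

lemma gen_add: "a \<in> gen A \<Longrightarrow> b \<in> gen A \<Longrightarrow> a + b \<in> gen A"
proof -
  assume "a \<in> gen A" "b \<in> gen A"
  then obtain X Y where "a = sum_mset X" "set_mset X \<subseteq> A" "b = sum_mset Y" "set_mset Y \<subseteq> A"
    unfolding gen_def by blast
  then show ?thesis using genI[of "X + Y" A] by simp
qed

lemma gen_mono: "A \<subseteq> B \<Longrightarrow> gen A \<subseteq> gen B"
  unfolding gen_def by blast

lemma face_refl: "face A A"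
  unfolding face_def by blast

lemma face_trans: "face A F \<Longrightarrow> face F F' \<Longrightarrow> face A F'"
  unfolding face_def using gen_mono[of F' F] by (meson subsetD subset_trans)

lemma face_memD: "face A F \<Longrightarrow> a \<in> A \<Longrightarrow> a \<in> gen F \<Longrightarrow> a \<in> F"
  unfolding face_def by (metis empty_subsetI insert_subset set_mset_single sum_mset.singleton)

lemma face_addD: "face A F \<Longrightarrow> a \<in> gen A \<Longrightarrow> b \<in> gen A \<Longrightarrow> a + b \<in> gen F \<Longrightarrow> a \<in> gen F"
proof -
  assume F: "face A F" and "a \<in> gen A" "b \<in> gen A" and ab: "a + b \<in> gen F"
  then obtain X Y where XY: "a = sum_mset X" "set_mset X \<subseteq> A" "b = sum_mset Y" "set_mset Y \<subseteq> A"
    unfolding gen_def by blast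
  then have "set_mset (X + Y) \<subseteq> F" using F ab unfolding face_def by (metis Un_least set_mset_union sum_mset.union)
  then show ?thesis using XY genI[of X F] by simp
qed

definition rvec :: "('v \<Rightarrow>\<^sub>0 nat) \<Rightarrow> 'v \<Rightarrow> real"
  where "rvec a = (\<lambda>x. real (lookup a x))"

lemma rvec_0: "rvec 0 = 0" and rvec_add: "rvec (a + b) = rvec a + rvec b"
  unfolding rvec_def by (auto simp: lookup_add fun_eq_iff)

lemma functional_rvec_sum:
  assumes "functional w"
  shows "w (rvec (sum_mset X)) = (\<Sum>a\<in>#X. w (rvec a))"
proof (induction X)
  case empty
  show ?case using real_functional.linear_0[OF assms] by (simp only: sum_mset.empty image_mset_empty rvec_0)
next
  case (add x X)
  have "w (rvec (sum_mset (add_mset x X))) = w (rvec x + rvec (sum_mset X))"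
    by (simp only: sum_mset.add_mset rvec_add)
  also have "\<dots> = w (rvec x) + w (rvec (sum_mset X))" by (rule real_functional.linear_add[OF assms])
  finally show ?case using add by simp
qed

lemma sum_mset_nonneg_eq_0:
  fixes g :: "'a \<Rightarrow> real"
  assumes "\<And>a. a \<in># X \<Longrightarrow> g a \<ge> 0"
  shows "(\<Sum>a\<in>#X. g a) \<ge> 0 \<and> ((\<Sum>a\<in>#X. g a) = 0 \<longrightarrow> (\<forall>a\<in>#X. g a = 0))"
  using assms
proof (induction X)
  case (add x X)
  then have "g x \<ge> 0" "(\<Sum>a\<in>#X. g a) \<ge> 0" "(\<Sum>a\<in>#X. g a) = 0 \<longrightarrow> (\<forall>a\<in>#X. g a = 0)" by auto
  then show ?case by auto
qed simp

text \<open>The functional vanishes on \<open>gen\<close> of its zero set. A sum of nonnegative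
  values is zero only if each of them is, so every summand is a zero.\<close>

lemma exposed_face:
  assumes "functional w" "\<And>a. a \<in> A \<Longrightarrow> w (rvec a) \<ge> 0"
  shows "face A {a \<in> A. w (rvec a) = 0}"
  unfolding face_def
proof (intro conjI allI impI)
  fix X assume X: "set_mset X \<subseteq> A" "sum_mset X \<in> gen {a \<in> A. w (rvec a) = 0}"
  then obtain Y where Y: "sum_mset X = sum_mset Y" "set_mset Y \<subseteq> {a \<in> A. w (rvec a) = 0}"
    unfolding gen_def by auto
  have "(\<Sum>a\<in>#Y. w (rvec a)) = (\<Sum>a\<in>#Y. 0)" using Y(2) by (intro arg_cong[of _ _ sum_mset] image_mset_cong) auto
  then have "(\<Sum>a\<in>#X. w (rvec a)) = 0"
    using functional_rvec_sum[OF assms(1), of X] functional_rvec_sum[OF assms(1), of Y] Y(1) by simp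
  then have "\<forall>a\<in>#X. w (rvec a) = 0" using sum_mset_nonneg_eq_0[of X "\<lambda>a. w (rvec a)"] X(1) assms(2) by blast
  then show "set_mset X \<subseteq> {a \<in> A. w (rvec a) = 0}" using X(1) by blast
qed blast

text \<open>Facets are cut off repeatedly down to the empty face; each cut lowers the dimension by
  at most one. Positivity of \<open>w0\<close> is inherited by subsets, so a next facet always
  exists.\<close>

lemma face_chain:
  assumes "finite A" "functional w0" "\<And>a. a \<in> A \<Longrightarrow> w0 (rvec a) > 0"
  shows "\<exists>Fs. sorted_wrt (\<subset>) Fs \<and> (\<forall>F\<in>set Fs. face A F) \<and> Suc (real_fun.dim (rvec ` A)) \<le> length Fs"
  using assms(1,3)
proof (induction A rule: finite_psubset_induct)
  case (psubset A)
  show ?case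
  proof (cases "A = {}")
    case True
    have "real_fun.dim (rvec ` A) = 0"
      using real_fun.dim_eq_card_independent[OF real_fun.independent_empty] unfolding True by simp
    then show ?thesis using True face_refl[of "{} :: ('v \<Rightarrow>\<^sub>0 nat) set"] by (intro exI[of _ "[{}]"]) simp
  next
    case False
    have pos: "w0 a > 0" if "a \<in> rvec ` A" for a using psubset.prems that by auto
    obtain w where w: "functional w" "\<And>a. a \<in> rvec ` A \<Longrightarrow> w a \<ge> 0" "\<exists>a\<in>rvec ` A. w a > 0"
      "real_fun.dim (rvec ` A) \<le> Suc (real_fun.dim {a \<in> rvec ` A. w a = 0})"
    proof -
      have "finite (rvec ` A)" "rvec ` A \<noteq> {}" using psubset.hyps(1) False by auto
      from exists_facet[OF this assms(2) pos] show thesis using that by blast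
    qed
    define F where "F = {a \<in> A. w (rvec a) = 0}"
    have face: "face A F" unfolding F_def using w(1,2) by (intro exposed_face) auto
    have "F \<subset> A"
    proof -
      obtain a where "a \<in> A" "w (rvec a) > 0" using w(3) by blast
      then have "a \<in> A - F" unfolding F_def by simp
      then show ?thesis unfolding F_def by blast
    qed
    from psubset.IH[OF this] psubset.prems obtain Fs where Fs: "sorted_wrt (\<subset>) Fs" "\<forall>F'\<in>set Fs. face F F'"
      "Suc (real_fun.dim (rvec ` F)) \<le> length Fs" using \<open>F \<subset> A\<close> by blast
    have "rvec ` F = {a \<in> rvec ` A. w a = 0}" unfolding F_def by auto
    then have "Suc (real_fun.dim (rvec ` A)) \<le> length (Fs @ [A])" using w(4) Fs(3) by simp
    moreover have "\<forall>F'\<in>set (Fs @ [A]). face A F'" using Fs(2) face face_trans face_refl by auto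
    moreover have "sorted_wrt (\<subset>) (Fs @ [A])"
      using Fs(1,2) \<open>F \<subset> A\<close> unfolding sorted_wrt_append face_def by auto
    ultimately show ?thesis by blast
  qed
qed

text \<open>The face condition makes the complement of \<open>gen F\<close> stable under adding
  elements of \<open>gen A\<close>, and \<open>gen F\<close> is closed under addition; this is an
  ideal and its primality on the level of exponents.\<close>

lemma face_prime:
  fixes A :: "('v \<Rightarrow>\<^sub>0 nat) set"
  assumes F: "face A F"
  shows "prime_in {p :: ('v, 'k::field) mpoly. keys p \<subseteq> gen A} {p. keys p \<subseteq> gen A - gen F}"
  unfolding prime_in_def
proof (intro conjI ballI impI)
  have ideal: "a + b \<in> gen A - gen F" if "a \<in> gen A - gen F" "b \<in> gen A" for a b
    using that gen_add[of a A b] face_addD[OF F, of a b] by blast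
  show "a * b \<in> {p. keys p \<subseteq> gen A - gen F}"
    if "a \<in> {p. keys p \<subseteq> gen A}" "b \<in> {p. keys p \<subseteq> gen A - gen F}" for a b :: "('v, 'k) mpoly"
  proof -
    have "keys (a * b) \<subseteq> gen A - gen F"
    proof (rule keys_mult_subset)
      fix c d assume "c \<in> keys a" "d \<in> keys b"
      then have "d + c \<in> gen A - gen F" using that by (intro ideal) auto
      then show "c + d \<in> gen A - gen F" by (simp only: add.commute)
    qed
    then show ?thesis by blast
  qed
  show "a \<in> {p. keys p \<subseteq> gen A - gen F} \<or> b \<in> {p. keys p \<subseteq> gen A - gen F}"
    if "a \<in> {p. keys p \<subseteq> gen A}" "b \<in> {p. keys p \<subseteq> gen A}" "a * b \<in> {p. keys p \<subseteq> gen A - gen F}"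
    for a b :: "('v, 'k) mpoly"
    using support_in_prime_complement[of a "gen A" b "gen A - gen F"] that ideal gen_add[of _ F] by auto
  show "a + b \<in> {p. keys p \<subseteq> gen A - gen F}"
    if "a \<in> {p. keys p \<subseteq> gen A - gen F}" "b \<in> {p. keys p \<subseteq> gen A - gen F}" for a b :: "('v, 'k) mpoly"
    using that keys_add_subset by blast
qed (use gen_0 in auto)

lemma face_ideal_strict:
  assumes "face A F" "face A F'" "F \<subset> F'"
  shows "{p :: ('v, 'k::field) mpoly. keys p \<subseteq> gen A - gen F'} \<subset> {p. keys p \<subseteq> gen A - gen F}"
proof
  show "{p :: ('v, 'k::field) mpoly. keys p \<subseteq> gen A - gen F'} \<subseteq> {p. keys p \<subseteq> gen A - gen F}"
    using gen_mono[of F F'] assms(3) by blast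
  obtain a where a: "a \<in> F'" "a \<notin> F" using assms(3) by blast
  have "a \<in> A" using a(1) assms(2) unfolding face_def by blast
  then have "a \<notin> gen F" "a \<in> gen A" "a \<in> gen F'" using face_memD[OF assms(1)] a gen_base by blast+
  then have "single a (1::'k) \<in> {p. keys p \<subseteq> gen A - gen F}" "single a (1::'k) \<notin> {p. keys p \<subseteq> gen A - gen F'}" by auto
  then show "{p :: ('v, 'k::field) mpoly. keys p \<subseteq> gen A - gen F'} \<noteq> {p. keys p \<subseteq> gen A - gen F}" by blast
qed

lemma subalg_gen: "subalg {p :: ('v, 'k::field) mpoly. keys p \<subseteq> gen A}"
  unfolding subalg_def
proof (intro conjI ballI)
  show "range const \<subseteq> {p :: ('v, 'k::field) mpoly. keys p \<subseteq> gen A}"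
    unfolding const_eq by (auto simp: gen_0 split: if_splits)
  fix p q :: "('v, 'k) mpoly" assume pq: "p \<in> {p. keys p \<subseteq> gen A}" "q \<in> {p. keys p \<subseteq> gen A}"
  then show "p + q \<in> {p. keys p \<subseteq> gen A}" using keys_add_subset[of p "gen A" q] by blast
  have "keys (p * q) \<subseteq> gen A"
    by (rule keys_mult_subset, rule gen_add) (use pq in auto)
  then show "p * q \<in> {p. keys p \<subseteq> gen A}" by blast
qed

text \<open>The upper bound holds because only \<open>card V\<close> variables are involved. For the
  lower bound, a chain of faces as long as the rank of the generators gives a chain of monomial
  primes, and the rank is full by assumption.\<close>

theorem krull_dim_monoid_algebra:
  assumes V: "finite V" and A: "finite A" "A \<subseteq> mon V" "0 \<notin> A"
    and full: "\<And>x. x \<in> V \<Longrightarrow> (\<lambda>y. if y = x then 1 else 0) \<in> real_fun.span (rvec ` A)"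
  shows "krull_dim (class_ring {p :: ('v, 'k::field) mpoly. keys p \<subseteq> gen A}) = enat (card V)"
proof (rule antisym)
  let ?A = "{p :: ('v, 'k::field) mpoly. keys p \<subseteq> gen A}"
  have "gen A \<subseteq> mon V"
  proof
    fix a assume "a \<in> gen A"
    then obtain X where "a = sum_mset X" "set_mset X \<subseteq> A" unfolding gen_def by blast
    then show "a \<in> mon V" using A(2) by (induction X arbitrary: a) (auto simp: mon_add_iff)
  qed
  then have sub: "?A \<subseteq> {p. keys p \<subseteq> mon V}" by blast
  show "krull_dim (class_ring ?A) \<le> enat (card V)"
  proof (rule krull_dim_leI)
    fix Ps assume Ps: "\<forall>P\<in>set Ps. primeideal P (class_ring ?A)" "sorted_wrt (\<subset>) Ps"
    show "length Ps \<le> Suc (card V)"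
      by (rule prime_chain_length[OF V subalg_gen sub])
        (use Ps primeideal_class_ring_iff[OF subalg_gen] in auto)
  qed
  \<comment> \<open>The total degree, positive on all generators because none of them is 0.\<close>
  define w0 where "w0 f = (\<Sum>x\<in>V. f x)" for f :: "'v \<Rightarrow> real"
  have "functional w0"
    unfolding Vector_Spaces.linear_iff w0_def
    using real_functional.vector_space_pair_axioms unfolding vector_space_pair_def
    by (simp add: sum.distrib sum_distrib_left)
  moreover have "w0 (rvec a) > 0" if "a \<in> A" for a
  proof -
    have "0 < deg_on V a" using deg_on_pos[OF V] A that by blast
    moreover have "w0 (rvec a) = real (deg_on V a)" unfolding w0_def rvec_def deg_on_def by simp
    ultimately show ?thesis by simp
  qed
  ultimately obtain Fs where Fs: "sorted_wrt (\<subset>) Fs" "\<forall>F\<in>set Fs. face A F"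
    "Suc (real_fun.dim (rvec ` A)) \<le> length Fs" using face_chain[OF A(1)] by metis
  define I where "I F = {p :: ('v, 'k) mpoly. keys p \<subseteq> gen A - gen F}" for F
  have "enat (real_fun.dim (rvec ` A)) \<le> krull_dim (class_ring ?A)"
  proof (rule krull_dim_geI)
    show "\<forall>P\<in>set (map I (rev Fs)). primeideal P (class_ring ?A)"
      unfolding primeideal_class_ring_iff[OF subalg_gen] I_def using Fs(2) by (auto intro: face_prime)
    \<comment> \<open>Passing from faces to primes reverses inclusions, hence the reversed
      list.\<close>
    have "sorted_wrt (\<lambda>F F'. F' \<subset> F) (rev Fs)" using Fs(1) by (simp add: sorted_wrt_rev)
    then have "sorted_wrt (\<lambda>F F'. I F \<subset> I F') (rev Fs)"
    proof (rule sorted_wrt_mono_rel[rotated])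
      fix F F' assume "F \<in> set (rev Fs)" "F' \<in> set (rev Fs)" "F' \<subset> F"
      then show "I F \<subset> I F'" unfolding I_def using Fs(2) by (intro face_ideal_strict) auto
    qed
    then show "sorted_wrt (\<subset>) (map I (rev Fs))" by (simp add: sorted_wrt_map)
    show "Suc (real_fun.dim (rvec ` A)) \<le> length (map I (rev Fs))" using Fs(3) by simp
  qed
  moreover have "card V \<le> real_fun.dim (rvec ` A)"
  proof -
    define e where "e x = (\<lambda>y. if y = x then 1 else 0 :: real)" for x :: 'v
    have inj: "inj_on e V" unfolding e_def by (rule inj_onI) (metis zero_neq_one)
    obtain C where C: "C \<subseteq> rvec ` A" "rvec ` A \<subseteq> real_fun.span C" "card C = real_fun.dim (rvec ` A)"
      using real_fun.basis_exists by metis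
    have finC: "finite C" using C(1) A(1) by (auto intro: finite_subset)
    have "real_fun.span (rvec ` A) \<subseteq> real_fun.span C" using C(2) by (rule real_fun.span_minimal) simp
    then have "e ` V \<subseteq> real_fun.span C" using full unfolding e_def by blast
    moreover have "real_fun.independent (e ` V)"
    proof
      assume "real_fun.dependent (e ` V)"
      then obtain t u v where t: "finite t" "t \<subseteq> e ` V" "(\<Sum>v\<in>t. (\<lambda>x. u v * v x)) = 0" "v \<in> t" "u v \<noteq> 0"
        unfolding real_fun.dependent_explicit by blast
      obtain x where x: "v = e x" using t by blast
      have "(\<Sum>v\<in>t. (\<lambda>x. u v * v x)) x = (\<Sum>v\<in>t. u v * v x)"
        using t(1) by (induction t rule: finite_induct) auto
      also have "\<dots> = (\<Sum>w\<in>t. if w = v then u v else 0)"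
      proof (rule sum.cong[OF refl])
        fix w assume "w \<in> t"
        then obtain y where y: "w = e y" using t(2) by blast
        show "u w * w x = (if w = v then u v else 0)"
          unfolding x y e_def by (auto simp: fun_eq_iff)
      qed
      also have "\<dots> = u v" using t by simp
      finally show False using t(3,5) by simp
    qed
    ultimately have "card (e ` V) \<le> card C" using real_fun.independent_span_bound[OF finC] by blast
    then show ?thesis using C(3) inj by (simp add: card_image)
  qed
  ultimately show "enat (card V) \<le> krull_dim (class_ring ?A)" by (meson enat_ord_simps(1) order_trans)
qed

section \<open>The edge subring\<close>

lemma edge_monomial_eq: "finite e \<Longrightarrow> edge_monomial e = single (ind e) 1"
proof (induction e rule: finite_induct)
  case (insert x e)
  then show ?case by (simp add: edge_monomial_def var_def ind_def mult_single)
qed (simp add: edge_monomial_def ind_def)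

lemma prod_mset_single: "prod_mset (image_mset (\<lambda>a. single a 1) X) = single (sum_mset X) 1"
  by (induction X) (simp_all add: mult_single)

lemma polynomial_ring_eq: "polynomial_ring TYPE('k::field) V = class_ring {p. keys p \<subseteq> mon V}"
  unfolding polynomial_ring_def class_ring_def mon_def by auto

lemma mon_eq_gen: "mon V = gen ((\<lambda>x. single x 1) ` V)"
proof (intro equalityI subsetI)
  fix a assume "a \<in> gen ((\<lambda>x. single x (1::nat)) ` V)"
  then obtain X where "a = sum_mset X" "set_mset X \<subseteq> (\<lambda>x. single x 1) ` V" unfolding gen_def by blast
  then show "a \<in> mon V" by (induction X arbitrary: a) (auto simp: mon_add_iff intro: mon_single)
next
  fix a assume a: "a \<in> mon V"
  have single: "single x k \<in> gen ((\<lambda>x. single x 1) ` V)" if "x \<in> V" for x and k :: nat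
  proof (induction k)
    case (Suc k)
    have "single x (Suc k) = single x 1 + single x k" by (simp flip: single_add)
    moreover have "single x 1 \<in> gen ((\<lambda>x. single x 1) ` V)" using that by (intro gen_base) blast
    ultimately show ?case using gen_add[of "single x 1" _ "single x k"] Suc by (simp only:)
  qed (simp add: gen_0)
  have "finite K \<Longrightarrow> K \<subseteq> V \<Longrightarrow> (\<Sum>x\<in>K. single x (lookup a x)) \<in> gen ((\<lambda>x. single x 1) ` V)" for K
    by (induction K rule: finite_induct) (auto simp del: One_nat_def intro: gen_0 gen_add single)
  from this[of "keys a"] show "a \<in> gen ((\<lambda>x. single x 1) ` V)"
    using a unfolding mon_def by (simp add: mpoly_expansion[symmetric])
qed

lemma subalg_mon: "subalg {p :: ('v, 'k::field) mpoly. keys p \<subseteq> mon V}"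
  unfolding mon_eq_gen by (rule subalg_gen)

context uniform_edges
begin

lemma gen_edges: "gen (ind ` E) = (\<Union>t. S t)"
  unfolding gen_def S_def sumset_def by auto

text \<open>Products of edge monomials are precisely the monomials of the monoid generated by the
  edges. In this form the dimension formula for monoid algebras applies.\<close>

lemma edge_subring_eq:
  "edge_subring TYPE('k::field) \<lparr>nodes = V, edges = E\<rparr> = class_ring {p :: ('v, 'k) mpoly. keys p \<subseteq> gen (ind ` E)}"
proof -
  define R where "R = polynomial_ring TYPE('k) V"
  have R: "R = class_ring {p. keys p \<subseteq> mon V}" unfolding R_def by (rule polynomial_ring_eq)
  interpret R: cring R unfolding R by (rule cring_class_ring[OF subalg_mon])
  define H :: "('v, 'k) mpoly set" where "H = range const \<union> edge_monomial ` E"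
  have H: "H = range const \<union> (\<lambda>e. single (ind e) 1) ` E"
    unfolding H_def using finite_edge by (auto simp: edge_monomial_eq)
  have gen_mon: "gen (ind ` E) \<subseteq> mon V" unfolding gen_edges using S_subset_mon by blast
  have HR: "H \<subseteq> carrier R"
    unfolding H R class_ring_def using subalg_closed(1)[OF subalg_mon] ind_in_mon[OF edge_subset] by auto
  have "generate_ring R H = {p. keys p \<subseteq> gen (ind ` E)}"
  proof (intro equalityI subsetI)
    fix p :: "('v, 'k) mpoly" assume p: "p \<in> generate_ring R H"
    note cl = subalg_closed[OF subalg_gen[of "ind ` E"]]
    show "p \<in> {p. keys p \<subseteq> gen (ind ` E)}"
      using p
    proof (induction rule: generate_ring.induct)
      case one
      then show ?case using cl(3) unfolding R class_ring_def by simp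
    next
      case (incl h)
      then show ?case unfolding H using cl(1) gen_base[of _ "ind ` E"] by auto
    next
      case (a_inv h)
      then have "h \<in> {p. keys p \<subseteq> mon V}" using gen_mon by blast
      then have "\<ominus>\<^bsub>R\<^esub> h = - h" unfolding R by (rule a_inv_class_ring[OF subalg_mon])
      then show ?case using cl(6)[OF a_inv(2)] by simp
    next
      case (eng_add h1 h2)
      then show ?case using cl(4)[OF eng_add(3,4)] unfolding R class_ring_def by simp
    next
      case (eng_mult h1 h2)
      then show ?case using cl(5)[OF eng_mult(3,4)] unfolding R class_ring_def by simp
    qed
  next
    fix p :: "('v, 'k) mpoly" assume p: "p \<in> {p. keys p \<subseteq> gen (ind ` E)}"
    have add: "a + b \<in> generate_ring R H" if "a \<in> generate_ring R H" "b \<in> generate_ring R H" for a b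
      using generate_ring.eng_add[OF that] unfolding R class_ring_def by simp
    have mult: "a * b \<in> generate_ring R H" if "a \<in> generate_ring R H" "b \<in> generate_ring R H" for a b
      using generate_ring.eng_mult[OF that] unfolding R class_ring_def by simp
    have const: "const c \<in> generate_ring R H" for c
      by (rule generate_ring.incl) (simp add: H)
    have mono: "single a 1 \<in> generate_ring R H" if a: "a \<in> gen (ind ` E)" for a
    proof -
      obtain X where "a = sum_mset X" "set_mset X \<subseteq> ind ` E" using a unfolding gen_def by blast
      then show ?thesis
      proof (induction X arbitrary: a)
        case empty
        then show ?case using const[of 1] by simp
      next
        case (add x X)
        have "single x 1 \<in> generate_ring R H" using add.prems(2) by (intro generate_ring.incl) (auto simp: H)
        moreover have "single (sum_mset X) 1 \<in> generate_ring R H" using add by simp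
        moreover have "single a 1 = single x 1 * single (sum_mset X) (1::'k)" unfolding add(2) by (simp add: mult_single)
        ultimately show ?case using mult by simp
      qed
    qed
    have "K \<subseteq> gen (ind ` E) \<Longrightarrow> finite K \<Longrightarrow> (\<Sum>a\<in>K. const (lookup p a) * single a 1) \<in> generate_ring R H" for K
    proof (induction K rule: infinite_finite_induct)
      case empty
      then show ?case using const[of 0] by simp
    qed (auto intro!: add mult const mono)
    from this[of "keys p"] have "(\<Sum>a\<in>keys p. const (lookup p a) * single a 1) \<in> generate_ring R H" using p by simp
    moreover have "p = (\<Sum>a\<in>keys p. const (lookup p a) * single a 1)"
      unfolding const_eq by (subst mpoly_expansion[of p]) (simp add: mult_single)
    ultimately show "p \<in> generate_ring R H" by simp
  qed
  then show ?thesis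
    unfolding edge_subring_def hypergraph.simps R_def[symmetric] H_def[symmetric]
    by (simp add: R class_ring_def)
qed

lemma dim_edge_subring_component:
  "mpoly.dim (edge_subring_component TYPE('k::field) \<lparr>nodes = V, edges = E\<rparr> t) = card (S t)"
proof -
  have em: "edge_monomial ` E = (\<lambda>a. single a 1) ` ind ` E"
    using finite_edge by (auto simp: edge_monomial_eq image_image)
  have "{prod_mset X | X. set_mset X \<subseteq> edge_monomial ` E \<and> size X = t} = (\<lambda>a. single a (1::'k)) ` S t"
  proof (intro equalityI subsetI)
    fix p :: "('v, 'k) mpoly"
    assume "p \<in> {prod_mset X | X. set_mset X \<subseteq> edge_monomial ` E \<and> size X = t}"
    then obtain X where X: "p = prod_mset X" "set_mset X \<subseteq> (\<lambda>a. single a 1) ` ind ` E" "size X = t"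
      unfolding em by blast
    have "\<exists>Y. set_mset Y \<subseteq> ind ` E \<and> X = image_mset (\<lambda>a. single a 1) Y"
      using X(2)
    proof (induction X)
      case (add x X)
      then obtain Y a where "set_mset Y \<subseteq> ind ` E" "X = image_mset (\<lambda>a. single a 1) Y" "a \<in> ind ` E" "x = single a 1"
        by auto
      then show ?case by (intro exI[of _ "add_mset a Y"]) simp
    qed simp
    then show "p \<in> (\<lambda>a. single a 1) ` S t"
    proof (elim exE conjE)
      fix Y assume Y: "set_mset Y \<subseteq> ind ` E" "X = image_mset (\<lambda>a. single a 1) Y"
      then have "sum_mset Y \<in> S t" using X(3) unfolding S_def by (metis size_image_mset sumsetI)
      moreover have "p = single (sum_mset Y) 1" unfolding X(1) Y(2) by (rule prod_mset_single)
      ultimately show ?thesis by blast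
    qed
  next
    fix p :: "('v, 'k) mpoly" assume "p \<in> (\<lambda>a. single a 1) ` S t"
    then obtain X where X: "p = single (sum_mset X) 1" "set_mset X \<subseteq> ind ` E" "size X = t"
      unfolding S_def sumset_def by blast
    then show "p \<in> {prod_mset X | X. set_mset X \<subseteq> edge_monomial ` E \<and> size X = t}"
      unfolding em by (intro CollectI exI[of _ "image_mset (\<lambda>a. single a 1) X"]) (auto simp: prod_mset_single)
  qed
  then show ?thesis
    unfolding edge_subring_component_def hypergraph.simps by (simp only: span_monomials dim_monomials)
qed

end

text \<open>Linking writes \<open>m\<close> times each unit vector as a difference of two sums of
  edges; after division by \<open>m\<close> the unit vectors lie in the real span of the edges, so
  the rank is \<open>card V\<close>.\<close>

theorem (in linked_edges) krull_dim_edge_subring: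
  "krull_dim (edge_subring TYPE('k::field) \<lparr>nodes = V, edges = E\<rparr>) = enat (card V)"
  unfolding edge_subring_eq
proof (rule krull_dim_monoid_algebra[OF finite_V])
  show "finite (ind ` E)" using finite_E by simp
  show "ind ` E \<subseteq> mon V" using ind_in_mon[OF edge_subset] by blast
  show "0 \<notin> ind ` E"
  proof
    assume "0 \<in> ind ` E"
    then obtain e where e: "e \<in> E" "ind e = 0" by auto
    then obtain x where "x \<in> e" using edge_nonempty by blast
    then show False using lookup_ind[OF finite_edge[OF e(1)], of x] e(2) by simp
  qed
  fix x assume x: "x \<in> V"
  have S_span: "rvec s \<in> real_fun.span (rvec ` ind ` E)" if "s \<in> S t" for s t
    using that
  proof (induction rule: S_induct)
    case zero
    show ?case unfolding rvec_0 by (rule real_fun.span_zero)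
  next
    case (edge t e s)
    then show ?case unfolding rvec_add by (intro real_fun.span_add[OF real_fun.span_base]) auto
  qed
  have "rel 1 (single x m) 0"
    using rel_trans[OF rel_single[OF linked[OF x]] rel_single_m] x unfolding C_def by auto
  then obtain p s1 s2 where s: "s1 \<in> S (p + 1)" "s2 \<in> S p" "single x m + s2 = 0 + s1" unfolding rel_def by blast
  have "rvec (single x m) + rvec s2 = rvec s1" using arg_cong[OF s(3), of rvec] by (simp only: rvec_add add_0_left)
  then have "rvec (single x m) = rvec s1 - rvec s2" by (simp only: eq_diff_eq)
  then have "rvec (single x m) \<in> real_fun.span (rvec ` ind ` E)"
    using S_span[OF s(1)] S_span[OF s(2)] by (simp only: real_fun.span_diff)
  then have "(\<lambda>y. 1 / real m * rvec (single x m) y) \<in> real_fun.span (rvec ` ind ` E)" by (rule real_fun.span_scale)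
  moreover have "(\<lambda>y. 1 / real m * rvec (single x m) y) = (\<lambda>y. if y = x then 1 else 0)"
    using m_pos unfolding rvec_def by (auto simp: lookup_single when_def fun_eq_iff)
  ultimately show "(\<lambda>y. if y = x then 1 else 0) \<in> real_fun.span (rvec ` ind ` E)" by simp
qed

section \<open>The local ring at the origin\<close>

text \<open>The exponent sets of monomial ideals.\<close>

definition upset :: "'v set \<Rightarrow> ('v \<Rightarrow>\<^sub>0 nat) set \<Rightarrow> bool"
  where "upset V I \<longleftrightarrow> I \<subseteq> mon V \<and> (\<forall>a\<in>I. \<forall>b\<in>mon V. a + b \<in> I)"

lemma keys_mult_upset:
  "upset V I \<Longrightarrow> keys p \<subseteq> mon V \<Longrightarrow> keys q \<subseteq> I \<Longrightarrow> keys (p * q) \<subseteq> I"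
  "upset V I \<Longrightarrow> keys p \<subseteq> mon V \<Longrightarrow> keys q \<subseteq> I \<Longrightarrow> keys (q * p) \<subseteq> I"
proof -
  assume *: "upset V I" "keys p \<subseteq> mon V" "keys q \<subseteq> I"
  show "keys (q * p) \<subseteq> I"
  proof (rule keys_mult_subset)
    fix a b assume "a \<in> keys q" "b \<in> keys p"
    then show "a + b \<in> I" using * unfolding upset_def by blast
  qed
  show "keys (p * q) \<subseteq> I"
  proof (rule keys_mult_subset)
    fix a b assume "a \<in> keys p" "b \<in> keys q"
    then have "b + a \<in> I" using * unfolding upset_def by blast
    then show "a + b \<in> I" by (simp only: add.commute)
  qed
qed

lemma mon_split:
  assumes "a \<in> mon V" "a \<noteq> 0"
  obtains x b where "x \<in> V" "b \<in> mon V" "a = single x 1 + b"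
proof -
  obtain x where x: "lookup a x \<noteq> 0" using assms(2) by (metis lookup_zero poly_mapping_eqI)
  then have "x \<in> V" using assms(1) unfolding mon_def by (auto simp: in_keys_iff)
  have "lookup (single x 1) y \<le> lookup a y" for y using x by (auto simp: lookup_single when_def)
  then obtain b where "a = single x 1 + b" by (rule monomial_le_imp_add)
  then show thesis using that \<open>x \<in> V\<close> assms(1) by (auto simp: mon_add_iff)
qed

locale origin =
  fixes K :: "'k::field itself" and V :: "'v set"
  assumes finite_V: "finite V"
begin

definition P :: "('v, 'k) mpoly set"
  where "P = {p. keys p \<subseteq> mon V}"

definition U :: "('v, 'k) mpoly set"
  where "U = {p \<in> P. lookup p 0 \<noteq> 0}"

abbreviation L :: "(('v, 'k) mpoly \<times> ('v, 'k) mpoly) set ring"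
  where "L \<equiv> local_polynomial_ring K V"

text \<open>Explicit form of a fraction in the local ring. Denominators can be cancelled, so the
  auxiliary factor in \<open>frac_rel\<close> disappears and only cross multiplication
  remains.\<close>

definition fr :: "('v, 'k) mpoly \<Rightarrow> ('v, 'k) mpoly \<Rightarrow> (('v, 'k) mpoly \<times> ('v, 'k) mpoly) set"
  where "fr a s = {(b, t). b \<in> P \<and> t \<in> U \<and> t * a = s * b}"

lemma ring_eq: "polynomial_ring K V = class_ring P"
  unfolding P_def polynomial_ring_def class_ring_def mon_def by auto

lemma subalg_P: "subalg P"
  unfolding P_def by (rule subalg_mon)

lemmas P_closed = subalg_closed[OF subalg_P]

lemma P_diff: "a \<in> P \<Longrightarrow> b \<in> P \<Longrightarrow> a - b \<in> P"
  using P_closed(4)[of a "- b"] P_closed(6)[of b] by simp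

lemma U_P: "s \<in> U \<Longrightarrow> s \<in> P"
  unfolding U_def by blast

lemma U_nonzero: "s \<in> U \<Longrightarrow> s \<noteq> 0"
  unfolding U_def by auto

lemma U_1: "1 \<in> U"
  unfolding U_def using P_closed(3) by simp

lemma U_mult: "s \<in> U \<Longrightarrow> t \<in> U \<Longrightarrow> s * t \<in> U"
  unfolding U_def using P_closed(5) by (auto simp: lookup_mult_0)

lemma single_P: "a \<in> mon V \<Longrightarrow> single a c \<in> P"
  unfolding P_def by auto

lemma cancel: "s \<in> U \<Longrightarrow> s * a = s * b \<Longrightarrow> a = b"
  using mpoly_mult_nonzero[of s "a - b"] U_nonzero by (auto simp: right_diff_distrib)

text \<open>A nonzero exponent vector splits off a variable, so every polynomial without constant
  term lies in the ideal. The admissible denominators thereby become the polynomials with nonzero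
  constant term.\<close>

lemma irrelevant_eq: "irrelevant_ideal K V = {p \<in> P. lookup p 0 = 0}"
proof -
  interpret R: cring "class_ring P" by (rule cring_class_ring[OF subalg_P])
  have var_P: "var ` V \<subseteq> carrier (class_ring P)"
    unfolding var_def class_ring_def using single_P[OF mon_single] by auto
  have "Idl\<^bsub>class_ring P\<^esub> (var ` V) = {p \<in> P. lookup p 0 = 0}"
  proof (intro equalityI)
    have "ideal {p \<in> P. lookup p 0 = 0} (class_ring P)"
    proof (rule idealI)
      show "ring (class_ring P)" by (rule R.ring_axioms)
      show "subgroup {p \<in> P. lookup p 0 = 0} (add_monoid (class_ring P))"
      proof
        fix x assume x: "x \<in> {p \<in> P. lookup p 0 = 0}"
        then show "inv\<^bsub>add_monoid (class_ring P)\<^esub> x \<in> {p \<in> P. lookup p 0 = 0}"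
          using a_inv_class_ring[OF subalg_P, of x] P_closed(6)[of x] unfolding a_inv_def by simp
      qed (use P_closed in \<open>auto simp: class_ring_def lookup_add\<close>)
    qed (use P_closed in \<open>auto simp: class_ring_def lookup_mult_0\<close>)
    moreover have "var ` V \<subseteq> {p \<in> P. lookup p 0 = 0}"
    proof (rule image_subsetI)
      fix x assume "x \<in> V"
      then have "var x \<in> P" using var_P unfolding class_ring_def by auto
      moreover have "single x (1::nat) \<noteq> 0" by (metis lookup_single_eq lookup_zero one_neq_zero)
      ultimately show "var x \<in> {p \<in> P. lookup p 0 = 0}"
        unfolding var_def by (simp add: lookup_single when_def)
    qed
    ultimately show "Idl\<^bsub>class_ring P\<^esub> (var ` V) \<subseteq> {p \<in> P. lookup p 0 = 0}" by (rule R.genideal_minimal)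
    interpret I: ideal "Idl\<^bsub>class_ring P\<^esub> (var ` V)" "class_ring P" by (rule R.genideal_ideal[OF var_P])
    show "{p \<in> P. lookup p 0 = 0} \<subseteq> Idl\<^bsub>class_ring P\<^esub> (var ` V)"
    proof
      fix p assume p: "p \<in> {p \<in> P. lookup p 0 = 0}"
      have mono: "single a c \<in> Idl\<^bsub>class_ring P\<^esub> (var ` V)" if a: "a \<in> mon V" "a \<noteq> 0" for a c
      proof -
        obtain x b where xb: "x \<in> V" "b \<in> mon V" "a = single x 1 + b" using mon_split[OF a] .
        have "var x \<in> Idl\<^bsub>class_ring P\<^esub> (var ` V)" using R.genideal_self[OF var_P] xb(1) by blast
        from I.I_r_closed[OF this, of "single b c"] single_P[OF xb(2)]
        have "var x * single b c \<in> Idl\<^bsub>class_ring P\<^esub> (var ` V)" unfolding class_ring_def by simp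
        then show ?thesis unfolding var_def xb(3) by (simp add: mult_single)
      qed
      have add: "f + g \<in> Idl\<^bsub>class_ring P\<^esub> (var ` V)"
        if "f \<in> Idl\<^bsub>class_ring P\<^esub> (var ` V)" "g \<in> Idl\<^bsub>class_ring P\<^esub> (var ` V)" for f g
        using I.a_closed[OF that] by (simp add: class_ring_def)
      have "(\<Sum>a\<in>A. single a (lookup p a)) \<in> Idl\<^bsub>class_ring P\<^esub> (var ` V)" if "finite A" "A \<subseteq> keys p" for A
        using that
      proof (induction A rule: finite_induct)
        case empty
        then show ?case using I.zero_closed by (simp add: class_ring_def)
      next
        case (insert a A)
        then have "a \<in> mon V" "a \<noteq> 0" using p unfolding P_def by (auto simp: in_keys_iff)
        then show ?case using insert add mono by simp
      qed
      from this[of "keys p"] show "p \<in> Idl\<^bsub>class_ring P\<^esub> (var ` V)" by (simp flip: mpoly_expansion)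
    qed
  qed
  then show ?thesis unfolding irrelevant_ideal_def ring_eq .
qed

lemma units_eq: "units_at_origin K V = U"
  unfolding units_at_origin_def irrelevant_eq U_def by (auto simp: ring_eq class_ring_def)

lemma frac_rel_eq: "frac_rel (polynomial_ring K V) U = {((a, s), (b, t)). a \<in> P \<and> s \<in> U \<and> b \<in> P \<and> t \<in> U \<and> t * a = s * b}"
  unfolding frac_rel_def ring_eq class_ring_def
proof (intro Collect_cong, clarsimp, intro conj_cong refl iffI)
  fix a s b t assume "\<exists>u\<in>U. u * (t * a) = u * (s * b)"
  then show "t * a = s * b" using cancel by blast
next
  fix a s b t :: "('v, 'k) mpoly" assume "t * a = s * b"
  then show "\<exists>u\<in>U. u * (t * a) = u * (s * b)" using U_1 by (intro bexI[of _ 1]) simp_all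
qed

lemma fraction_eq: "a \<in> P \<Longrightarrow> s \<in> U \<Longrightarrow> fraction (polynomial_ring K V) U a s = fr a s"
  unfolding fraction_def frac_rel_eq fr_def by auto

lemma fr_self: "a \<in> P \<Longrightarrow> s \<in> U \<Longrightarrow> (a, s) \<in> fr a s"
  unfolding fr_def by (simp add: mult.commute)

lemma fr_eq_iff:
  assumes "a \<in> P" "s \<in> U" "b \<in> P" "t \<in> U"
  shows "fr a s = fr b t \<longleftrightarrow> t * a = s * b"
proof
  assume "fr a s = fr b t"
  then have "(b, t) \<in> fr a s" using fr_self[OF assms(3,4)] by blast
  then show "t * a = s * b" unfolding fr_def by simp
next
  assume eq: "t * a = s * b"
  have sub: "fr a s \<subseteq> fr b t" if st: "s \<in> U" "t * a = s * b" for a b s t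
  proof
    fix z assume z: "z \<in> fr a s"
    then obtain c u where cu: "z = (c, u)" "c \<in> P" "u \<in> U" "u * a = s * c" unfolding fr_def by blast
    have "s * (u * b) = u * (s * b)" by (simp only: mult_ac)
    also have "\<dots> = t * (u * a)" unfolding st(2)[symmetric] by (simp only: mult_ac)
    also have "\<dots> = s * (t * c)" unfolding cu(4) by (simp only: mult_ac)
    finally have "u * b = t * c" by (rule cancel[OF st(1)])
    then show "z \<in> fr b t" using cu unfolding fr_def by simp
  qed
  show "fr a s = fr b t" using sub[of s t a b] sub[of t s b a] assms eq by auto
qed

lemma carrier_L: "carrier L = {fr a s | a s. a \<in> P \<and> s \<in> U}"
proof -
  have "carrier L = (P \<times> U) // frac_rel (polynomial_ring K V) U"
    unfolding local_polynomial_ring_def localization_def units_eq ring_eq by (simp add: class_ring_def)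
  also have "\<dots> = {fr a s | a s. a \<in> P \<and> s \<in> U}"
    unfolding quotient_def using fraction_eq unfolding fraction_def by blast
  finally show ?thesis .
qed

lemma fr_carrier: "a \<in> P \<Longrightarrow> s \<in> U \<Longrightarrow> fr a s \<in> carrier L"
  unfolding carrier_L by blast

lemma carrierE:
  assumes "X \<in> carrier L" obtains a s where "X = fr a s" "a \<in> P" "s \<in> U"
  using assms unfolding carrier_L by blast

lemma fr_D: "(b, t) \<in> fr a s \<Longrightarrow> b \<in> P \<and> t \<in> U \<and> t * a = s * b"
  unfolding fr_def by simp

text \<open>The product is a union over all representatives; the calculation shows that every member
  of this family is the same class.\<close>

lemma mult_fr:
  assumes "a \<in> P" "s \<in> U" "b \<in> P" "t \<in> U"
  shows "fr a s \<otimes>\<^bsub>L\<^esub> fr b t = fr (a * b) (s * t)"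
proof -
  have "fr a s \<otimes>\<^bsub>L\<^esub> fr b t = (\<Union>(a', s')\<in>fr a s. \<Union>(b', t')\<in>fr b t. fraction (polynomial_ring K V) U (a' * b') (s' * t'))"
    unfolding local_polynomial_ring_def localization_def units_eq by (simp add: ring_eq class_ring_def)
  also have "\<dots> = (\<Union>(a', s')\<in>fr a s. \<Union>(b', t')\<in>fr b t. fr (a * b) (s * t))"
  proof -
    have "fraction (polynomial_ring K V) U (a' * b') (s' * t') = fr (a * b) (s * t)"
      if "(a', s') \<in> fr a s" "(b', t') \<in> fr b t" for a' s' b' t'
    proof -
      note d = fr_D[OF that(1)] fr_D[OF that(2)]
      have "(s * t) * (a' * b') = (s * a') * (t * b')" by (simp only: mult_ac)
      also have "\<dots> = (s' * a) * (t' * b)" using d by simp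
      also have "\<dots> = (s' * t') * (a * b)" by (simp only: mult_ac)
      finally show ?thesis using d assms P_closed U_mult by (simp add: fraction_eq fr_eq_iff)
    qed
    then show ?thesis by (intro SUP_cong refl) auto
  qed
  also have "\<dots> = fr (a * b) (s * t)" using fr_self assms by blast
  finally show ?thesis .
qed

lemma add_fr:
  assumes "a \<in> P" "s \<in> U" "b \<in> P" "t \<in> U"
  shows "fr a s \<oplus>\<^bsub>L\<^esub> fr b t = fr (t * a + s * b) (s * t)"
proof -
  have "fr a s \<oplus>\<^bsub>L\<^esub> fr b t = (\<Union>(a', s')\<in>fr a s. \<Union>(b', t')\<in>fr b t.
      fraction (polynomial_ring K V) U (t' * a' + s' * b') (s' * t'))"
    unfolding local_polynomial_ring_def localization_def units_eq by (simp add: ring_eq class_ring_def)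
  also have "\<dots> = (\<Union>(a', s')\<in>fr a s. \<Union>(b', t')\<in>fr b t. fr (t * a + s * b) (s * t))"
  proof -
    have "fraction (polynomial_ring K V) U (t' * a' + s' * b') (s' * t') = fr (t * a + s * b) (s * t)"
      if "(a', s') \<in> fr a s" "(b', t') \<in> fr b t" for a' s' b' t'
    proof -
      note d = fr_D[OF that(1)] fr_D[OF that(2)]
      have "(s * t) * (t' * a' + s' * b') = (s * a') * (t * t') + (t * b') * (s * s')"
        by (simp only: distrib_left mult_ac)
      also have "\<dots> = (s' * a) * (t * t') + (t' * b) * (s * s')" using d by simp
      also have "\<dots> = (s' * t') * (t * a + s * b)" by (simp only: distrib_left mult_ac)
      finally show ?thesis using d assms P_closed U_mult U_P by (simp add: fraction_eq fr_eq_iff)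
    qed
    then show ?thesis by (intro SUP_cong refl) auto
  qed
  also have "\<dots> = fr (t * a + s * b) (s * t)" using fr_self assms by blast
  finally show ?thesis .
qed

lemma add_fr_same:
  assumes "a \<in> P" "b \<in> P" "s \<in> U"
  shows "fr a s \<oplus>\<^bsub>L\<^esub> fr b s = fr (a + b) s"
  using assms P_closed U_mult U_P by (simp add: add_fr fr_eq_iff algebra_simps)

lemma one_L: "\<one>\<^bsub>L\<^esub> = fr 1 1"
  unfolding local_polynomial_ring_def localization_def units_eq
  using fraction_eq[OF P_closed(3) U_1] by (simp add: ring_eq class_ring_def)

lemma zero_L: "\<zero>\<^bsub>L\<^esub> = fr 0 1"
  unfolding local_polynomial_ring_def localization_def units_eq
  using fraction_eq[OF P_closed(2) U_1] by (simp add: ring_eq class_ring_def)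

lemma cring_L: "cring L"
proof (rule cringI)
  show "abelian_group L"
  proof (rule abelian_groupI)
    fix X Y assume "X \<in> carrier L" "Y \<in> carrier L"
    then obtain a s b t where XY: "X = fr a s" "Y = fr b t" "a \<in> P" "s \<in> U" "b \<in> P" "t \<in> U"
      by (elim carrierE)
    then show "X \<oplus>\<^bsub>L\<^esub> Y \<in> carrier L" "X \<oplus>\<^bsub>L\<^esub> Y = Y \<oplus>\<^bsub>L\<^esub> X"
      using P_closed U_mult U_P by (auto simp: add_fr mult.commute add.commute intro!: fr_carrier)
    fix Z assume "Z \<in> carrier L"
    then obtain c u where "Z = fr c u" "c \<in> P" "u \<in> U" by (elim carrierE)
    then show "X \<oplus>\<^bsub>L\<^esub> Y \<oplus>\<^bsub>L\<^esub> Z = X \<oplus>\<^bsub>L\<^esub> (Y \<oplus>\<^bsub>L\<^esub> Z)"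
      using XY P_closed U_mult U_P by (simp add: add_fr algebra_simps)
  next
    show "\<zero>\<^bsub>L\<^esub> \<in> carrier L" unfolding zero_L using P_closed U_1 by (intro fr_carrier)
    fix X assume "X \<in> carrier L"
    then obtain a s where X: "X = fr a s" "a \<in> P" "s \<in> U" by (elim carrierE)
    then show "\<zero>\<^bsub>L\<^esub> \<oplus>\<^bsub>L\<^esub> X = X" unfolding zero_L using P_closed U_1 by (simp add: add_fr)
    show "\<exists>Y\<in>carrier L. Y \<oplus>\<^bsub>L\<^esub> X = \<zero>\<^bsub>L\<^esub>"
    proof
      show "fr (- a) s \<in> carrier L" using X P_closed by (intro fr_carrier)
      show "fr (- a) s \<oplus>\<^bsub>L\<^esub> X = \<zero>\<^bsub>L\<^esub>"
        unfolding zero_L X(1) using X P_closed U_1 by (simp add: add_fr_same fr_eq_iff)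
    qed
  qed
  show "comm_monoid L"
  proof (rule comm_monoidI)
    fix X Y assume "X \<in> carrier L" "Y \<in> carrier L"
    then obtain a s b t where XY: "X = fr a s" "Y = fr b t" "a \<in> P" "s \<in> U" "b \<in> P" "t \<in> U"
      by (elim carrierE)
    then show "X \<otimes>\<^bsub>L\<^esub> Y \<in> carrier L" "X \<otimes>\<^bsub>L\<^esub> Y = Y \<otimes>\<^bsub>L\<^esub> X"
      using P_closed U_mult by (auto simp: mult_fr mult.commute intro!: fr_carrier)
    fix Z assume "Z \<in> carrier L"
    then obtain c u where "Z = fr c u" "c \<in> P" "u \<in> U" by (elim carrierE)
    then show "X \<otimes>\<^bsub>L\<^esub> Y \<otimes>\<^bsub>L\<^esub> Z = X \<otimes>\<^bsub>L\<^esub> (Y \<otimes>\<^bsub>L\<^esub> Z)"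
      using XY P_closed U_mult by (simp add: mult_fr mult.assoc)
  next
    show "\<one>\<^bsub>L\<^esub> \<in> carrier L" unfolding one_L using P_closed U_1 by (intro fr_carrier)
    fix X assume "X \<in> carrier L"
    then obtain a s where X: "X = fr a s" "a \<in> P" "s \<in> U" by (elim carrierE)
    then show "\<one>\<^bsub>L\<^esub> \<otimes>\<^bsub>L\<^esub> X = X" unfolding one_L using P_closed U_1 by (simp add: mult_fr)
  qed
  fix X Y Z assume "X \<in> carrier L" "Y \<in> carrier L" "Z \<in> carrier L"
  then obtain a s b t c u where XYZ: "X = fr a s" "Y = fr b t" "Z = fr c u" "a \<in> P" "s \<in> U" "b \<in> P" "t \<in> U" "c \<in> P" "u \<in> U"
    by (elim carrierE)
  then show "(X \<oplus>\<^bsub>L\<^esub> Y) \<otimes>\<^bsub>L\<^esub> Z = X \<otimes>\<^bsub>L\<^esub> Z \<oplus>\<^bsub>L\<^esub> Y \<otimes>\<^bsub>L\<^esub> Z"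
    using P_closed U_mult U_P by (simp add: mult_fr add_fr fr_eq_iff algebra_simps)
qed

sublocale L: cring L by (rule cring_L)

lemma a_inv_fr: "a \<in> P \<Longrightarrow> s \<in> U \<Longrightarrow> \<ominus>\<^bsub>L\<^esub> fr a s = fr (- a) s"
proof (rule L.minus_equality)
  assume "a \<in> P" "s \<in> U"
  then show "fr (- a) s \<oplus>\<^bsub>L\<^esub> fr a s = \<zero>\<^bsub>L\<^esub>" "fr a s \<in> carrier L" "fr (- a) s \<in> carrier L"
    using P_closed U_1 by (auto simp: add_fr_same fr_eq_iff zero_L intro!: fr_carrier)
qed

section \<open>Ideals of the local ring extended from monomial ideals\<close>

definition Loc :: "('v \<Rightarrow>\<^sub>0 nat) set \<Rightarrow> (('v, 'k) mpoly \<times> ('v, 'k) mpoly) set set"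
  where "Loc I = {fr f s | f s. f \<in> P \<and> keys f \<subseteq> I \<and> s \<in> U}"

lemma LocE:
  assumes "X \<in> Loc I" obtains f s where "X = fr f s" "f \<in> P" "keys f \<subseteq> I" "s \<in> U"
  using assms unfolding Loc_def by blast

lemma LocI: "f \<in> P \<Longrightarrow> keys f \<subseteq> I \<Longrightarrow> s \<in> U \<Longrightarrow> fr f s \<in> Loc I"
  unfolding Loc_def by blast

text \<open>Saturation of monomial ideals with respect to denominators allows membership to be read
  off from any numerator, not only from a suitable one.\<close>

lemma fr_in_Loc_iff:
  assumes "upset V I" "f \<in> P" "s \<in> U"
  shows "fr f s \<in> Loc I \<longleftrightarrow> keys f \<subseteq> I"
proof
  assume "fr f s \<in> Loc I"
  then obtain g t where g: "fr f s = fr g t" "g \<in> P" "keys g \<subseteq> I" "t \<in> U" by (rule LocE)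
  then have eq: "t * f = s * g" using fr_eq_iff assms by simp
  show "keys f \<subseteq> I"
  proof (rule monomial_ideal_saturated[OF finite_V])
    show "keys (t * f) \<subseteq> I"
      unfolding eq using assms g(3) U_P[OF assms(3)] unfolding P_def by (intro keys_mult_upset(1)) auto
    show "keys f \<subseteq> mon V" "keys t \<subseteq> mon V" "lookup t 0 \<noteq> 0"
      using assms g(4) unfolding U_def P_def by auto
    show "a + b \<in> I" if "a \<in> I" "b \<in> mon V" for a b using assms(1) that unfolding upset_def by blast
  qed
qed (use assms LocI in blast)

lemma Loc_mon: "Loc (mon V) = carrier L"
  unfolding Loc_def carrier_L P_def by blast

lemma Loc_subset_carrier: "Loc I \<subseteq> carrier L"
  unfolding Loc_def carrier_L by blast

lemma ideal_Loc:
  assumes "upset V I" shows "ideal (Loc I) L"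
proof (rule idealI)
  show "ring L" by (rule L.ring_axioms)
  show "subgroup (Loc I) (add_monoid L)"
  proof
    show "Loc I \<subseteq> carrier (add_monoid L)" using Loc_subset_carrier by simp
    show "\<one>\<^bsub>add_monoid L\<^esub> \<in> Loc I" using LocI[of 0 I 1] P_closed U_1 by (simp add: zero_L)
    fix X assume "X \<in> Loc I"
    then obtain f s where X: "X = fr f s" "f \<in> P" "keys f \<subseteq> I" "s \<in> U" by (rule LocE)
    have "fr (- f) s \<in> Loc I" using X P_closed by (intro LocI) (auto simp: in_keys_iff subset_iff)
    then show "inv\<^bsub>add_monoid L\<^esub> X \<in> Loc I" using a_inv_fr[OF X(2,4)] X(1) unfolding a_inv_def by simp
    fix Y assume "Y \<in> Loc I"
    then obtain g t where Y: "Y = fr g t" "g \<in> P" "keys g \<subseteq> I" "t \<in> U" by (rule LocE)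
    have "keys t \<subseteq> mon V" "keys s \<subseteq> mon V" using U_P[OF X(4)] U_P[OF Y(4)] unfolding P_def by auto
    then have "keys (t * f) \<subseteq> I" "keys (s * g) \<subseteq> I"
      using X(3) Y(3) by (blast dest: keys_mult_upset(1)[OF assms])+
    then have "fr (t * f + s * g) (s * t) \<in> Loc I"
      using X Y P_closed U_mult U_P by (intro LocI keys_add_subset) auto
    then show "X \<otimes>\<^bsub>add_monoid L\<^esub> Y \<in> Loc I" using X Y by (simp add: add_fr)
  qed
  fix X Y assume "X \<in> Loc I" "Y \<in> carrier L"
  then obtain f s g t where XY: "X = fr f s" "f \<in> P" "keys f \<subseteq> I" "s \<in> U" "Y = fr g t" "g \<in> P" "t \<in> U"
    by (elim LocE carrierE)
  have "keys (g * f) \<subseteq> I" using assms XY unfolding P_def by (intro keys_mult_upset(1)) auto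
  then have "fr (g * f) (t * s) \<in> Loc I" using XY P_closed U_mult by (intro LocI)
  then show "Y \<otimes>\<^bsub>L\<^esub> X \<in> Loc I" using XY by (simp add: mult_fr)
  then show "X \<otimes>\<^bsub>L\<^esub> Y \<in> Loc I" using XY L.m_comm[of X Y] fr_carrier by simp
qed

text \<open>Lets membership in a generated ideal be checked one monomial at a time.\<close>

lemma fr_sum_in:
  assumes "\<And>X Y. X \<in> J \<Longrightarrow> Y \<in> J \<Longrightarrow> X \<oplus>\<^bsub>L\<^esub> Y \<in> J" "fr 0 s \<in> J" "s \<in> U" "f \<in> P"
    "\<And>a. a \<in> keys f \<Longrightarrow> fr (single a (lookup f a)) s \<in> J"
  shows "fr f s \<in> J"
proof -
  have "fr (\<Sum>a\<in>A. single a (lookup f a)) s \<in> J \<and> (\<Sum>a\<in>A. single a (lookup f a)) \<in> P"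
    if "finite A" "A \<subseteq> keys f" for A
    using that
  proof (induction A rule: finite_induct)
    case empty
    then show ?case using assms(2) P_closed by simp
  next
    case (insert a A)
    then have aP: "single a (lookup f a) \<in> P" using assms(4) single_P unfolding P_def by blast
    have A: "fr (\<Sum>a\<in>A. single a (lookup f a)) s \<in> J" "(\<Sum>a\<in>A. single a (lookup f a)) \<in> P"
      using insert by auto
    have "fr (single a (lookup f a)) s \<in> J" using assms(5) insert.prems by blast
    from assms(1)[OF this A(1)] show ?case
      using insert.hyps P_closed(4)[OF aP A(2)] by (simp add: add_fr_same[OF aP A(2) assms(3)])
  qed
  from this[of "keys f"] show ?thesis by (simp flip: mpoly_expansion)
qed

lemma ideal_prod_Loc:
  assumes "upset V I" "upset V J"
  shows "ideal_prod L (Loc I) (Loc J) = Loc {a + b | a b. a \<in> I \<and> b \<in> J}"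
proof (intro equalityI subsetI)
  let ?S = "{a + b | a b. a \<in> I \<and> b \<in> J}"
  have "upset V ?S"
    unfolding upset_def
  proof (intro conjI ballI)
    show "?S \<subseteq> mon V" using assms unfolding upset_def by (auto simp: mon_add_iff)
    fix c d assume "c \<in> ?S" "d \<in> mon V"
    then obtain a b where "c = a + b" "a \<in> I" "b \<in> J" by blast
    then have "c + d = a + (b + d)" "b + d \<in> J" using assms(2) \<open>d \<in> mon V\<close> unfolding upset_def by (auto simp: add.assoc)
    then show "c + d \<in> ?S" using \<open>a \<in> I\<close> by blast
  qed
  then interpret S: ideal "Loc ?S" L by (rule ideal_Loc)
  fix X assume "X \<in> ideal_prod L (Loc I) (Loc J)"
  then show "X \<in> Loc ?S"
  proof (induction rule: ideal_prod.induct)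
    case (prod X Y)
    then obtain f s g t where XY: "X = fr f s" "f \<in> P" "keys f \<subseteq> I" "s \<in> U" "Y = fr g t" "g \<in> P" "keys g \<subseteq> J" "t \<in> U"
      by (elim LocE)
    have "keys (f * g) \<subseteq> ?S" using XY by (intro keys_mult_subset) blast
    then have "fr (f * g) (s * t) \<in> Loc ?S" using XY P_closed U_mult by (intro LocI)
    then show ?case using XY by (simp add: mult_fr)
  qed (rule S.a_closed)
next
  let ?S = "{a + b | a b. a \<in> I \<and> b \<in> J}"
  fix X assume "X \<in> Loc ?S"
  then obtain f s where X: "X = fr f s" "f \<in> P" "keys f \<subseteq> ?S" "s \<in> U" by (rule LocE)
  have I: "I \<subseteq> mon V" "J \<subseteq> mon V" using assms unfolding upset_def by auto
  have prod: "fr (f * g) s \<in> ideal_prod L (Loc I) (Loc J)" if "f \<in> P" "g \<in> P" "keys f \<subseteq> I" "keys g \<subseteq> J" for f g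
  proof -
    have "fr f 1 \<otimes>\<^bsub>L\<^esub> fr g s \<in> ideal_prod L (Loc I) (Loc J)"
      using that X(4) U_1 by (intro ideal_prod.prod LocI)
    then show ?thesis using that X(4) U_1 by (simp add: mult_fr)
  qed
  show "X \<in> ideal_prod L (Loc I) (Loc J)"
    unfolding X(1)
  proof (rule fr_sum_in)
    show "fr 0 s \<in> ideal_prod L (Loc I) (Loc J)" using prod[of 0 0] P_closed by simp
    fix a assume "a \<in> keys f"
    then obtain b c where bc: "a = b + c" "b \<in> I" "c \<in> J" using X(3) by blast
    have "fr (single b (lookup f a) * single c 1) s \<in> ideal_prod L (Loc I) (Loc J)"
      using bc I by (intro prod single_P) auto
    then show "fr (single a (lookup f a)) s \<in> ideal_prod L (Loc I) (Loc J)"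
      using bc(1) by (simp add: mult_single)
  qed (use X ideal_prod.sum in auto)
qed

definition up :: "('v \<Rightarrow>\<^sub>0 nat) set \<Rightarrow> ('v \<Rightarrow>\<^sub>0 nat) set"
  where "up A = {a + b | a b. a \<in> A \<and> b \<in> mon V}"

lemma upset_up: "A \<subseteq> mon V \<Longrightarrow> upset V (up A)"
  unfolding upset_def up_def
proof (intro conjI ballI)
  assume A: "A \<subseteq> mon V"
  then show "{a + b | a b. a \<in> A \<and> b \<in> mon V} \<subseteq> mon V" by (auto simp: mon_add_iff)
  fix c d assume "c \<in> {a + b | a b. a \<in> A \<and> b \<in> mon V}" "d \<in> mon V"
  then obtain a b where "c = a + b" "a \<in> A" "b \<in> mon V" by blast
  then have "c + d = a + (b + d)" "b + d \<in> mon V" using \<open>d \<in> mon V\<close> by (auto simp: add.assoc mon_add_iff)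
  then show "c + d \<in> {a + b | a b. a \<in> A \<and> b \<in> mon V}" using \<open>a \<in> A\<close> by blast
qed

lemma genideal_Loc:
  assumes A: "A \<subseteq> mon V"
  shows "Idl\<^bsub>L\<^esub> ((\<lambda>a. fr (single a 1) 1) ` A) = Loc (up A)"
proof (intro equalityI)
  have carr: "(\<lambda>a. fr (single a 1) 1) ` A \<subseteq> carrier L"
    using A U_1 single_P by (auto intro!: fr_carrier)
  have "A \<subseteq> up A" unfolding up_def by force
  then have "(\<lambda>a. fr (single a 1) 1) ` A \<subseteq> Loc (up A)"
    using A U_1 single_P by (auto intro!: LocI)
  then show "Idl\<^bsub>L\<^esub> ((\<lambda>a. fr (single a 1) 1) ` A) \<subseteq> Loc (up A)"
    by (rule L.genideal_minimal[OF ideal_Loc[OF upset_up[OF A]]])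
  interpret I: ideal "Idl\<^bsub>L\<^esub> ((\<lambda>a. fr (single a 1) 1) ` A)" L by (rule L.genideal_ideal[OF carr])
  show "Loc (up A) \<subseteq> Idl\<^bsub>L\<^esub> ((\<lambda>a. fr (single a 1) 1) ` A)"
  proof
    fix X assume "X \<in> Loc (up A)"
    then obtain f s where X: "X = fr f s" "f \<in> P" "keys f \<subseteq> up A" "s \<in> U" by (rule LocE)
    show "X \<in> Idl\<^bsub>L\<^esub> ((\<lambda>a. fr (single a 1) 1) ` A)"
      unfolding X(1)
    proof (rule fr_sum_in)
      show "fr 0 s \<in> Idl\<^bsub>L\<^esub> ((\<lambda>a. fr (single a 1) 1) ` A)"
      proof -
        have "fr 0 s = fr 0 1" using X(4) P_closed U_1 by (simp add: fr_eq_iff)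
        then show ?thesis using I.zero_closed by (simp add: zero_L)
      qed
      fix c assume "c \<in> keys f"
      then obtain a b where ab: "c = a + b" "a \<in> A" "b \<in> mon V" using X(3) unfolding up_def by blast
      have "fr (single a 1) 1 \<in> Idl\<^bsub>L\<^esub> ((\<lambda>a. fr (single a 1) 1) ` A)" using L.genideal_self[OF carr] ab(2) by blast
      from I.I_r_closed[OF this fr_carrier[OF single_P[OF ab(3)] X(4)]]
      show "fr (single c (lookup f c)) s \<in> Idl\<^bsub>L\<^esub> ((\<lambda>a. fr (single a 1) 1) ` A)"
        using ab A X(4) U_1 single_P by (auto simp: mult_fr mult_single)
    qed (use X I.a_closed in auto)
  qed
qed

text \<open>Formulated for a sequence of exponent sets so that it serves both the powers of the edge
  ideal, with \<open>N\<close>, and those of the maximal ideal, with \<open>D\<close>.\<close>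

lemma power_Loc:
  assumes "\<And>t. upset V (I t)" "I 0 = mon V" "\<And>t. {a + b | a b. a \<in> I t \<and> b \<in> I 1} = I (Suc t)"
  shows "Loc (I 1) [^]\<^bsub>ideals_set L\<^esub> t = Loc (I t)"
proof (induction t)
  case 0
  then show ?case using assms(2) Loc_mon by (simp add: nat_pow_def ideals_set_def)
next
  case (Suc t)
  have "Loc (I 1) [^]\<^bsub>ideals_set L\<^esub> Suc t = ideal_prod L (Loc (I 1) [^]\<^bsub>ideals_set L\<^esub> t) (Loc (I 1))"
    by (simp add: nat_pow_def ideals_set_def)
  also have "\<dots> = Loc (I (Suc t))" unfolding Suc ideal_prod_Loc[OF assms(1) assms(1)] assms(3) ..
  finally show ?case .
qed

end

context origin
begin

section \<open>Maximal ideal and dimension of the local ring\<close>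

definition D :: "nat \<Rightarrow> ('v \<Rightarrow>\<^sub>0 nat) set"
  where "D k = {a \<in> mon V. k \<le> deg_on V a}"

lemma upset_D: "upset V (D k)"
  unfolding upset_def D_def by (auto simp: mon_add_iff deg_on_add)

lemma D_0: "D 0 = mon V"
  unfolding D_def by simp

lemma D_1: "D 1 = mon V - {0}"
  unfolding D_def using deg_on_pos[OF finite_V] by (auto simp: Suc_le_eq)

lemma deg_on_single: "x \<in> V \<Longrightarrow> deg_on V (single x k) = k"
  unfolding deg_on_def using finite_V by (simp add: lookup_single when_def)

lemma D_Suc: "{a + b | a b. a \<in> D t \<and> b \<in> D 1} = D (Suc t)"
proof (intro equalityI subsetI)
  fix c assume c: "c \<in> D (Suc t)"
  then have "c \<in> mon V" "c \<noteq> 0" unfolding D_def by auto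
  then obtain x b where xb: "x \<in> V" "b \<in> mon V" "c = single x 1 + b" by (rule mon_split)
  then have "b \<in> D t" "single x 1 \<in> D 1"
    using c mon_single[OF xb(1)] unfolding D_def by (auto simp: deg_on_add deg_on_single)
  then show "c \<in> {a + b | a b. a \<in> D t \<and> b \<in> D 1}" using xb(3) by (auto simp: add.commute)
qed (auto simp: D_def mon_add_iff deg_on_add)

lemma power_D: "Loc (D 1) [^]\<^bsub>ideals_set L\<^esub> k = Loc (D k)"
  by (rule power_Loc[OF upset_D D_0 D_Suc])

text \<open>A fraction outside \<open>Loc (D 1)\<close> has a numerator with nonzero constant term,
  so exchanging numerator and denominator inverts it.\<close>

lemma unit_generates:
  assumes "ideal J L" "X \<in> J" "X \<notin> Loc (D 1)" shows "J = carrier L"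
proof -
  interpret J: ideal J L by fact
  obtain f s where X: "X = fr f s" "f \<in> P" "s \<in> U" using carrierE[OF J.Icarr[OF assms(2)]] .
  have "f \<in> U"
  proof (rule ccontr)
    assume "f \<notin> U"
    then have "0 \<notin> keys f" using X unfolding U_def by (simp add: in_keys_iff)
    then have "keys f \<subseteq> D 1" using X(2) unfolding D_1 P_def by blast
    then show False using LocI[OF X(2) _ X(3)] assms(3) X(1) by blast
  qed
  then have "fr f s \<otimes>\<^bsub>L\<^esub> fr s f = \<one>\<^bsub>L\<^esub>"
    using X U_P U_1 P_closed U_mult by (simp add: mult_fr one_L fr_eq_iff mult.commute)
  moreover have "fr s f \<in> carrier L" using X U_P \<open>f \<in> U\<close> by (intro fr_carrier)
  ultimately have "\<one>\<^bsub>L\<^esub> \<in> J" using J.I_r_closed[OF assms(2)[unfolded X(1)]] by metis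
  then show ?thesis by (rule J.one_imp_carrier)
qed

lemma maximal_ideal_eq: "the_maximal_ideal L = Loc (D 1)"
  unfolding the_maximal_ideal_def
proof (rule the_equality)
  have "0 \<notin> D 1" unfolding D_1 by simp
  then have "\<not> keys (1 :: ('v, 'k) mpoly) \<subseteq> D 1" by simp
  then have one: "\<one>\<^bsub>L\<^esub> \<notin> Loc (D 1)" unfolding one_L using fr_in_Loc_iff[OF upset_D] P_closed U_1 by simp
  show "maximalideal (Loc (D 1)) L"
  proof (rule maximalidealI[OF ideal_Loc[OF upset_D]])
    show "carrier L \<noteq> Loc (D 1)" using one L.one_closed by blast
    fix J assume "ideal J L" "Loc (D 1) \<subseteq> J"
    then show "J = Loc (D 1) \<or> J = carrier L" using unit_generates by blast
  qed
  fix J assume "maximalideal J L"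
  then interpret J: maximalideal J L .
  have "J \<subseteq> Loc (D 1)" using unit_generates[OF J.is_ideal] J.I_notcarr by blast
  then show "J = Loc (D 1)"
    using J.I_maximal[OF ideal_Loc[OF upset_D]] Loc_subset_carrier one L.one_closed by blast
qed

lemma contract_prime:
  assumes "primeideal Q L" shows "prime_in P {f \<in> P. fr f 1 \<in> Q}"
proof -
  interpret Q: primeideal Q L by fact
  have mult: "fr f 1 \<otimes>\<^bsub>L\<^esub> fr g 1 = fr (f * g) 1" if "f \<in> P" "g \<in> P" for f g
    using that U_1 by (simp add: mult_fr)
  have add: "fr f 1 \<oplus>\<^bsub>L\<^esub> fr g 1 = fr (f + g) 1" if "f \<in> P" "g \<in> P" for f g
    using that U_1 by (simp add: add_fr_same)
  show ?thesis
    unfolding prime_in_def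
  proof (intro conjI ballI impI)
    show "0 \<in> {f \<in> P. fr f 1 \<in> Q}" using Q.zero_closed P_closed by (simp add: zero_L)
    show "1 \<notin> {f \<in> P. fr f 1 \<in> Q}" using Q.one_imp_carrier Q.I_notcarr by (auto simp: one_L)
    show "f + g \<in> {f \<in> P. fr f 1 \<in> Q}" if "f \<in> {f \<in> P. fr f 1 \<in> Q}" "g \<in> {f \<in> P. fr f 1 \<in> Q}" for f g
      using that Q.a_closed[of "fr f 1" "fr g 1"] P_closed by (simp add: add)
    show "f * g \<in> {f \<in> P. fr f 1 \<in> Q}" if "f \<in> P" "g \<in> {f \<in> P. fr f 1 \<in> Q}" for f g
      using that Q.I_l_closed[of "fr g 1" "fr f 1"] fr_carrier[OF _ U_1] P_closed by (simp add: mult)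
    show "f \<in> {f \<in> P. fr f 1 \<in> Q} \<or> g \<in> {f \<in> P. fr f 1 \<in> Q}"
      if "f \<in> P" "g \<in> P" "f * g \<in> {f \<in> P. fr f 1 \<in> Q}" for f g
      using that Q.I_prime[of "fr f 1" "fr g 1"] fr_carrier[OF _ U_1] by (simp add: mult)
  qed blast
qed

text \<open>A fraction and its numerator differ by a unit of the local ring, so an ideal is
  determined by the polynomials it contains.\<close>

lemma contract_strict:
  assumes "primeideal Q L" "primeideal Q' L" "Q \<subset> Q'"
  shows "{f \<in> P. fr f 1 \<in> Q} \<subset> {f \<in> P. fr f 1 \<in> Q'}"
proof
  interpret Q: primeideal Q L by fact
  interpret Q': primeideal Q' L by fact
  obtain X where X: "X \<in> Q'" "X \<notin> Q" using assms(3) by blast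
  obtain f s where f: "X = fr f s" "f \<in> P" "s \<in> U" using carrierE[OF Q'.Icarr[OF X(1)]] .
  have "fr f s \<otimes>\<^bsub>L\<^esub> fr s 1 = fr f 1" "fr f 1 \<otimes>\<^bsub>L\<^esub> fr 1 s = fr f s"
    using f U_1 U_P P_closed U_mult by (simp_all add: mult_fr fr_eq_iff mult.commute)
  moreover have "fr s 1 \<in> carrier L" "fr 1 s \<in> carrier L" using f U_1 U_P P_closed by (auto intro: fr_carrier)
  ultimately have "fr f 1 \<in> Q'" "fr f 1 \<notin> Q"
    using Q'.I_r_closed[of X "fr s 1"] Q.I_r_closed[of "fr f 1" "fr 1 s"] X f(1) by auto
  then show "{f \<in> P. fr f 1 \<in> Q} \<noteq> {f \<in> P. fr f 1 \<in> Q'}" using f(2) by blast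
qed (use assms(3) in blast)

text \<open>This is the ideal generated by the variables in \<open>W\<close>; it is prime because
  monomials free of \<open>W\<close> are closed under products.\<close>

lemma coordinate_prime:
  assumes "W \<subseteq> V"
  shows "upset V {a \<in> mon V. keys a \<inter> W \<noteq> {}}" "primeideal (Loc {a \<in> mon V. keys a \<inter> W \<noteq> {}}) L"
proof -
  let ?I = "{a \<in> mon V. keys a \<inter> W \<noteq> {}}"
  show up: "upset V ?I" unfolding upset_def by (auto simp: mon_add_iff keys_add_nat)
  show "primeideal (Loc ?I) L"
  proof (rule primeidealI[OF ideal_Loc[OF up] cring_L])
    have "fr 1 1 \<notin> Loc ?I" using fr_in_Loc_iff[OF up P_closed(3) U_1] by simp
    then show "carrier L \<noteq> Loc ?I" using fr_carrier[OF P_closed(3) U_1] by blast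
    fix X Y assume "X \<in> carrier L" "Y \<in> carrier L" and XY: "X \<otimes>\<^bsub>L\<^esub> Y \<in> Loc ?I"
    then obtain f s g t where *: "X = fr f s" "f \<in> P" "s \<in> U" "Y = fr g t" "g \<in> P" "t \<in> U"
      by (elim carrierE)
    then have fg: "keys (f * g) \<subseteq> ?I"
      using XY fr_in_Loc_iff[OF up P_closed(5) U_mult] by (simp add: mult_fr)
    have "keys f \<subseteq> ?I \<or> keys g \<subseteq> ?I"
    proof (rule support_in_prime_complement[OF _ _ fg])
      show "keys f \<subseteq> mon V" "keys g \<subseteq> mon V" using * unfolding P_def by auto
      show "a + b \<in> ?I" if "a \<in> ?I" "b \<in> mon V" for a b using up that unfolding upset_def by blast
      show "a + b \<notin> ?I" if "a \<in> mon V - ?I" "b \<in> mon V - ?I" for a b using that by (auto simp: keys_add_nat)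
    qed
    then show "X \<in> Loc ?I \<or> Y \<in> Loc ?I" using * LocI by blast
  qed
qed

text \<open>Contraction carries chains of primes to the polynomial ring, where their length is
  bounded; adjoining one variable at a time gives a chain of coordinate primes that attains the
  bound.\<close>

theorem krull_dim_L: "krull_dim L = enat (card V)"
proof (rule antisym)
  show "krull_dim L \<le> enat (card V)"
  proof (rule krull_dim_leI)
    fix Qs assume Qs: "\<forall>Q\<in>set Qs. primeideal Q L" "sorted_wrt (\<subset>) Qs"
    let ?c = "\<lambda>Q. {f \<in> P. fr f 1 \<in> Q}"
    have "sorted_wrt (\<lambda>Q Q'. ?c Q \<subset> ?c Q') Qs"
      using Qs(2) by (rule sorted_wrt_mono_rel[rotated]) (use Qs(1) contract_strict in blast)
    then have "sorted_wrt (\<subset>) (map ?c Qs)" by (simp only: sorted_wrt_map)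
    moreover have "\<forall>Q\<in>set (map ?c Qs). prime_in P Q" using Qs(1) contract_prime by auto
    ultimately have "length (map ?c Qs) \<le> Suc (card V)"
      by (intro prime_chain_length[OF finite_V subalg_P]) (auto simp: P_def)
    then show "length Qs \<le> Suc (card V)" by simp
  qed
  obtain xs where xs: "set xs = V" "distinct xs" using finite_distinct_list[OF finite_V] by blast
  \<comment> \<open>The exponents of the ideal generated by the first \<open>i\<close> variables;
    \<open>i = 0\<close> gives the zero ideal, so there are \<open>card V + 1\<close>
    primes.\<close>
  define I where "I i = {a \<in> mon V. keys a \<inter> set (take i xs) \<noteq> {}}" for i
  have W: "set (take i xs) \<subseteq> V" for i using xs(1) set_take_subset by fast
  show "enat (card V) \<le> krull_dim L"
  proof (rule krull_dim_geI)
    show "\<forall>Q\<in>set (map (\<lambda>i. Loc (I i)) [0..<Suc (card V)]). primeideal Q L"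
      unfolding I_def using coordinate_prime(2)[OF W] by simp
    show "sorted_wrt (\<subset>) (map (\<lambda>i. Loc (I i)) [0..<Suc (card V)])"
      unfolding sorted_wrt_iff_nth_less
    proof (intro allI impI)
      fix i j assume ij: "i < j" "j < length (map (\<lambda>i. Loc (I i)) [0..<Suc (card V)])"
      have sub: "set (take i xs) \<subseteq> set (take j xs)" using ij(1) by (simp add: set_take_subset_set_take)
      have len: "i < length xs" using ij distinct_card[OF xs(2)] xs(1) by auto
      have xi: "xs ! i \<in> set (take j xs)" using ij(1) len by (auto simp: in_set_conv_nth intro!: exI[of _ i])
      have "xs ! i \<notin> set (take i xs)"
      proof
        assume "xs ! i \<in> set (take i xs)"
        then obtain l where "l < i" "l < length xs" "xs ! l = xs ! i" by (auto simp: in_set_conv_nth)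
        then show False using nth_eq_iff_index_eq[OF xs(2), of l i] len by simp
      qed
      moreover have xV: "xs ! i \<in> V" using W xi by blast
      ultimately have mem: "single (xs ! i) 1 \<in> I j" "single (xs ! i) 1 \<notin> I i"
        using xi mon_single[OF xV] unfolding I_def by auto
      have "fr (single (single (xs ! i) 1) 1) 1 \<in> Loc (I j)"
        using mem(1) single_P[OF mon_single[OF xV]] U_1 by (intro LocI) auto
      moreover have "fr (single (single (xs ! i) 1) 1) 1 \<notin> Loc (I i)"
        using mem(2) single_P[OF mon_single[OF xV]] U_1 fr_in_Loc_iff[OF coordinate_prime(1)[OF W[of i]]]
        unfolding I_def by simp
      moreover have "I i \<subseteq> I j" unfolding I_def using sub by blast
      then have "Loc (I i) \<subseteq> Loc (I j)" unfolding Loc_def by blast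
      ultimately have "Loc (I i) \<subset> Loc (I j)" by blast
      then show "map (\<lambda>i. Loc (I i)) [0..<Suc (card V)] ! i \<subset> map (\<lambda>i. Loc (I i)) [0..<Suc (card V)] ! j"
        using ij by (simp del: upt_Suc)
    qed
  qed simp
qed

text \<open>A truncated geometric series: with \<open>c\<close> the constant term of
  \<open>s\<close>, the polynomial u = 1 - s/c has no constant term, and s/c times the sum of the
  u^i for i < k is 1 - u^k.\<close>

lemma inverse_mod_power:
  assumes "s \<in> U"
  shows "\<exists>h\<in>P. keys (1 - s * h) \<subseteq> D k"
proof -
  define c where "c = lookup s 0"
  define u where "u = 1 - const (1 / c) * s"
  have c: "c \<noteq> 0" using assms unfolding c_def U_def by simp
  have uP: "u \<in> P" unfolding u_def using P_closed U_P[OF assms] by (intro P_diff) auto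
  have "lookup u 0 = 0" unfolding u_def const_eq using c by (simp add: lookup_minus lookup_const_mult c_def)
  then have uD: "keys u \<subseteq> D 1" using uP unfolding D_1 P_def by (auto simp: in_keys_iff)
  have pow: "keys (u ^ i) \<subseteq> D i" for i
  proof (induction i)
    case (Suc i)
    have "keys (u * u ^ i) \<subseteq> {a + b | a b. a \<in> D i \<and> b \<in> D 1}"
      using uD Suc by (intro keys_mult_subset) (blast intro: add.commute)
    then show ?case unfolding D_Suc by simp
  qed (simp add: D_0)
  define h where "h = const (1 / c) * (\<Sum>i<k. u ^ i)"
  have "h \<in> P" unfolding h_def using P_closed subalg_P uP by (intro P_closed subalg_sum subalg_power)
  moreover have "1 - s * h = u ^ k"
  proof -
    have "s * h = (1 - u) * (\<Sum>i<k. u ^ i)" unfolding h_def u_def by (simp add: mult_ac)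
    also have "\<dots> = 1 - u ^ k" by (rule one_diff_power_eq[symmetric])
    finally show ?thesis by simp
  qed
  ultimately show ?thesis using pow[of k] by (intro bexI[of _ h]) simp_all
qed

end

section \<open>Length of the zeroth local cohomology of a monomial quotient\<close>

text \<open>Dimensions rise strictly along the chain and cannot exceed the number of monomials
  available.\<close>

lemma subspace_chain_length:
  fixes Ss :: "('v, 'k::field) mpoly set list"
  assumes B: "finite B" and "\<forall>S\<in>set Ss. mpoly.subspace S \<and> S \<subseteq> {p. keys p \<subseteq> B}" "sorted_wrt (\<subset>) Ss"
  shows "length Ss \<le> Suc (card B)"
proof -
  let ?M = "(\<lambda>a. single a 1) ` B :: ('v, 'k) mpoly set"
  have dim_less: "mpoly.dim S < mpoly.dim T"
    if ST: "mpoly.subspace S" "mpoly.subspace T" "S \<subset> T" "T \<subseteq> {p. keys p \<subseteq> B}" for S T :: "('v, 'k) mpoly set"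
  proof -
    obtain C where C: "C \<subseteq> S" "mpoly.independent C" "S \<subseteq> mpoly.span C" "card C = mpoly.dim S"
      using mpoly.basis_exists by metis
    obtain C' where C': "C' \<subseteq> T" "mpoly.independent C'" "T \<subseteq> mpoly.span C'" "card C' = mpoly.dim T"
      using mpoly.basis_exists by metis
    have finM: "finite ?M" using B by simp
    have "C \<subseteq> mpoly.span ?M" "C' \<subseteq> mpoly.span ?M" unfolding span_monomials using C(1) C'(1) ST by auto
    then have fin: "finite C" "finite C'"
      using mpoly.independent_span_bound[OF finM] C(2) C'(2) by blast+
    obtain x where x: "x \<in> T" "x \<notin> S" using ST(3) by blast
    have "mpoly.span C \<subseteq> S" using C(1) ST(1) by (rule mpoly.span_minimal)
    then have xC: "x \<notin> mpoly.span C" using x(2) by blast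
    then have "mpoly.independent (insert x C)" using C(2) by (rule mpoly.independent_insertI)
    moreover have "insert x C \<subseteq> mpoly.span C'" using x C(1) ST(3) C'(3) by blast
    ultimately have "card (insert x C) \<le> card C'" using mpoly.independent_span_bound[OF fin(2)] by blast
    moreover have "x \<notin> C" using xC mpoly.span_base by blast
    ultimately show ?thesis using fin C(4) C'(4) by simp
  qed
  have "Ss \<noteq> [] \<Longrightarrow> length Ss \<le> Suc (mpoly.dim (last Ss))" using assms(2,3)
  proof (induction Ss rule: rev_induct)
    case (snoc T Ss)
    show ?case
    proof (cases "Ss = []")
      case False
      then have "length Ss \<le> Suc (mpoly.dim (last Ss))" using snoc by (simp add: sorted_wrt_append)
      moreover have "mpoly.dim (last Ss) < mpoly.dim T"
        using snoc.prems last_in_set[OF False] by (intro dim_less) (auto simp: sorted_wrt_append)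
      ultimately show ?thesis by simp
    qed simp
  qed simp
  moreover have "mpoly.dim (last Ss) \<le> card B" if "Ss \<noteq> []"
  proof -
    have "last Ss \<subseteq> mpoly.span ?M" unfolding span_monomials using assms(2) last_in_set[OF that] by blast
    then have "mpoly.dim (last Ss) \<le> card ?M" using B by (intro mpoly.dim_le_card) auto
    also have "\<dots> \<le> card B" using B by (rule card_image_le)
    finally show ?thesis .
  qed
  ultimately show ?thesis by (cases "Ss = []") auto
qed

text \<open>To be used with two consecutive powers of the edge ideal: \<open>I\<close> is
  \<open>N t\<close>, \<open>I'\<close> is \<open>N (Suc t)\<close>, and the finite set is
  \<open>M t\<close>.\<close>

locale origin_quotient = origin K V for K :: "'k::field itself" and V :: "'v set" +
  fixes I I' :: "('v \<Rightarrow>\<^sub>0 nat) set"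
  assumes upset_I: "upset V I" and upset_I': "upset V I'" and I'_subset: "I' \<subseteq> I"
    and finite_T: "finite {a \<in> I. a \<notin> I' \<and> (\<forall>x\<in>V. \<exists>k. a + single x k \<in> I')}"
begin

definition T :: "('v \<Rightarrow>\<^sub>0 nat) set"
  where "T = {a \<in> I. a \<notin> I' \<and> (\<forall>x\<in>V. \<exists>k. a + single x k \<in> I')}"

definition cos :: "(('v, 'k) mpoly \<times> ('v, 'k) mpoly) set \<Rightarrow> (('v, 'k) mpoly \<times> ('v, 'k) mpoly) set set"
  where "cos X = Loc I' +>\<^bsub>L\<^esub> X"

definition Q where "Q = quotient_module (ideal_module L (Loc I)) (Loc I')"

definition Gam where "Gam = local_cohomology0 L (the_maximal_ideal L) Q"

text \<open>On polynomials supported in \<open>T\<close> this turns out to be an additive bijection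
  onto the zeroth local cohomology.\<close>

definition \<psi> :: "('v, 'k) mpoly \<Rightarrow> (('v, 'k) mpoly \<times> ('v, 'k) mpoly) set set"
  where "\<psi> p = cos (fr p 1)"

sublocale J': ideal "Loc I'" L by (rule ideal_Loc[OF upset_I'])

lemma coset_eq: "Loc I' +>\<^bsub>ideal_module L (Loc I)\<^esub> X = cos X"
  unfolding cos_def a_r_coset_def' ideal_module_def by simp

lemma carrier_Q: "carrier Q = cos ` Loc I"
  unfolding Q_def quotient_module_def A_RCOSETS_def' a_r_coset_def'[symmetric] coset_eq
  by (auto simp: ideal_module_def)

lemma zero_Q: "\<zero>\<^bsub>Q\<^esub> = Loc I'"
  unfolding Q_def quotient_module_def by simp

lemma add_Q: "X \<in> carrier L \<Longrightarrow> Y \<in> carrier L \<Longrightarrow> cos X \<oplus>\<^bsub>Q\<^esub> cos Y = cos (X \<oplus>\<^bsub>L\<^esub> Y)"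
  using J'.a_rcos_sum[of X Y]
  unfolding Q_def quotient_module_def cos_def set_add_def' ideal_module_def by simp

lemma cos_eq_iff:
  assumes "f \<in> P" "s \<in> U" "g \<in> P" "t \<in> U"
  shows "cos (fr f s) = cos (fr g t) \<longleftrightarrow> keys (t * f - s * g) \<subseteq> I'"
proof -
  have "fr f s \<ominus>\<^bsub>L\<^esub> fr g t = fr (t * f - s * g) (s * t)"
    unfolding a_minus_def using assms P_closed by (simp add: a_inv_fr add_fr)
  moreover have "t * f - s * g \<in> P" using assms P_closed U_P by (intro P_diff) auto
  ultimately have "fr f s \<ominus>\<^bsub>L\<^esub> fr g t \<in> Loc I' \<longleftrightarrow> keys (t * f - s * g) \<subseteq> I'"
    using fr_in_Loc_iff[OF upset_I'] U_mult assms by simp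
  then show ?thesis
    unfolding cos_def using L.quotient_eq_iff_same_a_r_cos[OF J'.is_ideal fr_carrier fr_carrier] assms by simp
qed

lemma cos_zero_iff: "f \<in> P \<Longrightarrow> s \<in> U \<Longrightarrow> cos (fr f s) = Loc I' \<longleftrightarrow> keys f \<subseteq> I'"
proof -
  assume f: "f \<in> P" "s \<in> U"
  have "cos (fr 0 1) = Loc I'"
    unfolding cos_def zero_L[symmetric] by (rule J'.a_rcos_const[OF J'.zero_closed])
  then show ?thesis using cos_eq_iff[OF f P_closed(2) U_1] by simp
qed

lemma smult_Q:
  assumes "A \<in> carrier L" "X \<in> carrier L"
  shows "A \<odot>\<^bsub>Q\<^esub> cos X = cos (A \<otimes>\<^bsub>L\<^esub> X)"
proof -
  have "A \<odot>\<^bsub>Q\<^esub> cos X = (\<Union>Y\<in>cos X. cos (A \<otimes>\<^bsub>L\<^esub> Y))"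
    unfolding Q_def quotient_module_def by (simp add: coset_eq) (simp add: ideal_module_def)
  also have "\<dots> = (\<Union>Y\<in>cos X. cos (A \<otimes>\<^bsub>L\<^esub> X))"
  proof (intro SUP_cong refl)
    fix Y assume "Y \<in> cos X"
    then obtain h where h: "h \<in> Loc I'" "Y = h \<oplus>\<^bsub>L\<^esub> X" unfolding cos_def a_r_coset_def' by blast
    have "A \<otimes>\<^bsub>L\<^esub> Y = A \<otimes>\<^bsub>L\<^esub> h \<oplus>\<^bsub>L\<^esub> A \<otimes>\<^bsub>L\<^esub> X"
      unfolding h(2) using assms J'.Icarr[OF h(1)] by (simp add: L.r_distr)
    moreover have "A \<otimes>\<^bsub>L\<^esub> h \<in> Loc I'" using J'.I_l_closed[OF h(1) assms(1)] .
    ultimately have "A \<otimes>\<^bsub>L\<^esub> Y \<in> Loc I' +>\<^bsub>L\<^esub> (A \<otimes>\<^bsub>L\<^esub> X)" unfolding a_r_coset_def' by blast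
    then show "cos (A \<otimes>\<^bsub>L\<^esub> Y) = cos (A \<otimes>\<^bsub>L\<^esub> X)"
      unfolding cos_def using L.a_repr_independence[OF _ _ J'.a_subgroup] assms by (metis L.m_closed)
  qed
  also have "\<dots> = cos (A \<otimes>\<^bsub>L\<^esub> X)"
    using J'.a_rcos_self[OF assms(2)] unfolding cos_def by blast
  finally show ?thesis .
qed

lemma T_subset: "T \<subseteq> mon V" "T \<subseteq> I"
  using upset_I unfolding T_def upset_def by auto

text \<open>Pigeonhole: a vector whose degree exceeds the sum of the exponents needed for the single
  variables contains one of these powers.\<close>

lemma killed_monomials:
  "\<exists>k. \<forall>a\<in>T \<union> I'. \<forall>d\<in>D k. a + d \<in> I'"
proof -
  have "\<exists>k. \<forall>d\<in>D k. a + d \<in> I'" if a: "a \<in> T" for a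
  proof -
    have "\<forall>x\<in>V. \<exists>k. a + single x k \<in> I'" using a unfolding T_def by blast
    then obtain k where k: "\<And>x. x \<in> V \<Longrightarrow> a + single x (k x) \<in> I'" by (elim bchoice[elim_format] exE) blast
    have "a + d \<in> I'" if d: "d \<in> D (Suc (sum k V))" for d
    proof -
      have "sum k V < deg_on V d" using d unfolding D_def by simp
      then obtain x where x: "x \<in> V" "k x \<le> lookup d x"
        unfolding deg_on_def using sum_mono[of V "lookup d" k] by (meson leD linear)
      have "lookup (single x (k x)) y \<le> lookup d y" for y
        using x by (cases "y = x") (simp_all add: lookup_single)
      then obtain b where b: "d = single x (k x) + b" by (rule monomial_le_imp_add)
      have "b \<in> mon V" using d unfolding D_def b by (simp add: mon_add_iff)
      then have "a + single x (k x) + b \<in> I'" using k[OF x(1)] upset_I' unfolding upset_def by blast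
      then show ?thesis unfolding b by (simp add: add.assoc)
    qed
    then show ?thesis by blast
  qed
  then obtain k where k: "\<And>a d. a \<in> T \<Longrightarrow> d \<in> D (k a) \<Longrightarrow> a + d \<in> I'" by metis
  \<comment> \<open>Since \<open>T\<close> is finite, the sum of the individual bounds is one bound
    for all its elements.\<close>
  have "a + d \<in> I'" if a: "a \<in> T \<union> I'" and d: "d \<in> D (sum k T)" for a d
  proof (cases "a \<in> T")
    case True
    then have "k a \<le> sum k T" using finite_T by (intro member_le_sum) (auto simp: T_def)
    then show ?thesis using k[OF True] d unfolding D_def by auto
  next
    case False
    then show ?thesis using a d upset_I' unfolding upset_def D_def by blast
  qed
  then show ?thesis by blast
qed

lemma upset_T: "upset V (T \<union> I')"
  unfolding upset_def
proof (intro conjI ballI)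
  show "T \<union> I' \<subseteq> mon V" using T_subset upset_I' unfolding upset_def by blast
  fix a b assume ab: "a \<in> T \<union> I'" "b \<in> mon V"
  show "a + b \<in> T \<union> I'"
  proof (cases "a + b \<in> I'")
    case False
    then have a: "a \<in> T" using ab upset_I' unfolding upset_def by blast
    have "\<exists>k. a + b + single x k \<in> I'" if x: "x \<in> V" for x
    proof -
      obtain k where "a + single x k \<in> I'" using a x unfolding T_def by blast
      then have "a + single x k + b \<in> I'" using ab upset_I' unfolding upset_def by blast
      moreover have "a + single x k + b = a + b + single x k" by (simp only: add_ac)
      ultimately show ?thesis by metis
    qed
    moreover have "a + b \<in> I" using a ab(2) upset_I T_subset unfolding upset_def by blast
    ultimately show ?thesis using False unfolding T_def by blast
  qed simp
qed

text \<open>Being killed by a power of the maximal ideal can be tested on powers of single variables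
  for necessity, while the uniform exponent of \<open>killed_monomials\<close> gives
  sufficiency.\<close>

lemma mem_Gam:
  assumes f: "f \<in> P" "keys f \<subseteq> I" "s \<in> U"
  shows "cos (fr f s) \<in> carrier Gam \<longleftrightarrow> keys f \<subseteq> T \<union> I'"
proof -
  have "cos (fr f s) \<in> carrier Gam \<longleftrightarrow> (\<exists>k. \<forall>A\<in>Loc (D k). A \<odot>\<^bsub>Q\<^esub> cos (fr f s) = Loc I')"
    unfolding Gam_def local_cohomology0_def maximal_ideal_eq power_D zero_Q
    using carrier_Q LocI[OF f] by auto
  also have "\<dots> \<longleftrightarrow> keys f \<subseteq> T \<union> I'"
  proof
    assume "\<exists>k. \<forall>A\<in>Loc (D k). A \<odot>\<^bsub>Q\<^esub> cos (fr f s) = Loc I'"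
    then obtain k where k: "\<And>A. A \<in> Loc (D k) \<Longrightarrow> A \<odot>\<^bsub>Q\<^esub> cos (fr f s) = Loc I'" by blast
    have kill: "a + single x k \<in> I'" if a: "a \<in> keys f" and x: "x \<in> V" for a x
    proof -
      let ?m = "single (single x k) (1::'k)"
      have "single x k \<in> D k" using mon_single[OF x] deg_on_single[OF x] unfolding D_def by simp
      then have mP: "?m \<in> P" and m: "fr ?m 1 \<in> Loc (D k)"
        using single_P U_1 unfolding D_def by (auto intro!: LocI)
      have "cos (fr (?m * f) s) = Loc I'"
        using k[OF m] smult_Q[OF fr_carrier[OF mP U_1] fr_carrier[OF f(1,3)]] mult_fr[OF mP U_1 f(1,3)] by simp
      then have "keys (?m * f) \<subseteq> I'" using cos_zero_iff P_closed(5)[OF mP f(1)] f(3) by blast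
      \<comment> \<open>Multiplication by a monomial translates the support injectively, so no other
        term contributes to this coefficient.\<close>
      moreover have "lookup (?m * f) (single x k + a) = lookup f a"
      proof -
        have "f = single a (lookup f a) + restr (- {a}) f"
          by (rule poly_mapping_eqI) (simp add: lookup_add lookup_restr lookup_single when_def)
        then have "?m * f = ?m * (single a (lookup f a) + restr (- {a}) f)" by (rule arg_cong)
        also have "\<dots> = single (single x k + a) (lookup f a) + ?m * restr (- {a}) f"
          unfolding distrib_left mult_single mult_1 ..
        finally have "?m * f = single (single x k + a) (lookup f a) + ?m * restr (- {a}) f" .
        moreover have "single x k + a \<notin> keys (?m * restr (- {a}) f)"
        proof
          assume "single x k + a \<in> keys (?m * restr (- {a}) f)"
          then obtain b c where "b \<in> keys ?m" "c \<in> keys (restr (- {a}) f)" "single x k + a = b + c"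
            using keys_mult by blast
          then show False by (simp add: keys_restr)
        qed
        ultimately show ?thesis by (simp add: lookup_add in_keys_iff)
      qed
      ultimately have "single x k + a \<in> I'" using a by (auto simp: in_keys_iff)
      then show ?thesis by (simp only: add.commute)
    qed
    show "keys f \<subseteq> T \<union> I'"
    proof
      fix a assume a: "a \<in> keys f"
      then show "a \<in> T \<union> I'" using kill[OF a] f(2) unfolding T_def by blast
    qed
  next
    assume fT: "keys f \<subseteq> T \<union> I'"
    obtain k where k: "\<And>a d. a \<in> T \<union> I' \<Longrightarrow> d \<in> D k \<Longrightarrow> a + d \<in> I'" using killed_monomials by blast
    have "A \<odot>\<^bsub>Q\<^esub> cos (fr f s) = Loc I'" if A: "A \<in> Loc (D k)" for A
    proof -
      obtain g t where g: "A = fr g t" "g \<in> P" "keys g \<subseteq> D k" "t \<in> U" using A by (rule LocE)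
      have "keys (g * f) \<subseteq> I'"
      proof (rule keys_mult_subset)
        fix d a assume "d \<in> keys g" "a \<in> keys f"
        then have "a + d \<in> I'" using k fT g(3) by blast
        then show "d + a \<in> I'" by (simp only: add.commute)
      qed
      then show ?thesis
        using g f P_closed U_mult by (simp add: smult_Q fr_carrier mult_fr cos_zero_iff)
    qed
    then show "\<exists>k. \<forall>A\<in>Loc (D k). A \<odot>\<^bsub>Q\<^esub> cos (fr f s) = Loc I'" by blast
  qed
  finally show ?thesis .
qed

lemma T_P: "keys p \<subseteq> T \<Longrightarrow> p \<in> P"
  unfolding P_def using T_subset by blast

text \<open>Every fraction is congruent to a polynomial supported on \<open>T\<close>, since denominators are
  invertible modulo a power of the maximal ideal killing everything.\<close>

lemma reduce_fraction:
  assumes g: "g \<in> P" "keys g \<subseteq> T \<union> I'" "s \<in> U"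
  obtains h where "h \<in> P" "cos (fr g s) = \<psi> (restr T (g * h))"
proof -
  obtain k where k: "\<And>a d. a \<in> T \<union> I' \<Longrightarrow> d \<in> D k \<Longrightarrow> a + d \<in> I'" using killed_monomials by blast
  obtain h where h: "h \<in> P" "keys (1 - s * h) \<subseteq> D k" using inverse_mod_power[OF g(3)] by blast
  have gh: "keys (g * h) \<subseteq> T \<union> I'"
    using h(1) g(2) unfolding P_def by (intro keys_mult_upset(2)[OF upset_T]) auto
  let ?p = "restr T (g * h)"
  let ?q = "restr (- T) (g * h)"
  have "keys ?p \<subseteq> T" "keys ?q \<subseteq> I'" using gh by (auto simp: keys_restr)
  have "1 * g - s * ?p = g * (1 - s * h) + s * ?q"
  proof -
    have "s * (g * h) = s * ?p + s * ?q" using restr_split[of "g * h" T] by (metis distrib_left)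
    then show ?thesis by (simp add: algebra_simps)
  qed
  moreover have "keys (g * (1 - s * h)) \<subseteq> I'"
    using k g(2) h(2) by (intro keys_mult_subset) blast
  moreover have "keys (s * ?q) \<subseteq> I'"
    using U_P[OF g(3)] \<open>keys ?q \<subseteq> I'\<close> unfolding P_def by (intro keys_mult_upset(1)[OF upset_I']) auto
  ultimately have "keys (1 * g - s * ?p) \<subseteq> I'" using keys_add_subset by metis
  then have "cos (fr g s) = \<psi> ?p"
    unfolding \<psi>_def using cos_eq_iff[OF g(1,3) T_P[OF \<open>keys ?p \<subseteq> T\<close>] U_1] by simp
  then show thesis using that h(1) by blast
qed

lemma carrier_Gam: "carrier Gam = \<psi> ` {p. keys p \<subseteq> T}"
proof (intro equalityI subsetI)
  fix Y assume Y: "Y \<in> carrier Gam"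
  then have "Y \<in> cos ` Loc I" unfolding Gam_def local_cohomology0_def using carrier_Q by auto
  then obtain g s where g: "Y = cos (fr g s)" "g \<in> P" "keys g \<subseteq> I" "s \<in> U" by (auto elim: LocE)
  then have "keys g \<subseteq> T \<union> I'" using mem_Gam Y by blast
  then obtain h where "Y = \<psi> (restr T (g * h))" using reduce_fraction g by metis
  moreover have "keys (restr T (g * h)) \<subseteq> T" by (simp add: keys_restr)
  ultimately show "Y \<in> \<psi> ` {p. keys p \<subseteq> T}" by blast
next
  fix Y assume "Y \<in> \<psi> ` {p. keys p \<subseteq> T}"
  then obtain p where p: "Y = \<psi> p" "keys p \<subseteq> T" by blast
  then show "Y \<in> carrier Gam"
    unfolding p(1) \<psi>_def using mem_Gam[OF T_P _ U_1] T_subset by blast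
qed

lemma add_Gam: "p \<in> P \<Longrightarrow> q \<in> P \<Longrightarrow> \<psi> p \<oplus>\<^bsub>Gam\<^esub> \<psi> q = \<psi> (p + q)"
proof -
  assume pq: "p \<in> P" "q \<in> P"
  have "\<psi> p \<oplus>\<^bsub>Gam\<^esub> \<psi> q = \<psi> p \<oplus>\<^bsub>Q\<^esub> \<psi> q" unfolding Gam_def local_cohomology0_def by simp
  then show ?thesis unfolding \<psi>_def using pq U_1 by (simp add: add_Q fr_carrier add_fr_same)
qed

lemma zero_Gam: "\<zero>\<^bsub>Gam\<^esub> = \<psi> 0"
proof -
  have "\<zero>\<^bsub>Gam\<^esub> = Loc I'" unfolding Gam_def local_cohomology0_def using zero_Q by simp
  then show ?thesis unfolding \<psi>_def using cos_zero_iff[OF P_closed(2) U_1] by simp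
qed

lemma smult_Gam: "b \<in> P \<Longrightarrow> t \<in> U \<Longrightarrow> p \<in> P \<Longrightarrow> fr b t \<odot>\<^bsub>Gam\<^esub> \<psi> p = cos (fr (b * p) t)"
proof -
  assume bp: "b \<in> P" "t \<in> U" "p \<in> P"
  have "fr b t \<odot>\<^bsub>Gam\<^esub> \<psi> p = fr b t \<odot>\<^bsub>Q\<^esub> \<psi> p" unfolding Gam_def local_cohomology0_def by simp
  then show ?thesis unfolding \<psi>_def using bp U_1 by (simp add: smult_Q fr_carrier mult_fr)
qed

text \<open>If two images agree, the difference is supported both in \<open>T\<close> and in
  \<open>I'\<close>, which are disjoint.\<close>

lemma inj_\<psi>: "inj_on \<psi> {p. keys p \<subseteq> T}"
proof (rule inj_onI)
  fix p q assume pq: "p \<in> {p. keys p \<subseteq> T}" "q \<in> {p. keys p \<subseteq> T}" "\<psi> p = \<psi> q"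
  have "keys (p - q) \<subseteq> I'"
    using pq cos_eq_iff[OF T_P U_1 T_P U_1, of p q] unfolding \<psi>_def by simp
  moreover have "keys (p - q) \<subseteq> T"
  proof
    fix a assume "a \<in> keys (p - q)"
    then have "a \<in> keys p \<or> a \<in> keys q" by (auto simp: in_keys_iff lookup_minus)
    then show "a \<in> T" using pq by blast
  qed
  moreover have "T \<inter> I' = {}" unfolding T_def by blast
  ultimately have "keys (p - q) = {}" by blast
  then show "p = q" by simp
qed

lemma abelian_group_Gam: "abelian_group Gam"
proof (rule abelian_groupI)
  have sum: "keys (p + q) \<subseteq> T" if "keys p \<subseteq> T" "keys q \<subseteq> T" for p q :: "('v, 'k) mpoly"
    using that by (rule keys_add_subset)
  fix X Y assume "X \<in> carrier Gam" "Y \<in> carrier Gam"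
  then obtain p q where pq: "X = \<psi> p" "Y = \<psi> q" "keys p \<subseteq> T" "keys q \<subseteq> T" unfolding carrier_Gam by blast
  then show "X \<oplus>\<^bsub>Gam\<^esub> Y \<in> carrier Gam" "X \<oplus>\<^bsub>Gam\<^esub> Y = Y \<oplus>\<^bsub>Gam\<^esub> X"
    using T_P sum unfolding carrier_Gam by (auto simp: add_Gam add.commute)
  fix Z assume "Z \<in> carrier Gam"
  then obtain r where r: "Z = \<psi> r" "keys r \<subseteq> T" unfolding carrier_Gam by blast
  then show "X \<oplus>\<^bsub>Gam\<^esub> Y \<oplus>\<^bsub>Gam\<^esub> Z = X \<oplus>\<^bsub>Gam\<^esub> (Y \<oplus>\<^bsub>Gam\<^esub> Z)"
    using pq T_P P_closed by (simp add: add_Gam add.assoc)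
next
  show "\<zero>\<^bsub>Gam\<^esub> \<in> carrier Gam" unfolding zero_Gam carrier_Gam by simp
  fix X assume "X \<in> carrier Gam"
  then obtain p where p: "X = \<psi> p" "keys p \<subseteq> T" unfolding carrier_Gam by blast
  then show "\<zero>\<^bsub>Gam\<^esub> \<oplus>\<^bsub>Gam\<^esub> X = X" unfolding zero_Gam using T_P P_closed by (simp add: add_Gam)
  have m: "keys (- p) \<subseteq> T" using p(2) by (auto simp: in_keys_iff subset_iff)
  show "\<exists>Y\<in>carrier Gam. Y \<oplus>\<^bsub>Gam\<^esub> X = \<zero>\<^bsub>Gam\<^esub>"
  proof
    show "\<psi> (- p) \<in> carrier Gam" unfolding carrier_Gam using m by blast
    show "\<psi> (- p) \<oplus>\<^bsub>Gam\<^esub> X = \<zero>\<^bsub>Gam\<^esub>" unfolding zero_Gam p(1) using T_P m p(2) by (simp add: add_Gam)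
  qed
qed

text \<open>Reduction replaces multiplication by a fraction by multiplication with a polynomial
  followed by restriction to \<open>T\<close>. Exponents then move only upwards, and those that stay
  in \<open>T\<close> remain in \<open>S\<close>.\<close>

lemma submodule_closed_subset:
  assumes S: "S \<subseteq> T" and closed: "\<And>a c. a \<in> S \<Longrightarrow> c \<in> mon V \<Longrightarrow> a + c \<in> T \<Longrightarrow> a + c \<in> S"
  shows "submodule (\<psi> ` {p. keys p \<subseteq> S}) L Gam"
proof -
  interpret G: abelian_group Gam by (rule abelian_group_Gam)
  have SP: "p \<in> P" if "keys p \<subseteq> S" for p using that S T_P by blast
  show ?thesis
  proof (intro submodule.intro subgroup.intro submodule_axioms.intro)
    show sub: "\<psi> ` {p. keys p \<subseteq> S} \<subseteq> carrier (add_monoid Gam)" using S by (auto simp: carrier_Gam)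
    show "\<one>\<^bsub>add_monoid Gam\<^esub> \<in> \<psi> ` {p. keys p \<subseteq> S}" by (simp add: zero_Gam)
    fix X assume "X \<in> \<psi> ` {p. keys p \<subseteq> S}"
    then obtain p where p: "X = \<psi> p" "keys p \<subseteq> S" by blast
    have m: "keys (- p) \<subseteq> S" using p(2) by (auto simp: in_keys_iff subset_iff)
    have "\<ominus>\<^bsub>Gam\<^esub> X = \<psi> (- p)"
    proof (rule G.minus_equality)
      show "\<psi> (- p) \<oplus>\<^bsub>Gam\<^esub> X = \<zero>\<^bsub>Gam\<^esub>" unfolding zero_Gam p(1) using SP m p(2) by (simp add: add_Gam)
      show "X \<in> carrier Gam" "\<psi> (- p) \<in> carrier Gam" using sub p m by auto
    qed
    then show "inv\<^bsub>add_monoid Gam\<^esub> X \<in> \<psi> ` {p. keys p \<subseteq> S}" using m unfolding a_inv_def by auto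
    fix Y assume "Y \<in> \<psi> ` {p. keys p \<subseteq> S}"
    then obtain q where q: "Y = \<psi> q" "keys q \<subseteq> S" by blast
    then show "X \<otimes>\<^bsub>add_monoid Gam\<^esub> Y \<in> \<psi> ` {p. keys p \<subseteq> S}"
      using p SP keys_add_subset[OF p(2) q(2)] by (auto simp: add_Gam)
  next
    fix A X assume "A \<in> carrier L" "X \<in> \<psi> ` {p. keys p \<subseteq> S}"
    then obtain b t p where *: "A = fr b t" "b \<in> P" "t \<in> U" "X = \<psi> p" "keys p \<subseteq> S" by (auto elim: carrierE)
    have bpP: "b * p \<in> P" using * SP P_closed by blast
    have "keys p \<subseteq> T \<union> I'" using *(5) S by blast
    then have "keys (b * p) \<subseteq> T \<union> I'" using *(2) unfolding P_def by (intro keys_mult_upset(1)[OF upset_T]) auto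
    then obtain h where h: "h \<in> P" "cos (fr (b * p) t) = \<psi> (restr T (b * p * h))"
      using reduce_fraction[OF bpP _ *(3)] by metis
    have "keys (b * p * h) \<subseteq> {a + c | a c. a \<in> S \<and> c \<in> mon V}"
    proof -
      have "b * h \<in> P" using *(2) h(1) by (rule P_closed)
      then have "keys (p * (b * h)) \<subseteq> {a + c | a c. a \<in> S \<and> c \<in> mon V}"
        using *(5) unfolding P_def by (intro keys_mult_subset) blast
      then show ?thesis by (simp only: mult_ac)
    qed
    then have "keys (restr T (b * p * h)) \<subseteq> S" unfolding keys_restr using closed by blast
    then show "A \<odot>\<^bsub>Gam\<^esub> X \<in> \<psi> ` {p. keys p \<subseteq> S}"
      using smult_Gam[OF *(2,3) SP[OF *(5)]] h(2) *(1,4) by auto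
  qed
qed

text \<open>Exponents are removed one at a time in order of increasing degree, which gives the
  longest possible chain.\<close>

lemma closed_chain:
  assumes "finite S" "S \<subseteq> T" "\<And>a c. a \<in> S \<Longrightarrow> c \<in> mon V \<Longrightarrow> a + c \<in> T \<Longrightarrow> a + c \<in> S"
  shows "\<exists>Ss. sorted_wrt (\<subset>) Ss \<and> length Ss = Suc (card S) \<and>
    (\<forall>R\<in>set Ss. R \<subseteq> S \<and> (\<forall>a c. a \<in> R \<longrightarrow> c \<in> mon V \<longrightarrow> a + c \<in> T \<longrightarrow> a + c \<in> R))"
  using assms
proof (induction S rule: finite_psubset_induct)
  case (psubset S)
  show ?case
  proof (cases "S = {}")
    case True
    then show ?thesis by (intro exI[of _ "[{}]"]) simp
  next
    case False
    \<comment> \<open>An element of least degree is not a proper multiple of another one, so the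
      rest stays closed.\<close>
    define a where "a = arg_min_on (deg_on V) S"
    have a: "a \<in> S" and min: "\<And>b. b \<in> S \<Longrightarrow> deg_on V a \<le> deg_on V b"
      unfolding a_def using arg_min_if_finite[OF psubset.hyps(1) False, of "deg_on V"] by (auto simp: not_less)
    have closed: "b + c \<in> S - {a}" if b: "b \<in> S - {a}" and c: "c \<in> mon V" and "b + c \<in> T" for b c
    proof -
      have "b + c \<noteq> a"
      proof
        assume eq: "b + c = a"
        then have "c \<noteq> 0" using b by auto
        then have "deg_on V b < deg_on V a" using deg_on_pos[OF finite_V c] unfolding eq[symmetric] deg_on_add by simp
        then show False using min b by fastforce
      qed
      then show ?thesis using psubset.prems(2)[of b c] that by blast
    qed
    have "S - {a} \<subset> S" using a by blast
    from psubset.IH[OF this _ closed] psubset.prems(1) obtain Ss where Ss: "sorted_wrt (\<subset>) Ss" "length Ss = Suc (card (S - {a}))"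
      "\<forall>R\<in>set Ss. R \<subseteq> S - {a} \<and> (\<forall>a c. a \<in> R \<longrightarrow> c \<in> mon V \<longrightarrow> a + c \<in> T \<longrightarrow> a + c \<in> R)" by blast
    have "sorted_wrt (\<subset>) (Ss @ [S])" using Ss(1,3) a by (auto simp: sorted_wrt_append)
    moreover have "length (Ss @ [S]) = Suc (card S)"
      using Ss(2) a psubset.hyps(1) by (metis card_Suc_Diff1 length_append_singleton)
    moreover have "\<forall>R\<in>set (Ss @ [S]). R \<subseteq> S \<and> (\<forall>a c. a \<in> R \<longrightarrow> c \<in> mon V \<longrightarrow> a + c \<in> T \<longrightarrow> a + c \<in> R)"
      using Ss(3) psubset.prems(2) by auto
    ultimately show ?thesis by blast
  qed
qed

text \<open>Submodules pull back along \<open>\<psi>\<close> to subspaces of the polynomials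
  supported in \<open>T\<close>, whose dimension bounds chains from above. Closed subsets of
  \<open>T\<close>, removing one exponent at a time, give a chain of submodules of that
  length.\<close>

theorem length_Gam: "module_length L Gam = enat (card T)"
proof (rule antisym)
  have fin: "finite T" using finite_T unfolding T_def .
  show "module_length L Gam \<le> enat (card T)"
    unfolding module_length_def
  proof (rule SUP_least)
    fix Ns assume "Ns \<in> {Ns. Ns \<noteq> [] \<and> (\<forall>N\<in>set Ns. submodule N L Gam) \<and> sorted_wrt (\<subset>) Ns}"
    then have Ns: "\<forall>N\<in>set Ns. submodule N L Gam" "sorted_wrt (\<subset>) Ns" by auto
    \<comment> \<open>The pull-back is a subspace over the field because constants act as fractions
      with denominator 1.\<close>
    define W where "W N = {p. keys p \<subseteq> T \<and> \<psi> p \<in> N}" for N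
    have sub: "mpoly.subspace (W N)" if "N \<in> set Ns" for N
    proof -
      interpret N: submodule N L Gam using Ns that by blast
      show ?thesis
        unfolding mpoly.subspace_def
      proof (intro conjI ballI allI)
        show "0 \<in> W N" unfolding W_def using N.one_closed by (simp add: zero_Gam)
        show "p + q \<in> W N" if "p \<in> W N" "q \<in> W N" for p q
          using that N.m_closed[of "\<psi> p" "\<psi> q"] keys_add_subset[of p T q] T_P
          unfolding W_def by (simp add: add_Gam)
        show "const c * p \<in> W N" if "p \<in> W N" for c p
        proof -
          have "keys (const c * p) \<subseteq> T"
            using that unfolding W_def const_eq by (auto simp: in_keys_iff lookup_const_mult subset_iff)
          moreover have "fr (const c) 1 \<odot>\<^bsub>Gam\<^esub> \<psi> p = \<psi> (const c * p)"
            using that smult_Gam[OF P_closed(1) U_1 T_P] unfolding W_def \<psi>_def by simp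
          ultimately show ?thesis
            using N.smult_closed[OF fr_carrier[OF P_closed(1)[of c] U_1], of "\<psi> p"] that unfolding W_def by simp
        qed
      qed
    qed
    have "sorted_wrt (\<lambda>N N'. W N \<subset> W N') Ns"
      using Ns(2)
    proof (rule sorted_wrt_mono_rel[rotated])
      fix N N' assume N: "N \<in> set Ns" "N' \<in> set Ns" "N \<subset> N'"
      interpret N': submodule N' L Gam using Ns N by blast
      obtain X where X: "X \<in> N'" "X \<notin> N" using N(3) by blast
      then have "X \<in> carrier Gam" using N'.mem_carrier by simp
      then obtain p where "X = \<psi> p" "keys p \<subseteq> T" unfolding carrier_Gam by blast
      then show "W N \<subset> W N'" unfolding W_def using X N(3) by blast
    qed
    then have "sorted_wrt (\<subset>) (map W Ns)" by (simp only: sorted_wrt_map)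
    moreover have "\<forall>S\<in>set (map W Ns). mpoly.subspace S \<and> S \<subseteq> {p. keys p \<subseteq> T}"
      using sub unfolding W_def by auto
    ultimately have "length (map W Ns) \<le> Suc (card T)" using subspace_chain_length[OF fin] by blast
    then show "enat (length Ns - 1) \<le> enat (card T)" by simp
  qed
  obtain Ss where Ss: "sorted_wrt (\<subset>) Ss" "length Ss = Suc (card T)"
    "\<forall>R\<in>set Ss. R \<subseteq> T \<and> (\<forall>a c. a \<in> R \<longrightarrow> c \<in> mon V \<longrightarrow> a + c \<in> T \<longrightarrow> a + c \<in> R)"
    using closed_chain[OF fin] by auto
  define N where "N S = \<psi> ` {p. keys p \<subseteq> S}" for S
  have "sorted_wrt (\<lambda>S S'. N S \<subset> N S') Ss"
    using Ss(1)
  proof (rule sorted_wrt_mono_rel[rotated])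
    fix S S' assume S: "S \<in> set Ss" "S' \<in> set Ss" "S \<subset> S'"
    obtain a where a: "a \<in> S'" "a \<notin> S" using S(3) by blast
    have sub: "S \<subseteq> T" "S' \<subseteq> T" using Ss(3) S by auto
    have "\<psi> (single a 1) \<in> N S'" unfolding N_def using a by auto
    moreover have "\<psi> (single a 1) \<notin> N S"
    proof
      assume "\<psi> (single a 1) \<in> N S"
      then obtain p where p: "\<psi> (single a 1) = \<psi> p" "keys p \<subseteq> S" unfolding N_def by blast
      have "single a 1 = p" using sub a p by (intro inj_onD[OF inj_\<psi> p(1)]) auto
      then show False using p(2) a(2) by auto
    qed
    moreover have "N S \<subseteq> N S'" unfolding N_def using S(3) by blast
    ultimately show "N S \<subset> N S'" by blast
  qed
  then have sorted: "sorted_wrt (\<subset>) (map N Ss)" by (simp only: sorted_wrt_map)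
  moreover have "\<forall>X\<in>set (map N Ss). submodule X L Gam"
    using Ss(3) unfolding N_def by (auto intro!: submodule_closed_subset)
  moreover have "map N Ss \<noteq> []" using Ss(2) by auto
  ultimately have "enat (length (map N Ss) - 1) \<le> module_length L Gam"
    unfolding module_length_def by (intro SUP_upper) blast
  then show "enat (card T) \<le> module_length L Gam" using Ss(2) by simp
qed

end

section \<open>The multiplicities of the edge ideal and of the edge subring\<close>

context uniform_edges
begin

lemma upset_N: "upset V (N t)"
  unfolding upset_def using N_subset_mon N_add_mon by blast

lemma S_1: "S 1 = ind ` E"
  unfolding One_nat_def S_Suc by auto

lemma N_sum: "{a + b | a b. a \<in> N t \<and> b \<in> N 1} = N (Suc t)"
proof (intro equalityI subsetI)
  fix c assume "c \<in> {a + b | a b. a \<in> N t \<and> b \<in> N 1}"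
  then obtain a b where c: "c = a + b" "a \<in> N t" "b \<in> N 1" by blast
  then obtain s d where "b = s + d" "s \<in> S 1" "d \<in> mon V" unfolding N_def by blast
  then have "a + s + d \<in> N (t + 1)" using c(2) by (intro N_add_mon N_add_S)
  then show "c \<in> N (Suc t)" unfolding c(1) \<open>b = s + d\<close> by (simp add: add.assoc)
next
  fix c assume "c \<in> N (Suc t)"
  then obtain e s b where c: "c = ind e + s + b" "e \<in> E" "s \<in> S t" "b \<in> mon V" unfolding N_def S_Suc by blast
  then have "s + b \<in> N t" "ind e \<in> N 1" by (auto simp only: intro: N_add_mon S_subset_N S_ind)
  moreover have "c = (s + b) + ind e" unfolding c(1) by (simp add: add_ac)
  ultimately show "c \<in> {a + b | a b. a \<in> N t \<and> b \<in> N 1}" by blast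
qed

lemma j_multiplicity_edge_ideal:
  fixes K :: "'k::field itself"
  shows "j_multiplicity (local_polynomial_ring K V) (edge_ideal K \<lparr>nodes = V, edges = E\<rparr>)
    = fact (card V - 1) * lim (\<lambda>t. real (card (M t)) / real t ^ (card V - 1))"
proof -
  interpret O: origin K V by unfold_locales (rule finite_V)
  have "edge_ideal K \<lparr>nodes = V, edges = E\<rparr> = Idl\<^bsub>local_polynomial_ring K V\<^esub> ((\<lambda>a. O.fr (single a 1) 1) ` ind ` E)"
    unfolding edge_ideal_def hypergraph.simps O.units_eq
  proof (rule arg_cong[where f = "genideal _"])
    have "fraction (polynomial_ring K V) O.U (edge_monomial e) 1 = O.fr (single (ind e) 1) 1" if "e \<in> E" for e
      unfolding edge_monomial_eq[OF finite_edge[OF that]]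
      by (rule O.fraction_eq[OF O.single_P[OF ind_in_mon[OF edge_subset[OF that]]] O.U_1])
    then show "(\<lambda>e. fraction (polynomial_ring K V) O.U (edge_monomial e) 1) ` E = (\<lambda>a. O.fr (single a 1) 1) ` ind ` E"
      unfolding image_image by (rule image_cong[OF refl])
  qed
  also have "\<dots> = O.Loc (O.up (ind ` E))"
    by (rule O.genideal_Loc) (use ind_in_mon[OF edge_subset] in blast)
  also have "O.up (ind ` E) = N 1" unfolding O.up_def N_def S_1 ..
  finally have power: "edge_ideal K \<lparr>nodes = V, edges = E\<rparr> [^]\<^bsub>ideals_set (local_polynomial_ring K V)\<^esub> t = O.Loc (N t)" for t
    using O.power_Loc[of N, OF upset_N N_0 N_sum] by simp
  have "module_length (local_polynomial_ring K V) (local_cohomology0 (local_polynomial_ring K V)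
      (the_maximal_ideal (local_polynomial_ring K V))
      (quotient_module (ideal_module (local_polynomial_ring K V) (O.Loc (N t))) (O.Loc (N (Suc t))))) = enat (card (M t))" for t
  proof -
    interpret Q: origin_quotient K V "N t" "N (Suc t)"
      using finite_M[of t] upset_N N_Suc_subset unfolding M_def by unfold_locales blast+
    show ?thesis using Q.length_Gam unfolding Q.Gam_def Q.Q_def Q.T_def M_def .
  qed
  then show ?thesis
    unfolding j_multiplicity_def O.krull_dim_L power Let_def by simp
qed

end

lemma (in linked_edges) edge_subring_multiplicity_eq:
  "edge_subring_multiplicity TYPE('k::field) \<lparr>nodes = V, edges = E\<rparr>
    = fact (card V - 1) * lim (\<lambda>t. real (card (S t)) / real t ^ (card V - 1))"
proof -
  \<comment> \<open>The dimension is positive, which selects the limit branch of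
    \<open>graded_multiplicity\<close>.\<close>
  have "card V \<noteq> 0" using finite_V V_nonempty by simp
  then show ?thesis
    unfolding edge_subring_multiplicity_def graded_multiplicity_def krull_dim_edge_subring
      dim_edge_subring_component Let_def by simp
qed

text \<open>\<open>M t\<close> is at most a constant multiple of \<open>S t\<close>, whose growth
  stays one power of \<open>t\<close> below the normalization; \<open>t + 1 \<le> 2 * t\<close>
  accounts for the constant 2^k.\<close>

lemma (in uniform_edges) degenerate_limit:
  assumes "2 \<le> card V" "\<And>t. card (S t) \<le> (t + 1) ^ (card V - 2)"
  shows "(\<lambda>t. real (card (M t)) / real t ^ (card V - 1)) \<longlonglongrightarrow> 0"
proof -
  obtain C where C: "\<And>t. card (M t) \<le> C * card (S t)" using card_M_le by blast
  define k where "k = card V - 2"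
  have k: "card V - 1 = Suc k" unfolding k_def using assms(1) by simp
  show ?thesis
  proof (rule tendsto_0_le[where K = "real C * 2 ^ k"])
    show "(\<lambda>t. inverse (real t)) \<longlonglongrightarrow> 0" by (rule lim_inverse_n)
    show "\<forall>\<^sub>F t in sequentially. norm (real (card (M t)) / real t ^ (card V - 1)) \<le> norm (inverse (real t)) * (real C * 2 ^ k)"
      unfolding eventually_sequentially
    proof (intro exI[of _ 1] allI impI)
      fix t :: nat assume t: "1 \<le> t"
      have "card (M t) \<le> C * (2 * t) ^ k"
      proof -
        have "(t + 1) ^ k \<le> (2 * t) ^ k" using t by (intro power_mono) auto
        then have "card (S t) \<le> (2 * t) ^ k" using assms(2)[of t] unfolding k_def by linarith
        then show ?thesis using C[of t] mult_le_mono2 order_trans by blast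
      qed
      then have "real (card (M t)) \<le> real (C * (2 * t) ^ k)" by (simp only: of_nat_le_iff)
      then have "real (card (M t)) / real t ^ Suc k \<le> real (C * (2 * t) ^ k) / real t ^ Suc k"
        by (rule divide_right_mono) simp
      also have "\<dots> = inverse (real t) * (real C * 2 ^ k)"
      proof -
        have "real C * (2 ^ k * a) / (real t * a) = inverse (real t) * (real C * 2 ^ k)" if "a > 0" for a :: real
          using that by (simp add: divide_inverse)
        from this[of "real t ^ k"] show ?thesis
          using t by (simp only: of_nat_mult of_nat_power power_mult_distrib power_Suc of_nat_numeral) simp
      qed
      finally show "norm (real (card (M t)) / real t ^ (card V - 1)) \<le> norm (inverse (real t)) * (real C * 2 ^ k)"
        unfolding k by simp
    qed
  qed
qed

theorem theorem7p5:
  fixes G :: "'v hypergraph" and m :: nat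
  assumes "hypergraph G"
    and "no_isolated_nodes G"
    and "uniform m G"
    and "\<forall>H \<in> connected_components G. properly_connected m H"
    and "j_multiplicity (local_polynomial_ring TYPE('k::field) (nodes G)) (edge_ideal TYPE('k) G) \<noteq> 0"
  shows "j_multiplicity (local_polynomial_ring TYPE('k) (nodes G)) (edge_ideal TYPE('k) G)
    = real m ^ card (connected_components G) * edge_subring_multiplicity TYPE('k) G"
proof -
  interpret proper_hypergraph G m using assms(1-4) by unfold_locales blast+
  let ?n = "card (nodes G) - 1"
  have G: "\<lparr>nodes = nodes G, edges = edges G\<rparr> = G" by simp
  have j: "j_multiplicity (local_polynomial_ring TYPE('k) (nodes G)) (edge_ideal TYPE('k) G)
    = fact ?n * lim (\<lambda>t. real (card (M t)) / real t ^ ?n)"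
    using j_multiplicity_edge_ideal[of "TYPE('k)"] unfolding G .
  \<comment> \<open>The degenerate alternative would make the \<open>j\<close>-multiplicity
    vanish.\<close>
  have linked: "linked_edges (nodes G) (edges G) m rep"
  proof (rule ccontr)
    assume "\<not> ?thesis"
    then have "(\<lambda>t. real (card (M t)) / real t ^ ?n) \<longlonglongrightarrow> 0"
      using linked_or_degenerate by (intro degenerate_limit) auto
    then show False using assms(5) unfolding j by (simp add: limI)
  qed
  then interpret Lk: linked_edges "nodes G" "edges G" m rep .
  \<comment> \<open>Convergence makes \<open>lim\<close> an actual limit, which the comparison can
    then multiply by the number of cosets.\<close>
  have "(\<lambda>t. real (card (S t)) / real t ^ ?n) \<longlonglongrightarrow> lim (\<lambda>t. real (card (S t)) / real t ^ ?n)"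
    using convergent_card_S by (simp add: convergent_LIMSEQ_iff)
  from Lk.card_M_tendsto[OF this]
  have "lim (\<lambda>t. real (card (M t)) / real t ^ ?n) = real m ^ card (rep ` nodes G) * lim (\<lambda>t. real (card (S t)) / real t ^ ?n)"
    unfolding Lk.C_def by (rule limI)
  moreover have "edge_subring_multiplicity TYPE('k) G = fact ?n * lim (\<lambda>t. real (card (S t)) / real t ^ ?n)"
    using Lk.edge_subring_multiplicity_eq[where 'k = 'k] unfolding G .
  ultimately show ?thesis unfolding j card_components by simp
qed

end
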